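(* Let $G$ be a minimal $(3,3)$-Ramsey graph such that $\omega(G) < 5$ and $|V(G)| \geq 30$. Then $\alpha(G) \leq |V(G)| - 10$.
   Context: All graphs are finite, undirected, without loops or multiple edges. $V(G)$ is the vertex set of $G$, $\alpha(G)$ its independence number, $\omega(G)$ its clique number. A graph $G$ is a $(3,3)$-Ramsey graph, written $G \rightarrow (3,3)$, if every coloring of the edges of $G$ with two colors contains a monochromatic triangle. $G$ is a minimal $(3,3)$-Ramsey graph if $G \rightarrow (3,3)$ and no proper subgraph $H$ of $G$ satisfies $H \rightarrow (3,3)$. *)

theory Defs
  imports "Graph_Theory.Digraph_Component"
begin

text \<open>
  A finite simple undirected graph is a \<^locale>\<open>pair_graph\<close>: a finite, loop-free digraph
  whose arcs are ordered pairs and whose arc set is symmetric. The undirected edge joining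
  \<open>u\<close> and \<open>v\<close> is represented by the two arcs \<open>(u, v)\<close> and \<open>(v, u)\<close>.
\<close>

definition is_clique :: "'a pair_pre_digraph \<Rightarrow> 'a set \<Rightarrow> bool" where
  "is_clique G S \<longleftrightarrow>
     S \<subseteq> pverts G \<and> (\<forall>u\<in>S. \<forall>v\<in>S. u \<noteq> v \<longrightarrow> (u, v) \<in> parcs G)"

definition is_independent :: "'a pair_pre_digraph \<Rightarrow> 'a set \<Rightarrow> bool" where
  "is_independent G S \<longleftrightarrow>
     S \<subseteq> pverts G \<and> (\<forall>u\<in>S. \<forall>v\<in>S. (u, v) \<notin> parcs G)"

definition clique_number :: "'a pair_pre_digraph \<Rightarrow> nat" where
  "clique_number G = Max {card S | S. is_clique G S}"

definition independence_number :: "'a pair_pre_digraph \<Rightarrow> nat" where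
  "independence_number G = Max {card S | S. is_independent G S}"

definition is_triangle :: "'a pair_pre_digraph \<Rightarrow> 'a set \<Rightarrow> bool" where
  "is_triangle G T \<longleftrightarrow> is_clique G T \<and> card T = 3"

text \<open>
  An edge colouring is a function on unordered pairs \<open>{u, v}\<close>, so the two arcs of an
  undirected edge get the same colour. Its values on sets that are not edges are irrelevant.
\<close>

definition monochromatic_triangle ::
    "'a pair_pre_digraph \<Rightarrow> ('a set \<Rightarrow> bool) \<Rightarrow> 'a set \<Rightarrow> bool" where
  "monochromatic_triangle G c T \<longleftrightarrow>
     is_triangle G T \<and> (\<exists>b. \<forall>u\<in>T. \<forall>v\<in>T. u \<noteq> v \<longrightarrow> c {u, v} = b)"

definition ramsey_3_3 :: "'a pair_pre_digraph \<Rightarrow> bool" where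
  "ramsey_3_3 G \<longleftrightarrow> (\<forall>c. \<exists>T. monochromatic_triangle G c T)"

text \<open>
  Proper subgraphs may omit vertices as well as edges. The requirement
  \<^term>\<open>pair_graph H\<close> makes \<open>H\<close> an undirected graph, as \<^const>\<open>subgraph\<close> alone would
  allow deleting just one of the two arcs of an edge.
\<close>

definition minimal_ramsey_3_3 :: "'a pair_pre_digraph \<Rightarrow> bool" where
  "minimal_ramsey_3_3 G \<longleftrightarrow>
     ramsey_3_3 G \<and>
     \<not> (\<exists>H. pair_graph H \<and> subgraph (with_proj H) (with_proj G) \<and> H \<noteq> G \<and> ramsey_3_3 H)"

end

theory Submission
  imports Defs
begin

text \<open>
  Let \<open>A\<close> be an independent set missing exactly nine vertices, and let \<open>H\<close> be the graph induced
  on those nine. A colouring of \<open>H\<close> without monochromatic triangle extends to \<open>a \<in> A\<close> iff the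
  neighbourhood \<open>N(a)\<close> \<^emph>\<open>splits\<close>, that is, is the union of a set without red edges and a set
  without blue edges; otherwise \<open>N(a)\<close> \<^emph>\<open>blocks\<close> the colouring. So \<open>G\<close> is a Ramsey graph iff
  every such colouring of \<open>H\<close> is blocked, and by minimality \<open>A\<close> is no larger than any
  subset of \<open>A\<close> whose neighbourhoods still block everything.

  As \<open>G\<close> has no 5-clique, every \<open>N(a)\<close> is free of 4-cliques. For most graphs \<open>H\<close> there is a
  colouring under which all 4-clique-free sets split, a contradiction. For each of the others there are colourings
  \<open>c\<^sub>1, \<dots>, c\<^sub>m\<close> and lists \<open>p\<^sub>1, \<dots>, p\<^sub>m\<close> of vertex sets such that a 4-clique-free set
  blocking \<open>c\<^sub>i\<close> contains a member of \<open>p\<^sub>i\<close>, while every colouring is blocked by all the members of some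
  \<open>p\<^sub>i\<close>. Neighbourhoods that between them contain a member of every \<open>p\<^sub>i\<close> therefore suffice, and
  20 of them always do. The extremal case is the complement of the 9-cycle.

  The graphs \<open>H\<close> are enumerated through sets \<open>P\<close> of known non-edges, up to isomorphism and
  starting from \<open>P = {}\<close>: whenever an argument at \<open>P\<close> needs certain pairs to be edges, either
  they are, or one of them joins \<open>P\<close> and the enlarged set contains an image of one that is already settled.
\<close>

section \<open>Graphs on nine vertices\<close>

text \<open>A counterexample has an independent set of |V(G)| - 9 \<ge> 21 vertices, so it is enough
  to bound an independent set with nine vertices outside it by 20. The obstacle is that
  \<open>H\<close> is unknown apart from some non-edges. The two halves of the argument are monotone
  in opposite directions. A colouring of all pairs outside \<open>P\<close> restricts to every graph
  avoiding \<open>P\<close>, and fewer edges only make splitting easier, so what blocks it is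
  computed from \<open>P\<close> alone. That every colouring is blocked is derived inside a graph
  \<open>D\<close> of needed edges, and more edges only make splitting harder, so it holds for every
  \<open>H\<close> containing \<open>D\<close>. Thus finitely many partially known graphs settle all
  graphs. The count is a hypergraph problem: the vertex sets in the lists are its points, the lists
  are its edges, and the points contained in some neighbourhood form a transversal. One vertex of
  \<open>A\<close> per point of a smaller transversal is enough, so a minimal one may be taken. In
  it every point has an edge that it alone meets, and this prunes the search for large ones.\<close>

datatype vx = V0 | V1 | V2 | V3 | V4 | V5 | V6 | V7 | V8

datatype 'a nine = Nine 'a 'a 'a 'a 'a 'a 'a 'a 'a

type_synonym vset = "bool nine"
type_synonym mat = "vset nine"

definition vxs :: "vx list" where
  "vxs = [V0, V1, V2, V3, V4, V5, V6, V7, V8]"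

fun get :: "'a nine \<Rightarrow> vx \<Rightarrow> 'a" where
  "get (Nine a b c d e f g h i) V0 = a"
| "get (Nine a b c d e f g h i) V1 = b"
| "get (Nine a b c d e f g h i) V2 = c"
| "get (Nine a b c d e f g h i) V3 = d"
| "get (Nine a b c d e f g h i) V4 = e"
| "get (Nine a b c d e f g h i) V5 = f"
| "get (Nine a b c d e f g h i) V6 = g"
| "get (Nine a b c d e f g h i) V7 = h"
| "get (Nine a b c d e f g h i) V8 = i"

fun put :: "'a nine \<Rightarrow> vx \<Rightarrow> 'a \<Rightarrow> 'a nine" where
  "put (Nine a b c d e f g h i) V0 z = Nine z b c d e f g h i"
| "put (Nine a b c d e f g h i) V1 z = Nine a z c d e f g h i"
| "put (Nine a b c d e f g h i) V2 z = Nine a b z d e f g h i"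
| "put (Nine a b c d e f g h i) V3 z = Nine a b c z e f g h i"
| "put (Nine a b c d e f g h i) V4 z = Nine a b c d z f g h i"
| "put (Nine a b c d e f g h i) V5 z = Nine a b c d e z g h i"
| "put (Nine a b c d e f g h i) V6 z = Nine a b c d e f z h i"
| "put (Nine a b c d e f g h i) V7 z = Nine a b c d e f g z i"
| "put (Nine a b c d e f g h i) V8 z = Nine a b c d e f g h z"

definition nine_of :: "'a \<Rightarrow> 'a nine" where
  "nine_of x = Nine x x x x x x x x x"

abbreviation none :: vset where "none \<equiv> nine_of False"

fun apart :: "vset \<Rightarrow> vset \<Rightarrow> bool" where
  "apart (Nine a b c d e f g h i) (Nine a' b' c' d' e' f' g' h' i') =
     (\<not> (a \<and> a') \<and> \<not> (b \<and> b') \<and> \<not> (c \<and> c') \<and> \<not> (d \<and> d') \<and> \<not> (e \<and> e') \<and>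
      \<not> (f \<and> f') \<and> \<not> (g \<and> g') \<and> \<not> (h \<and> h') \<and> \<not> (i \<and> i'))"

fun neither :: "vset \<Rightarrow> vset \<Rightarrow> vset" where
  "neither (Nine a b c d e f g h i) (Nine a' b' c' d' e' f' g' h' i') =
     Nine (\<not> (a \<or> a')) (\<not> (b \<or> b')) (\<not> (c \<or> c')) (\<not> (d \<or> d')) (\<not> (e \<or> e'))
       (\<not> (f \<or> f')) (\<not> (g \<or> g')) (\<not> (h \<or> h')) (\<not> (i \<or> i'))"

abbreviation linked :: "mat \<Rightarrow> vx \<Rightarrow> vx \<Rightarrow> bool" where "linked m u v \<equiv> get (get m u) v"

abbreviation nomat :: mat where "nomat \<equiv> nine_of none"

definition link :: "mat \<Rightarrow> vx \<Rightarrow> vx \<Rightarrow> mat" where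
  "link m u v = (let m' = put m u (put (get m u) v True) in put m' v (put (get m' v) u True))"

fun links :: "vx list \<Rightarrow> mat \<Rightarrow> mat" where
  "links (u # v # ds) m = links ds (link m u v)"
| "links _ m = m"

text \<open>The complement of \<open>P \<union> R\<close>: with \<open>P\<close> the non-edges and \<open>R\<close> the red edges, the blue ones.\<close>

definition others :: "mat \<Rightarrow> mat \<Rightarrow> mat" where
  "others P R = Nine 
    (put (neither (get P V0) (get R V0)) V0 False)
    (put (neither (get P V1) (get R V1)) V1 False)
    (put (neither (get P V2) (get R V2)) V2 False)
    (put (neither (get P V3) (get R V3)) V3 False)
    (put (neither (get P V4) (get R V4)) V4 False)
    (put (neither (get P V5) (get R V5)) V5 False)
    (put (neither (get P V6) (get R V6)) V6 False)
    (put (neither (get P V7) (get R V7)) V7 False)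
    (put (neither (get P V8) (get R V8)) V8 False)"

section \<open>Triangle-free colour classes and splitting sets\<close>

text \<open>An edge lies in no triangle iff the rows of its two ends are disjoint, so one test of
  two rows replaces the search for a third vertex.\<close>

fun tfree_row :: "mat \<Rightarrow> vx \<Rightarrow> vx list \<Rightarrow> bool" where
  "tfree_row m u [] = True"
| "tfree_row m u (v # vs) =
     ((if linked m u v then apart (get m u) (get m v) else True) \<and> tfree_row m u vs)"

fun tfree_rows :: "mat \<Rightarrow> vx list \<Rightarrow> bool" where
  "tfree_rows m [] = True"
| "tfree_rows m (u # us) = (tfree_row m u us \<and> tfree_rows m us)"

text \<open>\<open>X\<close> collects the vertices joined in red to a new vertex, \<open>Y\<close>
  those joined in blue. A vertex may enter \<open>X\<close> only if it has no red edge into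
  \<open>X\<close>, and \<open>Y\<close> only if it has no blue edge into \<open>Y\<close>.\<close>

fun splittable :: "mat \<Rightarrow> mat \<Rightarrow> vx list \<Rightarrow> vset \<Rightarrow> vset \<Rightarrow> bool" where
  "splittable R B [] X Y = True"
| "splittable R B (v # vs) X Y =
     (apart (get R v) X \<and> splittable R B vs (put X v True) Y \<or> apart (get B v) Y \<and> splittable R B vs X (put Y v True))"

fun all_in :: "vx list \<Rightarrow> vset \<Rightarrow> bool" where
  "all_in [] S = True"
| "all_in (v # vs) S = (get S v \<and> all_in vs S)"

text \<open>
  Decides whether every \<open>T\<close> with \<open>K \<subseteq> T \<subseteq> S\<close> that contains none of the listed sets splits, by
  branching on the first element of the next listed set that is missing from \<open>T\<close>.
\<close>

function (sequential) unblocked :: "mat \<Rightarrow> mat \<Rightarrow> vx list list \<Rightarrow> vset \<Rightarrow> vset \<Rightarrow> bool"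
  and unblocked_minus :: "mat \<Rightarrow> mat \<Rightarrow> vx list list \<Rightarrow> vx list \<Rightarrow> vset \<Rightarrow> vset \<Rightarrow> bool" where
  "unblocked R B [] S K = splittable R B (filter (get S) vxs) none none"
| "unblocked R B (b # bs) S K = (if all_in b S then unblocked_minus R B bs b S K else unblocked R B bs S K)"
| "unblocked_minus R B bs [] S K = True"
| "unblocked_minus R B bs (v # vs) S K =
     ((get K v \<or> unblocked R B bs (put S v False) K) \<and> unblocked_minus R B bs vs S (put K v True))"
  by pat_completeness auto
termination
  by (relation "measures [\<lambda>x. case x of Inl (R, B, bs, S, K) \<Rightarrow> length bs | Inr (R, B, bs, vs, S, K) \<Rightarrow> length bs,
      \<lambda>x. case x of Inl (R, B, bs, S, K) \<Rightarrow> 0 | Inr (R, B, bs, vs, S, K) \<Rightarrow> Suc (length vs)]") auto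

text \<open>
  Certificates are strings over the digits 0 to 8, written as hexadecimal numerals with a leading 1
  that keeps initial zeros.
\<close>

fun digits :: "num \<Rightarrow> vx list \<Rightarrow> vx list" where
  "digits (num.Bit0 (num.Bit0 (num.Bit0 (num.Bit0 n)))) acc = digits n (V0 # acc)"
| "digits (num.Bit1 (num.Bit0 (num.Bit0 (num.Bit0 n)))) acc = digits n (V1 # acc)"
| "digits (num.Bit0 (num.Bit1 (num.Bit0 (num.Bit0 n)))) acc = digits n (V2 # acc)"
| "digits (num.Bit1 (num.Bit1 (num.Bit0 (num.Bit0 n)))) acc = digits n (V3 # acc)"
| "digits (num.Bit0 (num.Bit0 (num.Bit1 (num.Bit0 n)))) acc = digits n (V4 # acc)"
| "digits (num.Bit1 (num.Bit0 (num.Bit1 (num.Bit0 n)))) acc = digits n (V5 # acc)"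
| "digits (num.Bit0 (num.Bit1 (num.Bit1 (num.Bit0 n)))) acc = digits n (V6 # acc)"
| "digits (num.Bit1 (num.Bit1 (num.Bit1 (num.Bit0 n)))) acc = digits n (V7 # acc)"
| "digits (num.Bit0 (num.Bit0 (num.Bit0 (num.Bit1 n)))) acc = digits n (V8 # acc)"
| "digits _ acc = acc"

definition hex :: "int \<Rightarrow> vx list" where
  "hex k = digits (num_of_nat (nat k)) []"

text \<open>On literals the digits are read off the binary numeral in groups of four bits, without
  arithmetic. The leading 1 is \<open>num.One\<close>, which stops the recursion.\<close>

lemma hex_code [code]:
  "hex (Int.Pos n) = digits n []" "hex 0 = digits num.One []" "hex (Int.Neg n) = digits num.One []"
  by (simp_all add: hex_def Int.Pos_def Int.Neg_def num_of_nat_numeral_eq del: digits.simps)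

fun hexes :: "int list \<Rightarrow> vx list" where
  "hexes [] = []"
| "hexes (k # ks) = hex k @ hexes ks"

section \<open>Relabellings and embeddings of settled graphs\<close>

fun embeds :: "vx list \<Rightarrow> vx nine \<Rightarrow> mat \<Rightarrow> bool" where
  "embeds (u # v # ds) p m = (linked m (get p u) (get p v) \<and> embeds ds p m)"
| "embeds _ p m = True"

fun inj_digits :: "vx list \<Rightarrow> vset \<Rightarrow> bool" where
  "inj_digits [] S = True"
| "inj_digits (v # vs) S = (\<not> get S v \<and> inj_digits vs (put S v True))"

fun isperm :: "vx nine \<Rightarrow> bool" where
  "isperm (Nine a b c d e f g h i) = inj_digits [a, b, c, d, e, f, g, h, i] none"

type_synonym trie = "vx list option nine nine nine"

text \<open>\<open>pairs vxs\<close> lists the 36 unordered pairs of vertices, each in one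
  orientation only. The same list serves as fuel for \<open>place\<close>, \<open>refuted\<close>
  and \<open>covered\<close>.\<close>

fun pairs :: "'b list \<Rightarrow> ('b \<times> 'b) list" where
  "pairs [] = []"
| "pairs (x # xs) = map (Pair x) xs @ pairs xs"

text \<open>
  Backtracking search for an embedding of the graph with edge list \<open>ds\<close> into \<open>m\<close>; its result is
  checked again by \<^const>\<open>embeds\<close>, so no property of the search is needed. The first
  arguments of \<open>place\<close>, \<open>tries\<close>, \<open>refuted\<close> and \<open>covered\<close> are only fuel.
\<close>

function (sequential) place :: "'f list \<Rightarrow> mat \<Rightarrow> vx list \<Rightarrow> vx option nine \<Rightarrow> vset \<Rightarrow> (vx option nine \<times> vset) option"
  and tries :: "'f list \<Rightarrow> mat \<Rightarrow> vx list \<Rightarrow> vx option nine \<Rightarrow> vset \<Rightarrow> vx \<Rightarrow> vset \<Rightarrow> vx list \<Rightarrow>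
    (vx option nine \<times> vset) option" where
  "place (z # zs) m (u # v # ds) p F =
     (case get p u of None \<Rightarrow> tries zs m (u # v # ds) p F u F vxs
      | Some a \<Rightarrow> (case get p v of None \<Rightarrow> tries zs m (u # v # ds) p F v (get m a) vxs
          | Some b \<Rightarrow> if linked m a b then place zs m ds p F else None))"
| "place zs m ds p F = Some (p, F)"
| "tries zs m ds p F x C [] = None"
| "tries zs m ds p F x C (w # ws) =
     (case (if get C w \<and> get F w then place zs m ds (put p x (Some w)) (put F w False) else None) of
        None \<Rightarrow> tries zs m ds p F x C ws
      | Some r \<Rightarrow> Some r)"
  by pat_completeness auto
termination
  by (relation "measures [\<lambda>x. case x of Inl (zs, _) \<Rightarrow> length zs | Inr (zs, _) \<Rightarrow> length zs,
      \<lambda>x. case x of Inl _ \<Rightarrow> 0 | Inr (zs, m, ds, p, F, x, C, ws) \<Rightarrow> Suc (length ws)]") auto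

fun completion :: "vx list \<Rightarrow> vx option nine \<Rightarrow> vx list \<Rightarrow> vx nine \<Rightarrow> vx nine" where
  "completion [] p fr q = q"
| "completion (v # vs) p fr q =
     (case get p v of Some a \<Rightarrow> completion vs p fr (put q v a)
      | None \<Rightarrow> (case fr of [] \<Rightarrow> q | a # fr' \<Rightarrow> completion vs p fr' (put q v a)))"

text \<open>The default \<open>nine_of V0\<close> is constant, hence rejected by
  \<open>isperm\<close>; a failed search therefore makes the certificate fail.\<close>

fun embedding :: "vx \<Rightarrow> mat \<Rightarrow> vx list \<Rightarrow> vx nine" where
  "embedding x m [] = nine_of V0"
| "embedding x m (u # ds) =
     (case place (pairs vxs) m (u # ds) (put (nine_of None) u (Some x)) (put (nine_of True) x False) of
        None \<Rightarrow> nine_of V0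
      | Some (p, F) \<Rightarrow> completion vxs p (filter (get F) vxs) (nine_of V0))"

text \<open>Four digits: the image of the first vertex, and the index of the settled node.\<close>

fun take_branch :: "trie \<Rightarrow> mat \<Rightarrow> vx list \<Rightarrow> vx list option" where
  "take_branch T P (x # i # j # k # ds) =
     (case get (get (get T i) j) k of None \<Rightarrow> None
      | Some es \<Rightarrow> (let p = embedding x P es in if isperm p \<and> embeds es p P then Some ds else None))"
| "take_branch T P _ = None"

text \<open>The digits form one stream: each step consumes its own part and hands on the rest, so no
  separators are stored. \<open>refuted\<close> and \<open>covered\<close> read their trees in the
  same way.\<close>

fun branches :: "trie \<Rightarrow> mat \<Rightarrow> mat \<Rightarrow> (vx \<times> vx) list \<Rightarrow> vx list \<Rightarrow> bool" where
  "branches T D P [] ds = True"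
| "branches T D P ((u, v) # es) ds =
     (if linked D u v then (case take_branch T (link P u v) ds of None \<Rightarrow> False | Some ds' \<Rightarrow> branches T D P es ds')
      else branches T D P es ds)"

fun clique :: "vx list \<Rightarrow> mat \<Rightarrow> mat" where
  "clique vs m = fold (\<lambda>(u, v) m. link m u v) (pairs vs) m"

section \<open>Points, families of points and decision trees for colourings\<close>

type_synonym point_id = "vx \<times> vx"

fun point_ids :: "vx list \<Rightarrow> point_id list" where
  "point_ids (i # j # r) = (i, j) # point_ids r"
| "point_ids _ = []"

definition point :: "vx list nine nine \<Rightarrow> point_id \<Rightarrow> vx list" where
  "point t p = get (get t (fst p)) (snd p)"

fun point_table :: "int list \<Rightarrow> point_id list \<Rightarrow> vx list nine nine \<Rightarrow> vx list nine nine" where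
  "point_table (k # ks) ((i, j) # qs) t = point_table ks qs (put t i (put (get t i) j (hex k)))"
| "point_table _ _ t = t"

type_synonym htable = "point_id list option nine nine nine"

fun edge_table :: "point_id list list \<Rightarrow> (vx \<times> vx \<times> vx) list \<Rightarrow> htable \<Rightarrow> htable" where
  "edge_table (h # hs) ((i, j, k) # qs) t =
     edge_table hs qs (put t i (put (get t i) j (put (get (get t i) j) k (Some h))))"
| "edge_table _ _ t = t"

fun all_blocked :: "vx list nine nine \<Rightarrow> mat \<Rightarrow> mat \<Rightarrow> point_id list \<Rightarrow> bool" where
  "all_blocked t R B [] = True"
| "all_blocked t R B (q # qs) = (\<not> splittable R B (point t q) none none \<and> all_blocked t R B qs)"

fun leaf_ok :: "vx list nine nine \<Rightarrow> htable \<Rightarrow> mat \<Rightarrow> mat \<Rightarrow> vx list \<Rightarrow> vx list option" where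
  "leaf_ok t H R B (i # j # k # ds) =
     (case get (get (get H i) j) k of None \<Rightarrow> None
      | Some h \<Rightarrow> if all_blocked t R B h then Some ds else None)"
| "leaf_ok t H R B _ = None"

fun call :: "'b option \<Rightarrow> 'c \<Rightarrow> 'c option" where
  "call None x = None"
| "call (Some _) x = Some x"

type_synonym parts = "vx \<Rightarrow> vx \<Rightarrow> int list"

text \<open>
  A decision tree showing that every colouring of \<open>D\<close> is blocked by all members of some \<open>p\<^sub>i\<close>. The
  digits \<open>u v\<close> branch on the colour of the edge \<open>uv\<close> (red first); a child with a monochromatic
  triangle is left out, and a repeated digit starts the three-digit index of a leaf, except that
  \<open>88ij\<close> stands for the subtree \<open>Q i j\<close>. Storing parts of a large tree in the function \<open>Q\<close> hides
  them from the simplifier, whose rewriting steps cost time proportional to the size of the term.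
\<close>

fun refuted :: "'f list \<Rightarrow> parts \<Rightarrow> vx list nine nine \<Rightarrow> htable \<Rightarrow> mat \<Rightarrow> mat \<Rightarrow> mat \<Rightarrow> vx list \<Rightarrow> vx list option" where
  "refuted (z # zs) Q t H D R B (u # v # ds) =
     (if u = v then
        if u = V8 then (case ds of i # j # ds' \<Rightarrow> call (refuted zs Q t H D R B (hexes (Q i j))) ds' | _ \<Rightarrow> None)
        else leaf_ok t H R B (v # ds)
      else if linked D u v then
        (case (if apart (get R u) (get R v) then refuted zs Q t H D (link R u v) B ds else Some ds) of
           None \<Rightarrow> None
         | Some ds' \<Rightarrow> if apart (get B u) (get B v) then refuted zs Q t H D R (link B u v) ds' else Some ds')
      else None)"
| "refuted _ _ _ _ _ _ _ _ = None"

text \<open>The tree is read only with the first edge blue. Exchanging the colours preserves what is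
  blocked, so the other half follows by symmetry.\<close>

fun refuted_root :: "parts \<Rightarrow> vx list nine nine \<Rightarrow> htable \<Rightarrow> mat \<Rightarrow> vx list \<Rightarrow> bool" where
  "refuted_root Q t H D (u # v # ds) =
     (u \<noteq> v \<and> linked D u v \<and> (case refuted (pairs vxs) Q t H D nomat (link nomat u v) ds of None \<Rightarrow> False | Some _ \<Rightarrow> True))"
| "refuted_root _ _ _ _ _ = False"

section \<open>Minimal transversals of a hypergraph\<close>

fun mem :: "point_id \<Rightarrow> point_id list \<Rightarrow> bool" where
  "mem p [] = False"
| "mem p (q # qs) = (p = q \<or> mem p qs)"

fun subedge :: "point_id list \<Rightarrow> point_id list \<Rightarrow> bool" where
  "subedge [] e = True"
| "subedge (p # ps) e = (mem p e \<and> subedge ps e)"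

fun has_sub :: "point_id list list \<Rightarrow> point_id list \<Rightarrow> bool" where
  "has_sub [] e = False"
| "has_sub (m # ms) e = (subedge m e \<or> has_sub ms e)"

text \<open>One pass drops the edges that contain an earlier one. The accumulator is in reverse
  order, so a second pass drops those that contain a later one; this is why \<open>covered\<close>
  applies the function twice.\<close>

fun minimal_edges :: "point_id list list \<Rightarrow> point_id list list \<Rightarrow> point_id list list" where
  "minimal_edges [] acc = acc"
| "minimal_edges (e # es) acc = (if has_sub acc e then minimal_edges es acc else minimal_edges es (e # acc))"

fun dedup :: "point_id list \<Rightarrow> point_id list \<Rightarrow> point_id list" where
  "dedup [] acc = acc"
| "dedup (p # ps) acc = (if mem p acc then dedup ps acc else dedup ps (p # acc))"

fun without :: "point_id \<Rightarrow> point_id list list \<Rightarrow> point_id list list" where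
  "without p [] = []"
| "without p (e # es) = (if mem p e then without p es else e # without p es)"

fun drop1 :: "point_id \<Rightarrow> point_id list \<Rightarrow> point_id list" where
  "drop1 p [] = []"
| "drop1 p (q # qs) = (if p = q then drop1 p qs else q # drop1 p qs)"

fun shrunk :: "point_id \<Rightarrow> point_id list list \<Rightarrow> point_id list list" where
  "shrunk p [] = []"
| "shrunk p (e # es) = (if mem p e then drop1 p e # shrunk p es else shrunk p es)"

fun small :: "point_id list \<Rightarrow> bool" where
  "small (p # q # r # e) = False"
| "small _ = True"

definition merge_with :: "point_id list list \<Rightarrow> point_id list list \<Rightarrow> point_id list list \<Rightarrow> point_id list list" where
  "merge_with ss ms es = ms @ filter (\<lambda>e. \<not> has_sub ss e) es"

text \<open>\<open>ms\<close> are the edges from which a rejected point was deleted. Only those with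
  at most two points are used to discard larger edges, which limits the work and is harmless,
  because a discarded edge contains one that is kept.\<close>

definition merge :: "point_id list list \<Rightarrow> point_id list list \<Rightarrow> point_id list list" where
  "merge ms es = merge_with (filter small ms) ms es"

fun short :: "'b list \<Rightarrow> 'c list \<Rightarrow> bool" where
  "short [] b = True"
| "short (x # xs) [] = False"
| "short (x # xs) (y # ys) = short xs ys"

fun lonely :: "point_id \<Rightarrow> (point_id \<times> point_id list list) list \<Rightarrow> bool" where
  "lonely p [] = False"
| "lonely p ((q, l) # X) = (if p = q then l = [] else lonely p X)"

text \<open>What is left of a minimal transversal needs at most one point per remaining edge, and at
  most all remaining points. An empty edge cannot be met, so such a branch is vacuous; with the
  budget overspent (\<open>None\<close>) nothing else is accepted.\<close>

fun cover_leaf :: "point_id list list \<Rightarrow> 'c list option \<Rightarrow> bool" where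
  "cover_leaf m None = has_sub m []"
| "cover_leaf m (Some b) = (short m b \<or> short (dedup (concat m) []) b \<or> has_sub m [])"

fun spend :: "'c list option \<Rightarrow> 'c list option" where
  "spend (Some (c # cs)) = Some cs"
| "spend _ = None"

fun private_to :: "point_id \<Rightarrow> (point_id \<times> point_id list list) list \<Rightarrow> (point_id \<times> point_id list list) list" where
  "private_to p [] = []"
| "private_to p ((q, l) # X) = (q, without p l) # private_to p X"

text \<open>
  A decision tree bounding the minimal transversals of a hypergraph with edges \<open>es\<close>: the digits of
  a point branch on whether it belongs to the transversal. The points of the transversal are kept in \<open>X\<close>,
  each with the edges that no other point of \<open>X\<close> meets, \<open>es\<close> becomes the list of edges not
  met so far, and \<open>b\<close> is the remaining budget. The leaf \<open>80\<close> claims that the budget suffices for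
  what is left of the edges, and \<open>82\<close> with a point that this point of \<open>X\<close> is redundant, which
  contradicts minimality; \<open>88ij\<close> is the subtree \<open>Q i j\<close>.
\<close>

fun covered :: "'f list \<Rightarrow> parts \<Rightarrow> point_id list list \<Rightarrow> (point_id \<times> point_id list list) list \<Rightarrow> 'c list option \<Rightarrow> vx list \<Rightarrow> vx list option" where
  "covered (z # zs) Q es X b (i # j # ds) =
     (if i = V8 then
        if j = V0 then if cover_leaf (minimal_edges (minimal_edges es []) []) b then Some ds else None
        else (case ds of
            x # y # ds' \<Rightarrow> if j = V8 then call (covered zs Q es X b (hexes (Q x y))) ds'
              else if lonely (x, y) X then Some ds' else None
          | _ \<Rightarrow> None)
      else if mem (i, j) (map fst X) then None
      else
        (case covered zs Q (without (i, j) es) (((i, j), shrunk (i, j) es) # private_to (i, j) X) (spend b) ds of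
           None \<Rightarrow> None
         | Some ds' \<Rightarrow> covered zs Q (merge (shrunk (i, j) es) (without (i, j) es)) X b ds'))"
| "covered _ _ _ _ _ _ = None"

section \<open>Certificates and their validation\<close>

definition no_parts :: parts where
  "no_parts i j = []"

datatype fam = Fam int int

text \<open>
  How a set \<open>P\<close> of non-edges is settled: by five vertices that would form a clique; by a
  colouring, given by its red edges, whose only obstructions are the listed 4-cliques; or by a system
  of further needed edges, the sets occurring in the \<open>p\<^sub>i\<close>, automorphisms, pairs of \<open>c\<^sub>i\<close> and
  \<open>p\<^sub>i\<close>, and the two decision trees. The last component lists the branches for the pairs that have to be edges.
\<close>

datatype cert =
    Clique5 int "int list"
  | Nice "int list" int "int list"
  | System "int list" int "int list" "int list" "fam list" "int list" parts "int list" parts "int list"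

fun cliques :: "int list \<Rightarrow> mat \<Rightarrow> mat" where
  "cliques [] m = m"
| "cliques (k # ks) m = cliques ks (clique (hex k) m)"

fun quad :: "vx list \<Rightarrow> bool" where
  "quad [a, b, c, d] = inj_digits [a, b, c, d] none"
| "quad _ = False"

fun quint :: "vx list \<Rightarrow> bool" where
  "quint [a, b, c, d, e] = inj_digits [a, b, c, d, e] none"
| "quint _ = False"

text \<open>Every pair outside \<open>P\<close> is coloured, whether or not it turns out to be an
  edge. Removing edges from this largest graph creates no monochromatic triangle and destroys no
  splitting, so the check is valid for all graphs avoiding \<open>P\<close>.\<close>

definition colouring_ok :: "mat \<Rightarrow> mat \<Rightarrow> vx list list \<Rightarrow> bool" where
  "colouring_ok P R bs =
     (let B = others P R in tfree_rows R vxs \<and> tfree_rows B vxs \<and> unblocked R B bs (nine_of True) none)"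

fun vset_of :: "vx nine \<Rightarrow> vx list \<Rightarrow> vset \<Rightarrow> vset" where
  "vset_of p [] S = S"
| "vset_of p (v # vs) S = vset_of p vs (put S (get p v) True)"

fun same_points :: "vx list nine nine \<Rightarrow> vx nine \<Rightarrow> point_id list \<Rightarrow> point_id list \<Rightarrow> bool" where
  "same_points t p [] [] = True"
| "same_points t p (q # qs) (r # rs) = (all_in (point t r) (vset_of p (point t q) none) \<and> same_points t p qs rs)"
| "same_points t p _ _ = False"

fun embeds_pairs :: "(vx \<times> vx) list \<Rightarrow> vx nine \<Rightarrow> mat \<Rightarrow> bool" where
  "embeds_pairs [] p m = True"
| "embeds_pairs ((u, v) # es) p m = ((if linked m u v then linked m (get p u) (get p v) else True) \<and> embeds_pairs es p m)"

text \<open>Only a guess at the name of the image of a point. \<open>same_points\<close> checks it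
  again, so the default \<open>(V0, V0)\<close> does no harm.\<close>

fun locate :: "(point_id \<times> vx list) list \<Rightarrow> vset \<Rightarrow> point_id" where
  "locate [] S = (V0, V0)"
| "locate ((r, vs) # ix) S = (if all_in vs S then r else locate ix S)"

fun automorphic_image :: "vx list nine nine \<Rightarrow> (point_id \<times> vx list) list \<Rightarrow> mat \<Rightarrow> mat \<Rightarrow> point_id list \<Rightarrow> vx list \<Rightarrow> point_id list option" where
  "automorphic_image t ix P D h [a, b, c, d, e, f, g, x, y] =
     (let p = Nine a b c d e f g x y; h' = map (\<lambda>q. locate ix (vset_of p (point t q) none)) h in
      if isperm p \<and> embeds_pairs (pairs vxs) p P \<and> embeds_pairs (pairs vxs) p D \<and> same_points t p h h' then Some h' else None)"
| "automorphic_image t ix P D h _ = None"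

fun automorphic_images :: "vx list nine nine \<Rightarrow> (point_id \<times> vx list) list \<Rightarrow> mat \<Rightarrow> mat \<Rightarrow> point_id list \<Rightarrow> int list \<Rightarrow> point_id list list option" where
  "automorphic_images t ix P D h [] = Some []"
| "automorphic_images t ix P D h (k # ks) =
     (case automorphic_image t ix P D h (hex k) of None \<Rightarrow> None
      | Some h' \<Rightarrow> (case automorphic_images t ix P D h ks of None \<Rightarrow> None | Some hs \<Rightarrow> Some (h' # hs)))"

fun families :: "vx list nine nine \<Rightarrow> (point_id \<times> vx list) list \<Rightarrow> int list \<Rightarrow> mat \<Rightarrow> mat \<Rightarrow> vx list list \<Rightarrow> fam list \<Rightarrow>
    point_id list list option" where
  "families t ix ks P D q [] = Some []"
| "families t ix ks P D q (Fam r h # fs) =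
     (let h' = point_ids (hex h) in
      if colouring_ok P (links (hex r) nomat) (map (point t) h' @ q) then
        (case automorphic_images t ix P D h' ks of None \<Rightarrow> None
         | Some hs \<Rightarrow> (case families t ix ks P D q fs of None \<Rightarrow> None | Some hs' \<Rightarrow> Some (h' # hs @ hs')))
      else None)"

fun node_mat :: "vx list \<Rightarrow> mat" where
  "node_mat (i # j # k # ds) = links ds nomat"
| "node_mat _ = nomat"

text \<open>The number 20 in unary, one less than the 30 - 9 = 21 vertices that a counterexample
  would have in \<open>A\<close>.\<close>

definition budget :: "vx list" where
  "budget = [V0, V0, V0, V0, V0, V0, V0, V0, V0, V0, V0, V0, V0, V0, V0, V0, V0, V0, V0, V0]"

fun valid :: "trie \<Rightarrow> vx list \<Rightarrow> cert \<Rightarrow> bool" where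
  "valid T k (Clique5 c bs) = (quint (hex c) \<and> branches T (clique (hex c) nomat) (node_mat k) (pairs vxs) (hexes bs))"
| "valid T k (Nice qs r bs) =
     (let P = node_mat k in
      list_all (\<lambda>q. quad (hex q)) qs \<and> colouring_ok P (links (hex r) nomat) (map hex qs) \<and>
      branches T (cliques qs nomat) P (pairs vxs) (hexes bs))"
| "valid T k (System qs e ps as fs tr Q cs Q' bs) =
     (let P = node_mat k; D = links (hex e) (cliques qs nomat);
          t = point_table ps (List.product vxs vxs) (nine_of (nine_of [])) in
      list_all (\<lambda>q. quad (hex q)) qs \<and>
      (case families t (zip (List.product vxs vxs) (map hex ps)) as P D (map hex qs) fs of None \<Rightarrow> False
       | Some hs \<Rightarrow>
          refuted_root Q t (edge_table hs (List.product vxs (List.product vxs vxs)) (nine_of (nine_of (nine_of None)))) D (hexes tr) \<and>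
          (case covered (pairs vxs) Q' hs [] (Some budget) (hexes cs) of None \<Rightarrow> False | Some _ \<Rightarrow> True) \<and>
          branches T D P (pairs vxs) (hexes bs)))"

fun register :: "vx list \<Rightarrow> trie \<Rightarrow> trie" where
  "register (i # j # k # ds) T = put T i (put (get T i) j (put (get (get T i) j) k (Some ds)))"
| "register _ T = T"

text \<open>A node is registered only after its own check, so its branches can refer to earlier
  nodes only and the argument is not circular.\<close>

fun valid_all :: "trie \<Rightarrow> int list \<Rightarrow> cert list \<Rightarrow> bool" where
  "valid_all T [] [] = True"
| "valid_all T (k # ks) (c # cs) = (valid T (hex k) c \<and> valid_all (register (hex k) T) ks cs)"
| "valid_all T _ _ = False"

fun register_all :: "int list \<Rightarrow> trie \<Rightarrow> trie" where
  "register_all [] T = T"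
| "register_all (k # ks) T = register_all ks (register (hex k) T)"

abbreviation empty_trie :: trie where "empty_trie \<equiv> nine_of (nine_of (nine_of None))"

section \<open>Correctness of the checks\<close>

lemma get_put: "get (put m u z) v = (if u = v then z else get m v)"
  by (cases m; cases u; cases v) simp_all

lemma get_nine_of [simp]: "get (nine_of z) v = z"
  by (cases v) (simp_all add: nine_of_def)

lemma set_vxs [simp]: "set vxs = UNIV"
proof -
  have "v \<in> set vxs" for v by (cases v) (simp_all add: vxs_def)
  then show ?thesis by blast
qed

lemma finite_vx: "finite (S :: vx set)"
  by (metis finite_set finite_subset set_vxs subset_UNIV)

lemma ex_vx: "(\<exists>v. P v) \<longleftrightarrow> P V0 \<or> P V1 \<or> P V2 \<or> P V3 \<or> P V4 \<or> P V5 \<or> P V6 \<or> P V7 \<or> P V8"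
  by (rule iffI, erule exE, rename_tac v, case_tac v) auto

lemma apart_iff: "apart A B \<longleftrightarrow> \<not> (\<exists>v. get A v \<and> get B v)"
  by (cases A; cases B) (simp add: ex_vx)

lemma get_neither: "get (neither A B) v \<longleftrightarrow> \<not> get A v \<and> \<not> get B v"
  by (cases A; cases B; cases v) simp_all

definition symm :: "mat \<Rightarrow> bool" where
  "symm m \<longleftrightarrow> (\<forall>u v. linked m u v \<longrightarrow> linked m v u)"

lemma linked_link: "linked (link m u v) x y \<longleftrightarrow> linked m x y \<or> x = u \<and> y = v \<or> x = v \<and> y = u"
  by (auto simp: link_def get_put Let_def)

lemma symm_link: "symm m \<Longrightarrow> symm (link m u v)"
  unfolding symm_def linked_link by blast

lemma symm_nomat [simp]: "symm nomat" by (simp add: symm_def)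

lemma symm_links: "symm m \<Longrightarrow> symm (links ds m)"
  by (induction ds m rule: links.induct) (simp_all add: symm_link)

lemma links_mono: "linked m x y \<Longrightarrow> linked (links ds m) x y"
  by (induction ds m rule: links.induct) (simp_all add: linked_link)

lemma symm_fold_link: "symm m \<Longrightarrow> symm (fold (\<lambda>(u, v) m. link m u v) es m)"
  by (induction es arbitrary: m) (auto simp: symm_link)

lemma linked_fold_link:
  "linked (fold (\<lambda>(u, v) m. link m u v) es m) x y \<longleftrightarrow> linked m x y \<or> (x, y) \<in> set es \<or> (y, x) \<in> set es"
proof (induction es arbitrary: m)
  case (Cons e es)
  obtain u v where e: "e = (u, v)" by fastforce
  have "linked (fold (\<lambda>(u, v) m. link m u v) (e # es) m) x y \<longleftrightarrow>
      linked (link m u v) x y \<or> (x, y) \<in> set es \<or> (y, x) \<in> set es"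
    using Cons.IH[of "link m u v"] by (simp add: e)
  then show ?case unfolding linked_link e by (simp; blast)
qed simp

lemma set_pairs: "x \<in> set xs \<Longrightarrow> y \<in> set xs \<Longrightarrow> x \<noteq> y \<Longrightarrow> (x, y) \<in> set (pairs xs) \<or> (y, x) \<in> set (pairs xs)"
  by (induction xs) auto

lemma clique_linked: "x \<in> set vs \<Longrightarrow> y \<in> set vs \<Longrightarrow> x \<noteq> y \<Longrightarrow> linked (clique vs m) x y"
  using set_pairs[of x vs y] by (auto simp: linked_fold_link)

lemma clique_mono: "linked m x y \<Longrightarrow> linked (clique vs m) x y"
  by (simp add: linked_fold_link)

lemma symm_clique: "symm m \<Longrightarrow> symm (clique vs m)"
  by (simp add: symm_fold_link)

declare clique.simps [simp del]

lemma cliques_mono: "linked m x y \<Longrightarrow> linked (cliques ks m) x y"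
  by (induction ks m rule: cliques.induct) (simp_all add: clique_mono)

lemma symm_cliques: "symm m \<Longrightarrow> symm (cliques ks m)"
  by (induction ks m rule: cliques.induct) (simp_all add: symm_clique)

lemma cliques_linked:
  "k \<in> set ks \<Longrightarrow> x \<in> set (hex k) \<Longrightarrow> y \<in> set (hex k) \<Longrightarrow> x \<noteq> y \<Longrightarrow> linked (cliques ks m) x y"
  by (induction ks m rule: cliques.induct) (auto simp: clique_linked intro: cliques_mono)

lemma linked_others: "linked (others P R) u v \<longleftrightarrow> u \<noteq> v \<and> \<not> linked P u v \<and> \<not> linked R u v"
  by (cases u) (auto simp: others_def get_put get_neither)

lemma tfree_row: "tfree_row m u vs \<Longrightarrow> v \<in> set vs \<Longrightarrow> linked m u v \<Longrightarrow> apart (get m u) (get m v)"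
  by (induction m u vs rule: tfree_row.induct) (auto split: if_splits)

lemma tfree_pairs: "tfree_rows m us \<Longrightarrow> (u, v) \<in> set (pairs us) \<Longrightarrow> linked m u v \<Longrightarrow> apart (get m u) (get m v)"
  by (induction m us rule: tfree_rows.induct) (auto simp: tfree_row)

lemma tfree:
  assumes "tfree_rows m vxs" "symm m" "u \<noteq> v" "linked m u v" "linked m u w" "linked m v w"
  shows False
proof -
  have "(u, v) \<in> set (pairs vxs) \<or> (v, u) \<in> set (pairs vxs)" using assms(3) by (intro set_pairs) auto
  with assms tfree_pairs[OF assms(1), of u v] tfree_pairs[OF assms(1), of v u] show False
    unfolding apart_iff symm_def by blast
qed

section \<open>Soundness of the test for splitting\<close>

definition splits :: "(vx \<Rightarrow> vx \<Rightarrow> bool) \<Rightarrow> (vx \<Rightarrow> vx \<Rightarrow> bool) \<Rightarrow> vx set \<Rightarrow> bool" where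
  "splits r b S \<longleftrightarrow> (\<exists>X. (\<forall>u\<in>S \<inter> X. \<forall>v\<in>S \<inter> X. u \<noteq> v \<longrightarrow> \<not> r u v) \<and> (\<forall>u\<in>S - X. \<forall>v\<in>S - X. u \<noteq> v \<longrightarrow> \<not> b u v))"

lemma splits_swap: "splits r b S \<longleftrightarrow> splits b r S"
proof -
  have "splits b r S" if "splits r b S" for r b
  proof -
    from that obtain X where "\<forall>u\<in>S \<inter> X. \<forall>v\<in>S \<inter> X. u \<noteq> v \<longrightarrow> \<not> r u v"
      "\<forall>u\<in>S - X. \<forall>v\<in>S - X. u \<noteq> v \<longrightarrow> \<not> b u v"
      unfolding splits_def by blast
    then show ?thesis unfolding splits_def by (intro exI[of _ "- X"]) blast
  qed
  then show ?thesis by blast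
qed

lemma splits_antimono:
  assumes "splits r b S" "S' \<subseteq> S" "\<And>u v. u \<noteq> v \<Longrightarrow> r' u v \<Longrightarrow> r u v" "\<And>u v. u \<noteq> v \<Longrightarrow> b' u v \<Longrightarrow> b u v"
  shows "splits r' b' S'"
proof -
  from assms(1) obtain X where X: "\<forall>u\<in>S \<inter> X. \<forall>v\<in>S \<inter> X. u \<noteq> v \<longrightarrow> \<not> r u v"
      "\<forall>u\<in>S - X. \<forall>v\<in>S - X. u \<noteq> v \<longrightarrow> \<not> b u v"
    unfolding splits_def by blast
  show ?thesis
    unfolding splits_def
  proof (intro exI[of _ X] conjI ballI impI)
    fix u v assume "u \<in> S' \<inter> X" "v \<in> S' \<inter> X" "u \<noteq> v"
    then show "\<not> r' u v" using assms(2) assms(3)[of u v] X(1) by auto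
  next
    fix u v assume "u \<in> S' - X" "v \<in> S' - X" "u \<noteq> v"
    then show "\<not> b' u v" using assms(2) assms(4)[of u v] X(2) by auto
  qed
qed

definition indep_in :: "mat \<Rightarrow> (vx \<Rightarrow> bool) \<Rightarrow> bool" where
  "indep_in m X \<longleftrightarrow> (\<forall>u v. X u \<longrightarrow> X v \<longrightarrow> u \<noteq> v \<longrightarrow> \<not> linked m u v)"

lemma indep_in_put:
  "symm m \<Longrightarrow> indep_in m (get X) \<Longrightarrow> apart (get m v) X \<Longrightarrow> indep_in m (get (put X v True))"
  unfolding indep_in_def apart_iff get_put symm_def by metis

lemma splittable_sound:
  "splittable R B vs X Y \<Longrightarrow> symm R \<Longrightarrow> symm B \<Longrightarrow> indep_in R (get X) \<Longrightarrow> indep_in B (get Y) \<Longrightarrow>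
   \<exists>X' Y'. indep_in R X' \<and> indep_in B Y' \<and> (\<forall>v. get X v \<longrightarrow> X' v) \<and> (\<forall>v. get Y v \<longrightarrow> Y' v) \<and>
     (\<forall>v\<in>set vs. X' v \<or> Y' v)"
proof (induction vs arbitrary: X Y)
  case Nil
  then show ?case by auto
next
  case (Cons v vs)
  from Cons.prems(1) consider "apart (get R v) X" "splittable R B vs (put X v True) Y"
    | "apart (get B v) Y" "splittable R B vs X (put Y v True)" by auto
  then show ?case
  proof cases
    case 1
    from Cons.IH[OF 1(2) Cons.prems(2,3) indep_in_put[OF Cons.prems(2,4) 1(1)] Cons.prems(5)]
    obtain X' Y' where "indep_in R X'" "indep_in B Y'" "\<forall>u. get (put X v True) u \<longrightarrow> X' u"
      "\<forall>v. get Y v \<longrightarrow> Y' v" "\<forall>v\<in>set vs. X' v \<or> Y' v" by blast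
    then show ?thesis by (intro exI[of _ X'] exI[of _ Y']) (auto simp: get_put split: if_splits)
  next
    case 2
    from Cons.IH[OF 2(2) Cons.prems(2-4) indep_in_put[OF Cons.prems(3,5) 2(1)]]
    obtain X' Y' where "indep_in R X'" "indep_in B Y'" "\<forall>u. get (put Y v True) u \<longrightarrow> Y' u"
      "\<forall>v. get X v \<longrightarrow> X' v" "\<forall>v\<in>set vs. X' v \<or> Y' v" by blast
    then show ?thesis by (intro exI[of _ X'] exI[of _ Y']) (auto simp: get_put split: if_splits)
  qed
qed

lemma splittable_splits:
  assumes "splittable R B vs none none" "symm R" "symm B" "S \<subseteq> set vs"
  shows "splits (linked R) (linked B) S"
proof -
  have "indep_in R (get none)" "indep_in B (get none)" by (simp_all add: indep_in_def)
  from splittable_sound[OF assms(1-3) this] obtain X Y where "indep_in R X" "indep_in B Y" "\<forall>v\<in>set vs. X v \<or> Y v"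
    by blast
  with assms(4) show ?thesis unfolding splits_def indep_in_def by (intro exI[of _ "{v. X v}"]) blast
qed

text \<open>Putting \<open>v\<close> into \<open>X\<close> exactly when it lies in \<open>Z\<close>
  is always an admissible move, so the backtracking search has a successful path.\<close>

lemma splittable_complete:
  assumes "\<And>u. \<not> linked R u u" "\<And>u. \<not> linked B u u"
    and Z: "\<forall>u\<in>S \<inter> Z. \<forall>v\<in>S \<inter> Z. u \<noteq> v \<longrightarrow> \<not> linked R u v" "\<forall>u\<in>S - Z. \<forall>v\<in>S - Z. u \<noteq> v \<longrightarrow> \<not> linked B u v"
  shows "set vs \<subseteq> S \<Longrightarrow> (\<forall>v. get X v \<longrightarrow> v \<in> S \<inter> Z) \<Longrightarrow> (\<forall>v. get Y v \<longrightarrow> v \<in> S - Z) \<Longrightarrow> splittable R B vs X Y"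
proof (induction vs arbitrary: X Y)
  case (Cons v vs)
  show ?case
  proof (cases "v \<in> Z")
    case True
    with Cons.prems have "apart (get R v) X" unfolding apart_iff using Z(1) assms(1) by (metis IntI list.set_intros(1) subsetD)
    moreover have "splittable R B vs (put X v True) Y"
      using Cons.prems True by (intro Cons.IH) (auto simp: get_put)
    ultimately show ?thesis by simp
  next
    case False
    with Cons.prems have "apart (get B v) Y" unfolding apart_iff using Z(2) assms(2) by (metis DiffI list.set_intros(1) subsetD)
    moreover have "splittable R B vs X (put Y v True)"
      using Cons.prems False by (intro Cons.IH) (auto simp: get_put)
    ultimately show ?thesis by simp
  qed
qed simp

lemma not_splittable:
  assumes "\<not> splittable R B vs none none" "\<And>u. \<not> linked R u u" "\<And>u. \<not> linked B u u"
  shows "\<not> splits (linked R) (linked B) (set vs)"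
proof
  assume "splits (linked R) (linked B) (set vs)"
  then obtain Z where "\<forall>u\<in>set vs \<inter> Z. \<forall>v\<in>set vs \<inter> Z. u \<noteq> v \<longrightarrow> \<not> linked R u v"
    "\<forall>u\<in>set vs - Z. \<forall>v\<in>set vs - Z. u \<noteq> v \<longrightarrow> \<not> linked B u v"
    unfolding splits_def by blast
  from splittable_complete[OF assms(2,3) this, of vs none none] assms(1) show False by simp
qed

lemma all_in_iff: "all_in vs S \<longleftrightarrow> (\<forall>v\<in>set vs. get S v)"
  by (induction vs) auto

text \<open>The invariant is that \<open>T\<close> lies between \<open>K\<close> and
  \<open>S\<close> and contains none of the sets still to be treated. When the list is exhausted,
  the whole of \<open>S\<close> splits, hence so does \<open>T\<close>.\<close>

lemma unblocked_sound:
  assumes "symm R" "symm B"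
  shows "unblocked R B bs S K \<Longrightarrow> (\<forall>v. get K v \<longrightarrow> v \<in> T) \<Longrightarrow> (\<forall>v\<in>T. get S v) \<Longrightarrow> (\<forall>b\<in>set bs. \<not> set b \<subseteq> T) \<Longrightarrow>
      splits (linked R) (linked B) T"
proof (induction bs arbitrary: S K)
  case Nil
  from Nil.prems show ?case
    by (intro splittable_splits[of R B "filter (get S) vxs"]) (auto simp: assms)
next
  case (Cons b bs)
  \<comment> \<open>\<open>T\<close> misses some element of \<open>b\<close>. The elements scanned
    before the first missing one belong to \<open>T\<close>, which justifies adding them to
    \<open>K\<close>; the missing one may be deleted from \<open>S\<close>.\<close>
  have unblocked_minus: "unblocked_minus R B bs vs S K \<Longrightarrow> (\<forall>v. get K v \<longrightarrow> v \<in> T) \<Longrightarrow> \<not> set vs \<subseteq> T \<Longrightarrow> splits (linked R) (linked B) T" for vs K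
  proof (induction vs arbitrary: K)
    case inner: (Cons v vs)
    show ?case
    proof (cases "v \<in> T")
      case True
      have "\<forall>u. get (put K v True) u \<longrightarrow> u \<in> T" using inner.prems(2) True by (simp add: get_put)
      moreover have "unblocked_minus R B bs vs S (put K v True)" "\<not> set vs \<subseteq> T" using inner.prems True by auto
      ultimately show ?thesis using inner.IH by blast
    next
      case False
      with inner.prems have "unblocked R B bs (put S v False) K" by auto
      then show ?thesis
        using inner.prems False Cons.prems(3,4)
        by (intro Cons.IH[of "put S v False" K]) (auto simp: get_put)
    qed
  qed simp
  show ?case
  proof (cases "all_in b S")
    case True
    with Cons.prems show ?thesis by (intro unblocked_minus[of b K]) auto
  next
    case False
    with Cons show ?thesis by auto
  qed
qed

section \<open>Embeddings and permutations\<close>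

lemma embeds_links:
  "embeds ds p m \<Longrightarrow> symm m \<Longrightarrow> linked (links ds m0) x y \<Longrightarrow> linked m0 x y \<or> linked m (get p x) (get p y)"
proof (induction ds m0 rule: links.induct)
  case (1 u v ds m0)
  then have "linked (link m0 u v) x y \<or> linked m (get p x) (get p y)" by simp
  with 1(2,3) show ?case by (auto simp: linked_link symm_def)
qed auto

lemma inj_digits: "inj_digits vs S \<Longrightarrow> distinct vs \<and> (\<forall>v\<in>set vs. \<not> get S v)"
  by (induction vs S rule: inj_digits.induct) (auto simp: get_put split: if_splits)

lemma isperm_bij:
  assumes "isperm p"
  shows "bij (get p)"
proof -
  have "inj_digits (map (get p) vxs) none" using assms by (cases p) (simp add: vxs_def)
  then have "distinct (map (get p) vxs)" using inj_digits by blast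
  then have "inj (get p)" by (simp add: distinct_map)
  then show ?thesis using finite_UNIV_inj_surj[OF finite_vx] by (simp add: bij_def)
qed

lemma quad: "quad vs \<Longrightarrow> card (set vs) = 4"
  by (induction vs rule: quad.induct) (auto dest!: inj_digits simp del: inj_digits.simps)

lemma quint: "quint vs \<Longrightarrow> card (set vs) = 5"
  by (induction vs rule: quint.induct) (auto dest!: inj_digits simp del: inj_digits.simps)

section \<open>Soundness of the bound on transversals\<close>

lemma mem_iff: "mem p ps \<longleftrightarrow> p \<in> set ps"
  by (induction ps) auto

lemma subedge_iff: "subedge ps e \<longleftrightarrow> set ps \<subseteq> set e"
  by (induction ps) (auto simp: mem_iff)

lemma has_sub_iff: "has_sub ms e \<longleftrightarrow> (\<exists>m\<in>set ms. set m \<subseteq> set e)"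
  by (induction ms) (auto simp: subedge_iff)

lemma minimal_edges_subset: "set (minimal_edges es acc) \<subseteq> set es \<union> set acc"
  by (induction es acc rule: minimal_edges.induct) auto

lemma minimal_edges_below: "\<forall>e\<in>set es \<union> set acc. \<exists>m\<in>set (minimal_edges es acc). set m \<subseteq> set e"
proof (induction es acc rule: minimal_edges.induct)
  case (2 e es acc)
  show ?case
  proof (cases "has_sub acc e")
    case True
    then obtain m where "m \<in> set acc" "set m \<subseteq> set e" by (auto simp: has_sub_iff)
    moreover from 2(1)[OF True] \<open>m \<in> set acc\<close> obtain m' where "m' \<in> set (minimal_edges es acc)" "set m' \<subseteq> set m" by blast
    ultimately have "\<exists>m\<in>set (minimal_edges es acc). set m \<subseteq> set e" by blast
    with 2(1)[OF True] True show ?thesis by simp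
  next
    case False
    with 2(2) show ?thesis by simp
  qed
qed auto

lemma set_dedup: "set (dedup ps acc) = set ps \<union> set acc"
  by (induction ps acc rule: dedup.induct) (auto simp: mem_iff)

lemma without_eq: "without p es = filter (\<lambda>e. p \<notin> set e) es"
  by (induction es) (auto simp: mem_iff)

lemma drop1_eq: "drop1 p e = removeAll p e"
  by (induction e) auto

lemma short_le: "short xs b \<Longrightarrow> length xs \<le> length b"
  by (induction xs b rule: short.induct) auto

lemma lonely: "lonely p X \<Longrightarrow> (p, []) \<in> set X"
  by (induction p X rule: lonely.induct) (auto split: if_splits)

lemma private_to_eq: "private_to p X = map (map_prod id (without p)) X"
  by (induction p X rule: private_to.induct) auto

definition hits :: "point_id set \<Rightarrow> point_id list list \<Rightarrow> bool" where
  "hits T E \<longleftrightarrow> (\<forall>e\<in>set E. \<exists>q\<in>set e. q \<in> T)"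

lemma set_shrunk: "set (shrunk p es) = removeAll p ` {e \<in> set es. p \<in> set e}"
  by (induction es) (auto simp: mem_iff drop1_eq)

text \<open>A transversal without \<open>p\<close> meets each edge through \<open>p\<close> at
  another point, so \<open>p\<close> can be deleted from these edges.\<close>

lemma hits_merge:
  assumes "hits T es" "p \<notin> T"
  shows "hits T (merge (shrunk p es) (without p es))"
  unfolding hits_def
proof
  fix e assume "e \<in> set (merge (shrunk p es) (without p es))"
  then obtain e' where "e' \<in> set es" "e = e' \<or> e = removeAll p e'"
    by (auto simp: merge_def merge_with_def set_shrunk without_eq)
  with assms show "\<exists>q\<in>set e. q \<in> T" unfolding hits_def by force
qed

text \<open>Every old edge contains an edge of the merged list: itself, its shrunk form, or the
  small edge because of which it was discarded.\<close>

lemma hits_mergeD: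
  assumes "hits Y (merge (shrunk p es) (without p es))"
  shows "hits Y es"
  unfolding hits_def
proof
  fix e assume e: "e \<in> set es"
  have "\<exists>e'\<in>set (merge (shrunk p es) (without p es)). set e' \<subseteq> set e"
  proof (cases "p \<in> set e")
    case True
    with e show ?thesis by (intro bexI[of _ "removeAll p e"]) (auto simp: merge_def merge_with_def set_shrunk)
  next
    case False
    show ?thesis
    proof (cases "has_sub (filter small (shrunk p es)) e")
      case True
      then show ?thesis by (auto simp: has_sub_iff merge_def merge_with_def)
    next
      case False
      with e \<open>p \<notin> set e\<close> show ?thesis by (intro bexI[of _ e]) (auto simp: merge_def merge_with_def without_eq)
    qed
  qed
  with assms show "\<exists>q\<in>set e. q \<in> Y" unfolding hits_def by blast
qed

lemma finite_pt: "finite (S :: point_id set)"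
  by (metis finite_SigmaI finite_vx UNIV_Times_UNIV finite_subset subset_UNIV)

text \<open>\<open>Y\<close> consists either of one point of \<open>T\<close> chosen from each
  minimal edge, or of all points of \<open>T\<close> on these edges. Each edge contains a minimal
  one, so \<open>Y\<close> meets them all; the vacuous alternative is excluded because
  \<open>T\<close> is a transversal.\<close>

lemma cover_leaf:
  assumes leaf: "cover_leaf (minimal_edges (minimal_edges es []) []) b" and es: "hits T es"
  shows "\<exists>l Y. b = Some l \<and> Y \<subseteq> T \<and> hits Y es \<and> card Y \<le> length l"
proof -
  define m where "m = minimal_edges (minimal_edges es []) []"
  have sub: "set m \<subseteq> set es" unfolding m_def using minimal_edges_subset[of "minimal_edges es []" "[]"] minimal_edges_subset[of es "[]"] by auto
  have below: "\<exists>x\<in>set m. set x \<subseteq> set e" if "e \<in> set es" for e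
    using minimal_edges_below[of es "[]"] minimal_edges_below[of "minimal_edges es []" "[]"] that unfolding m_def by simp (meson order_trans)
  have lift: "hits Y es" if "hits Y m" for Y
    using below that unfolding hits_def by blast
  have Tm: "hits T m" using es sub unfolding hits_def by blast
  have no_empty: "\<not> has_sub m []" using Tm unfolding hits_def has_sub_iff by fastforce
  then obtain l where b: "b = Some l" and "short m l \<or> short (dedup (concat m) []) l"
    using leaf by (cases b) (auto simp flip: m_def)
  then consider "short m l" | "short (dedup (concat m) []) l" by blast
  then have "\<exists>Y\<subseteq>T. hits Y es \<and> card Y \<le> length l"
  proof cases
    case 1
    from Tm obtain f where f: "\<forall>e\<in>set m. f e \<in> set e \<and> f e \<in> T" unfolding hits_def by metis
    have "card (f ` set m) \<le> length m" by (meson card_image_le card_length finite_set order_trans)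
    moreover have "hits (f ` set m) es" using f by (intro lift) (auto simp: hits_def)
    ultimately show ?thesis using f short_le[OF 1] by (intro exI[of _ "f ` set m"]) auto
  next
    case 2
    have "card (T \<inter> set (concat m)) \<le> card (set (dedup (concat m) []))"
      by (intro card_mono) (auto simp: set_dedup)
    also have "\<dots> \<le> length l" using short_le[OF 2] card_length order_trans by blast
    finally have "card (T \<inter> set (concat m)) \<le> length l" .
    moreover have "hits (T \<inter> set (concat m)) es" using Tm by (intro lift) (fastforce simp: hits_def)
    ultimately show ?thesis by (intro exI[of _ "T \<inter> set (concat m)"]) auto
  qed
  with b show ?thesis by blast
qed

text \<open>The tree is followed along the path chosen by an inclusion-minimal transversal
  \<open>T\<close>. Invariants: the points of \<open>X\<close> belong to \<open>T\<close>; meeting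
  \<open>es\<close> in addition to taking \<open>X\<close> meets all of \<open>E\<close>; if the
  other points of \<open>T\<close> already meet the list attached to \<open>p\<close>, then
  \<open>p\<close> is redundant; points taken and remaining budget add up to
  \<open>n\<close>.\<close>

lemma covered_sound:
  assumes hit: "hits T E" and min: "\<And>q. q \<in> T \<Longrightarrow> \<not> hits (T - {q}) E"
  shows "covered zs Q es X b ds = Some ds' \<Longrightarrow> fst ` set X \<subseteq> T \<Longrightarrow> hits T es \<Longrightarrow>
    (\<And>Y. hits Y es \<Longrightarrow> hits (fst ` set X \<union> Y) E) \<Longrightarrow>
    (\<And>p l. (p, l) \<in> set X \<Longrightarrow> hits (T - {p}) l \<Longrightarrow> hits (T - {p}) E) \<Longrightarrow>
    (\<And>l. b = Some l \<Longrightarrow> length X + length l = n) \<Longrightarrow> card T \<le> n"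
proof (induction zs arbitrary: es X b ds ds')
  case Nil
  then show ?case by simp
next
  case (Cons z zs)
  from Cons.prems(1) obtain i j r where ds: "ds = i # j # r"
    by (cases "(z # zs, Q, es, X, b, ds)" rule: covered.cases) auto
  show ?case
  proof (cases "i = V8")
    case True
    show ?thesis
    proof (cases "j = V0")
      case leaf: True
      then have "cover_leaf (minimal_edges (minimal_edges es []) []) b" using Cons.prems(1) ds True by (auto split: if_splits)
      from cover_leaf[OF this Cons.prems(3)] obtain l Y where l: "b = Some l"
        and Y: "Y \<subseteq> T" "hits Y es" "card Y \<le> length l" by blast
      \<comment> \<open>\<open>X\<close> and \<open>Y\<close> together already form a transversal
        inside \<open>T\<close>, so minimality leaves no further point in \<open>T\<close>.\<close>
      have "T \<subseteq> fst ` set X \<union> Y"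
      proof
        fix q assume "q \<in> T"
        show "q \<in> fst ` set X \<union> Y"
        proof (rule ccontr)
          assume "q \<notin> fst ` set X \<union> Y"
          then have "fst ` set X \<union> Y \<subseteq> T - {q}" using Cons.prems(2) Y(1) by blast
          then have "hits (T - {q}) E" using Cons.prems(4)[OF Y(2)] unfolding hits_def by blast
          with min[OF \<open>q \<in> T\<close>] show False by blast
        qed
      qed
      then have "card T \<le> card (fst ` set X \<union> Y)" by (intro card_mono finite_pt)
      also have "\<dots> \<le> card (fst ` set X) + card Y" by (rule card_Un_le)
      also have "card (fst ` set X) \<le> length X" by (metis card_length length_map list.set_map)
      finally show ?thesis using Y(3) Cons.prems(6)[OF l] by linarith
    next
      case inner: False
      obtain x y r' where r: "r = x # y # r'"
        using Cons.prems(1) ds True inner by (auto split: list.splits)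
      show ?thesis
      proof (cases "j = V8")
        case True
        then have "call (covered zs Q es X b (hexes (Q x y))) r' = Some ds'"
          using Cons.prems(1) ds r \<open>i = V8\<close> by simp
        then obtain ds1 where "covered zs Q es X b (hexes (Q x y)) = Some ds1"
          by (cases "covered zs Q es X b (hexes (Q x y))") auto
        from Cons.IH[OF this Cons.prems(2-6)] show ?thesis .
      next
        case False
        with Cons.prems(1) ds True inner r have "lonely (x, y) X"
          by (auto split: if_splits)
        from lonely[OF this] have X: "((x, y), []) \<in> set X" .
        \<comment> \<open>An empty list of private edges is met trivially, so the point is
          redundant, which contradicts minimality.\<close>
        then have "hits (T - {(x, y)}) E" using Cons.prems(5)[of "(x, y)" "[]"] by (simp add: hits_def)
        moreover have "(x, y) \<in> T" using X Cons.prems(2) by force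
        ultimately show ?thesis using min by blast
      qed
    qed
  next
    case False
    with Cons.prems(1) ds have new: "(i, j) \<notin> fst ` set X"
      by (auto simp: mem_iff split: if_splits)
    with False Cons.prems(1) ds obtain r1
      where inn: "covered zs Q (without (i, j) es) (((i, j), shrunk (i, j) es) # private_to (i, j) X) (spend b) r = Some r1"
      and out: "covered zs Q (merge (shrunk (i, j) es) (without (i, j) es)) X b r1 = Some ds'"
      by (auto split: if_splits option.splits)
    show ?thesis
    proof (cases "(i, j) \<in> T")
      case True
      have fst: "fst ` set (((i, j), l) # private_to (i, j) X) = insert (i, j) (fst ` set X)" for l
        by (force simp: private_to_eq)
      show ?thesis
      proof (rule Cons.IH[OF inn])
        show "length (((i, j), shrunk (i, j) es) # private_to (i, j) X) + length l = n" if "spend b = Some l" for l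
          using that Cons.prems(6) by (cases b rule: spend.cases) (auto simp: private_to_eq)
        show "fst ` set (((i, j), shrunk (i, j) es) # private_to (i, j) X) \<subseteq> T"
          unfolding fst using True Cons.prems(2) by simp
        show "hits T (without (i, j) es)" using Cons.prems(3) by (auto simp: hits_def without_eq)
        show "hits (fst ` set (((i, j), shrunk (i, j) es) # private_to (i, j) X) \<union> Y) E"
          if "hits Y (without (i, j) es)" for Y
        proof -
          from that have "hits (insert (i, j) Y) es" unfolding hits_def without_eq by auto
          from Cons.prems(4)[OF this] show ?thesis unfolding fst by simp
        qed
        fix p l
        assume "(p, l) \<in> set (((i, j), shrunk (i, j) es) # private_to (i, j) X)" and l: "hits (T - {p}) l"
        then consider "p = (i, j)" "l = shrunk (i, j) es" | l' where "(p, l') \<in> set X" "l = without (i, j) l'"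
          by (auto simp: private_to_eq)
        then show "hits (T - {p}) E"
        proof cases
          case 1
          \<comment> \<open>Edges through \<open>p\<close> are met by assumption on
            \<open>l\<close>, their shrunk forms; an edge avoiding \<open>p\<close> is met by
            \<open>T\<close> at some other point anyway.\<close>
          have es: "hits (T - {p}) es"
            unfolding hits_def
          proof
            fix e assume e: "e \<in> set es"
            show "\<exists>q\<in>set e. q \<in> T - {p}"
            proof (cases "p \<in> set e")
              case True
              with l 1 e have "\<exists>q\<in>set (removeAll p e). q \<in> T - {p}"
                unfolding hits_def by (simp add: set_shrunk)
              then show ?thesis by auto
            next
              case False
              from e Cons.prems(3) obtain q where "q \<in> set e" "q \<in> T" unfolding hits_def by blast
              with False show ?thesis by auto
            qed
          qed
          have absorb: "fst ` set X \<union> (T - {p}) = T - {p}"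
            using Cons.prems(2) new unfolding 1(1) by (intro Un_absorb1) (simp add: subset_Diff_insert)
          from Cons.prems(4)[OF es] show ?thesis unfolding absorb .
        next
          case 2
          have "p \<noteq> (i, j)" using 2(1) new by force
          \<comment> \<open>The edges struck from \<open>l'\<close> pass through the new point
            \<open>(i, j)\<close>, which lies in \<open>T\<close> and differs from
            \<open>p\<close>.\<close>
          then have "hits (T - {p}) l'" using l True unfolding 2(2) without_eq hits_def by auto
          with Cons.prems(5) 2(1) show ?thesis by blast
        qed
      qed
    next
      case False
      show ?thesis
      proof (rule Cons.IH[OF out Cons.prems(2) _ _ Cons.prems(5,6)])
        show "hits T (merge (shrunk (i, j) es) (without (i, j) es))"
          using Cons.prems(3) False by (rule hits_merge)
        show "hits (fst ` set X \<union> Y) E" if "hits Y (merge (shrunk (i, j) es) (without (i, j) es))" for Y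
          using Cons.prems(4)[OF hits_mergeD[OF that]] .
      qed
    qed
  qed
qed

text \<open>A transversal of least size within \<open>T\<close> is inclusion-minimal, so the
  decision tree bounds its size. The bound must hold for all minimal transversals, since nothing is
  known about \<open>T\<close>.\<close>

lemma cover:
  assumes "covered zs Q E [] (Some b) ds = Some ds'" "hits T E"
  shows "\<exists>T'\<subseteq>T. hits T' E \<and> card T' \<le> length b"
proof -
  let ?P = "\<lambda>T'. T' \<subseteq> T \<and> hits T' E"
  have "\<exists>T'. ?P T' \<and> (\<forall>S. ?P S \<longrightarrow> card T' \<le> card S)"
    by (rule ex_has_least_nat[of ?P T card]) (use assms(2) in simp)
  then obtain T' where T': "T' \<subseteq> T" "hits T' E" and least: "\<And>S. ?P S \<Longrightarrow> card T' \<le> card S" by auto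
  have min: "\<not> hits (T' - {q}) E" if "q \<in> T'" for q
  proof
    assume "hits (T' - {q}) E"
    then have "card T' \<le> card (T' - {q})" using T'(1) by (intro least) auto
    with card_Diff1_less[OF finite_pt that] show False by simp
  qed
  have "card T' \<le> length b"
    using covered_sound[of T' E zs Q E "[]" "Some b" ds ds' "length b"] assms(1) T'(2) min by simp
  with T' show ?thesis by auto
qed

section \<open>Soundness of the decision tree for colourings\<close>

lemma all_blocked_iff: "all_blocked t R B h \<longleftrightarrow> (\<forall>q\<in>set h. \<not> splittable R B (point t q) none none)"
  by (induction h) auto

definition table_within :: "htable \<Rightarrow> point_id list set \<Rightarrow> bool" where
  "table_within H S \<longleftrightarrow> (\<forall>i j k h. get (get (get H i) j) k = Some h \<longrightarrow> h \<in> S)"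

lemma table_within_put:
  assumes "table_within t S" "h \<in> S"
  shows "table_within (put t i (put (get t i) j (put (get (get t i) j) k (Some h)))) S"
  unfolding table_within_def
proof (intro allI impI)
  fix i' j' k' h'
  assume "get (get (get (put t i (put (get t i) j (put (get (get t i) j) k (Some h)))) i') j') k' = Some h'"
  then have "h' = h \<or> get (get (get t i') j') k' = Some h'"
    by (cases "i = i'"; cases "j = j'"; cases "k = k'") (simp_all add: get_put)
  with assms show "h' \<in> S" unfolding table_within_def by blast
qed

lemma edge_table: "table_within H S \<Longrightarrow> set hs \<subseteq> S \<Longrightarrow> table_within (edge_table hs qs H) S"
  by (induction hs qs H rule: edge_table.induct) (simp_all add: table_within_put)

locale tree_colouring =
  fixes D :: mat and \<kappa> :: "vx \<Rightarrow> vx \<Rightarrow> bool"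
  assumes D: "symm D" and \<kappa>: "\<And>u v. \<kappa> u v = \<kappa> v u"
    and no_mono: "\<And>u v w. u \<noteq> v \<Longrightarrow> u \<noteq> w \<Longrightarrow> v \<noteq> w \<Longrightarrow> linked D u v \<Longrightarrow> linked D u w \<Longrightarrow> linked D v w \<Longrightarrow>
      \<not> (\<kappa> u v = \<kappa> u w \<and> \<kappa> u v = \<kappa> v w)"
begin

text \<open>What one path of the tree has decided so far: \<open>m\<close> holds some of the edges
  of \<open>D\<close> that have colour \<open>c\<close>.\<close>

definition part :: "mat \<Rightarrow> bool \<Rightarrow> bool" where
  "part m c \<longleftrightarrow> symm m \<and> (\<forall>u v. linked m u v \<longrightarrow> u \<noteq> v \<and> linked D u v \<and> \<kappa> u v = c)"

lemma part_link: "part m c \<Longrightarrow> u \<noteq> v \<Longrightarrow> linked D u v \<Longrightarrow> \<kappa> u v = c \<Longrightarrow> part (link m u v) c"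
  using D \<kappa> unfolding part_def linked_link symm_def by metis

text \<open>A common neighbour of \<open>u\<close> and \<open>v\<close> in colour \<open>c\<close>
  would complete a monochromatic triangle. Hence a child that the tree leaves out is never the one
  chosen by the colouring.\<close>

lemma part_disj: "part m c \<Longrightarrow> u \<noteq> v \<Longrightarrow> linked D u v \<Longrightarrow> \<kappa> u v = c \<Longrightarrow> apart (get m u) (get m v)"
  using no_mono[of u v] unfolding part_def apart_iff by blast

definition blocked :: "vx set \<Rightarrow> bool" where
  "blocked S \<longleftrightarrow> \<not> splits (\<lambda>u v. linked D u v \<and> \<kappa> u v) (\<lambda>u v. linked D u v \<and> \<not> \<kappa> u v) S"

text \<open>The colouring \<kappa> selects one path: at each edge the child of its colour is present
  by \<open>part_disj\<close>, and the induction hypothesis applies to it. The blue child starts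
  reading where the red one stopped, which is why the rest of the digits is threaded
  through.\<close>

lemma refuted_sound:
  assumes H: "table_within H S"
  shows "refuted zs Q t H D R B ds = Some ds' \<Longrightarrow> part R True \<Longrightarrow> part B False \<Longrightarrow>
    \<exists>h\<in>S. \<forall>q\<in>set h. blocked (set (point t q))"
proof (induction zs arbitrary: R B ds ds')
  case Nil
  then show ?case by simp
next
  case (Cons z zs)
  obtain u v r where ds: "ds = u # v # r"
    using Cons.prems(1) by (cases "(z # zs, Q, t, H, D, R, B, ds)" rule: refuted.cases) auto
  show ?case
  proof (cases "u = v")
    case eq: True
    show ?thesis
    proof (cases "u = V8")
      case True
      then obtain i j r' where r: "r = i # j # r'"
        using Cons.prems(1) ds eq by (auto split: list.splits)
      then have "call (refuted zs Q t H D R B (hexes (Q i j))) r' = Some ds'"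
        using Cons.prems(1) ds eq True by auto
      then obtain ds1 where "refuted zs Q t H D R B (hexes (Q i j)) = Some ds1"
        by (cases "refuted zs Q t H D R B (hexes (Q i j))") auto
      from Cons.IH[OF this Cons.prems(2,3)] show ?thesis .
    next
      case False
      with Cons.prems(1) ds eq have leaf: "leaf_ok t H R B (v # r) = Some ds'" by simp
      then obtain j k r' h where h: "get (get (get H v) j) k = Some h" "all_blocked t R B h"
        by (cases "(t, H, R, B, v # r)" rule: leaf_ok.cases) (auto split: option.splits if_splits)
      have "blocked (set (point t q))" if "q \<in> set h" for q
      proof -
        have "\<not> splits (linked R) (linked B) (set (point t q))"
          using h(2) that Cons.prems(2,3) by (intro not_splittable) (auto simp: all_blocked_iff part_def)
        \<comment> \<open>\<open>R\<close> and \<open>B\<close> are only the decided part of the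
          colouring; a set that does not split for them does not split for the complete colouring
          either.\<close>
        then show ?thesis
          unfolding blocked_def using Cons.prems(2,3) by (auto simp: part_def elim!: splits_antimono contrapos_nn)
    qed
    moreover have "h \<in> S" using H h(1) unfolding table_within_def by blast
    ultimately show ?thesis by blast
    qed
  next
    case False
    have D': "linked D u v" using Cons.prems(1) ds False by (simp split: if_splits)
    define red where "red = (if apart (get R u) (get R v) then refuted zs Q t H D (link R u v) B r else Some r)"
    have step: "(case red of None \<Rightarrow> None
       | Some ds1 \<Rightarrow> if apart (get B u) (get B v) then refuted zs Q t H D R (link B u v) ds1 else Some ds1) = Some ds'"
      using Cons.prems(1) ds False D' by (simp add: red_def)
    then obtain ds1 where ds1: "red = Some ds1" by (cases red) auto
    show ?thesis
    proof (cases "\<kappa> u v")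
      case True
      have "apart (get R u) (get R v)" using part_disj[OF Cons.prems(2) False D'] True by simp
      then have "refuted zs Q t H D (link R u v) B r = Some ds1" using ds1 by (simp add: red_def)
      then show ?thesis
        using part_link[OF Cons.prems(2) False D'] True Cons.prems(3) by (intro Cons.IH) auto
    next
      case blue: False
      have "apart (get B u) (get B v)" using part_disj[OF Cons.prems(3) False D'] blue by simp
      then have "refuted zs Q t H D R (link B u v) ds1 = Some ds'" using step ds1 by simp
      then show ?thesis
        using part_link[OF Cons.prems(3) False D'] blue Cons.prems(2) by (intro Cons.IH) auto
    qed
  qed
qed

lemma part_nomat: "part nomat c"
  by (simp add: part_def)

end

lemma (in tree_colouring) refuted_root_half:
  assumes H: "table_within H S" and refuted: "refuted zs Q t H D nomat (link nomat u v) ds = Some ds'"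
    and uv: "u \<noteq> v" "linked D u v" "\<not> \<kappa> u v"
  shows "\<exists>h\<in>S. \<forall>q\<in>set h. blocked (set (point t q))"
  using part_link[OF part_nomat uv(1,2), of False] uv(3) by (intro refuted_sound[OF H refuted part_nomat]) auto

lemma (in tree_colouring) refuted_root_sound:
  assumes H: "table_within H S" and refuted: "refuted_root Q t H D ds"
  shows "\<exists>h\<in>S. \<forall>q\<in>set h. blocked (set (point t q))"
proof -
  obtain u v r where ds: "ds = u # v # r"
    using refuted by (cases "(Q, t, H, D, ds)" rule: refuted_root.cases) auto
  from refuted ds obtain ds' where uv: "u \<noteq> v" "linked D u v" and c: "refuted (pairs vxs) Q t H D nomat (link nomat u v) r = Some ds'"
    by (auto split: option.splits)
  show ?thesis
  proof (cases "\<kappa> u v")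
    case False
    from refuted_root_half[OF H c uv False] show ?thesis .
  next
    case True
    \<comment> \<open>If the first edge is red, the tree is applied to the colouring with the
      colours exchanged; splitting is symmetric in the two colours, so the same sets are
      blocked.\<close>
    interpret swap: tree_colouring D "\<lambda>u v. \<not> \<kappa> u v"
      using D \<kappa> no_mono by unfold_locales auto
    have "swap.blocked S' = blocked S'" for S'
      unfolding swap.blocked_def blocked_def by (simp add: splits_swap)
    with swap.refuted_root_half[OF H c uv] True show ?thesis by simp
  qed
qed

section \<open>Images of points, and monochromatic triangles\<close>

lemma embeds_pairs_iff: "embeds_pairs es p m \<longleftrightarrow> (\<forall>(u, v)\<in>set es. linked m u v \<longrightarrow> linked m (get p u) (get p v))"
  by (induction es p m rule: embeds_pairs.induct) auto

lemma embeds_pairs: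
  assumes "embeds_pairs (pairs vxs) p m" "symm m" "linked m u v" "u \<noteq> v"
  shows "linked m (get p u) (get p v)"
proof -
  have "(u, v) \<in> set (pairs vxs) \<or> (v, u) \<in> set (pairs vxs)" using assms(4) by (intro set_pairs) auto
  with assms show ?thesis unfolding embeds_pairs_iff symm_def by blast
qed

lemma vset_of: "get (vset_of p vs S) x \<longleftrightarrow> get S x \<or> x \<in> get p ` set vs"
  by (induction p vs S rule: vset_of.induct) (auto simp: get_put)

lemma same_points:
  "same_points t p qs rs \<Longrightarrow> q \<in> set qs \<Longrightarrow> \<exists>r\<in>set rs. set (point t r) \<subseteq> get p ` set (point t q)"
  by (induction t p qs rs rule: same_points.induct) (auto simp: all_in_iff vset_of)

lemma mono_triangleE:
  assumes "monochromatic_triangle G c T"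
  obtains x y z where "T = {x, y, z}" "x \<noteq> y" "x \<noteq> z" "y \<noteq> z" "T \<subseteq> pverts G"
    "\<And>u v. u \<in> T \<Longrightarrow> v \<in> T \<Longrightarrow> u \<noteq> v \<Longrightarrow> (u, v) \<in> parcs G" "c {x, y} = c {x, z}" "c {x, y} = c {y, z}"
proof -
  from assms have cl: "is_clique G T" and "card T = 3" and ex: "\<exists>b. \<forall>u\<in>T. \<forall>v\<in>T. u \<noteq> v \<longrightarrow> c {u, v} = b"
    unfolding monochromatic_triangle_def is_triangle_def by auto
  then obtain x y z where T: "T = {x, y, z}" "x \<noteq> y" "x \<noteq> z" "y \<noteq> z" by (auto simp: card_3_iff)
  show ?thesis
    using ex T cl unfolding is_clique_def by (intro that[OF T]) auto
qed

lemma mono_triangleI: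
  assumes "x \<noteq> y" "x \<noteq> z" "y \<noteq> z" "{x, y, z} \<subseteq> pverts G"
    "\<And>u v. u \<in> {x, y, z} \<Longrightarrow> v \<in> {x, y, z} \<Longrightarrow> u \<noteq> v \<Longrightarrow> (u, v) \<in> parcs G"
    "c {x, y} = c {x, z}" "c {x, y} = c {y, z}"
  shows "monochromatic_triangle G c {x, y, z}"
  unfolding monochromatic_triangle_def is_triangle_def is_clique_def
  using assms by (auto simp: insert_commute)

section \<open>The nine vertices outside an independent set\<close>

locale ramsey_split =
  fixes G :: "'a pair_pre_digraph" and A :: "'a set"
  assumes graph: "pair_graph G" and minimal: "minimal_ramsey_3_3 G"
    and no_5_clique: "is_clique G S \<Longrightarrow> card S \<noteq> 5"
    and indep: "is_independent G A"
begin

interpretation pair_graph G by (rule graph)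

lemma arcs_sym: "(u, v) \<in> parcs G \<Longrightarrow> (v, u) \<in> parcs G"
  using sym_arcs by (auto simp: symmetric_def elim: symE)

lemma arcs_verts: "(u, v) \<in> parcs G \<Longrightarrow> u \<in> pverts G \<and> v \<in> pverts G"
  using in_arcsD1 in_arcsD2 by blast

text \<open>The size of the complement of \<open>A\<close> is no assumption of the locale: a
  labelling exists only if exactly nine vertices lie outside \<open>A\<close>.\<close>

definition labelling :: "(vx \<Rightarrow> 'a) \<Rightarrow> bool" where
  "labelling f \<longleftrightarrow> bij_betw f UNIV (pverts G - A)"

lemma labellingD:
  assumes "labelling f"
  shows "f u = f v \<longleftrightarrow> u = v" "f u \<in> pverts G" "f u \<notin> A" "x \<in> pverts G \<Longrightarrow> x \<notin> A \<Longrightarrow> \<exists>u. x = f u"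
  using assms unfolding labelling_def bij_betw_def inj_def by (blast, blast, blast, blast)

text \<open>\<open>P\<close> is a lower bound for the non-edges and \<open>D\<close> a lower bound
  for the edges. Pairs in neither remain undecided, so one fact about \<open>P\<close> and
  \<open>D\<close> covers many graphs.\<close>

definition fits :: "(vx \<Rightarrow> 'a) \<Rightarrow> mat \<Rightarrow> mat \<Rightarrow> bool" where
  "fits f P D \<longleftrightarrow> labelling f \<and> (\<forall>u v. linked P u v \<longrightarrow> (f u, f v) \<notin> parcs G) \<and>
     (\<forall>u v. u \<noteq> v \<longrightarrow> linked D u v \<longrightarrow> (f u, f v) \<in> parcs G)"

text \<open>Quantifying over all labellings makes the notion invariant under relabelling, so that a
  settled graph can be used through any isomorphic copy. \<open>good nomat\<close> is the
  unconditional bound.\<close>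

definition good :: "mat \<Rightarrow> bool" where
  "good P \<longleftrightarrow> (\<forall>f. labelling f \<longrightarrow> (\<forall>u v. linked P u v \<longrightarrow> (f u, f v) \<notin> parcs G) \<longrightarrow> card A \<le> 20)"

lemma clique_around:
  assumes f: "labelling f" and a: "a \<in> A" and q: "\<forall>v\<in>set q. (a, f v) \<in> parcs G"
    "card (set q) = 4" "\<forall>x\<in>set q. \<forall>y\<in>set q. x \<noteq> y \<longrightarrow> (f x, f y) \<in> parcs G"
  shows False
proof -
  have "is_clique G (insert a (f ` set q))"
    unfolding is_clique_def using q(1,3) a labellingD[OF f] arcs_sym arcs_verts indep
    unfolding is_independent_def by auto
  moreover have "card (f ` set q) = 4" using q(2) labellingD(1)[OF f] by (simp add: card_image inj_on_def)
  moreover have "a \<notin> f ` set q" using labellingD(3)[OF f] a by auto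
  ultimately show False using no_5_clique by force
qed

text \<open>If no neighbourhood contained a listed point, every neighbourhood would split, as it
  contains no 4-clique of \<open>D\<close> either. The colouring then extends to all of
  \<open>G\<close> without a monochromatic triangle, against the Ramsey property.\<close>

lemma hit:
  assumes fits: "fits f P D" and P: "symm P" and R: "symm R" and ok: "colouring_ok P R (pts @ qs)"
    and qs: "\<And>q. q \<in> set qs \<Longrightarrow> card (set q) = 4" "\<And>q x y. q \<in> set qs \<Longrightarrow> x \<in> set q \<Longrightarrow> y \<in> set q \<Longrightarrow> x \<noteq> y \<Longrightarrow> linked D x y"
  shows "\<exists>p\<in>set pts. \<exists>a\<in>A. \<forall>v\<in>set p. (a, f v) \<in> parcs G"
proof (rule ccontr)
  assume none: "\<not> ?thesis"
  have f: "labelling f" and nonadj: "\<And>u v. linked P u v \<Longrightarrow> (f u, f v) \<notin> parcs G"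
    and adj: "\<And>u v. u \<noteq> v \<Longrightarrow> linked D u v \<Longrightarrow> (f u, f v) \<in> parcs G"
    using fits unfolding fits_def by blast+
  note lab = labellingD[OF f]
  define B where "B = others P R"
  define S where "S a = {v. (a, f v) \<in> parcs G}" for a
  have B: "symm B" using P R unfolding B_def symm_def linked_others by blast
  from ok have tR: "tfree_rows R vxs" and tB: "tfree_rows B vxs" and u: "unblocked R B (pts @ qs) (nine_of True) none"
    unfolding colouring_ok_def B_def Let_def by auto
  have split: "splits (linked R) (linked B) (S a)" if a: "a \<in> A" for a
  proof (rule unblocked_sound[OF R B u])
    show "\<forall>b\<in>set (pts @ qs). \<not> set b \<subseteq> S a"
    proof
      fix b assume "b \<in> set (pts @ qs)"
      then consider "b \<in> set pts" | "b \<in> set qs" by auto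
      then show "\<not> set b \<subseteq> S a"
      proof cases
        case 1
        with none a show ?thesis unfolding S_def by blast
      next
        case 2
        with clique_around[OF f a, of b] qs[OF 2] adj show ?thesis unfolding S_def by blast
      qed
    qed
  qed (auto simp: S_def)
  then have "\<forall>a\<in>A. \<exists>X. (\<forall>u\<in>S a \<inter> X. \<forall>v\<in>S a \<inter> X. u \<noteq> v \<longrightarrow> \<not> linked R u v) \<and>
      (\<forall>u\<in>S a - X. \<forall>v\<in>S a - X. u \<noteq> v \<longrightarrow> \<not> linked B u v)"
    unfolding splits_def by simp
  from bchoice[OF this] obtain X where X': "\<forall>a\<in>A. (\<forall>u\<in>S a \<inter> X a. \<forall>v\<in>S a \<inter> X a. u \<noteq> v \<longrightarrow> \<not> linked R u v) \<and>
      (\<forall>u\<in>S a - X a. \<forall>v\<in>S a - X a. u \<noteq> v \<longrightarrow> \<not> linked B u v)"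
    by (rule exE)
  have X: "\<not> linked R u v" if "a \<in> A" "u \<in> S a" "v \<in> S a" "u \<noteq> v" "u \<in> X a" "v \<in> X a" for a u v
    using bspec[OF X' that(1)] that(2-) by simp
  have X2: "\<not> linked B u v" if "a \<in> A" "u \<in> S a" "v \<in> S a" "u \<noteq> v" "u \<notin> X a" "v \<notin> X a" for a u v
    using bspec[OF X' that(1)] that(2-) by simp
  \<comment> \<open>\<open>True\<close> is red. Inside the nine vertices the given red edges are
    used, and at \<open>a\<close> the part \<open>X a\<close> of its splitting. Since
    \<open>A\<close> is independent, these clauses decide every edge of \<open>G\<close>.\<close>
  define c where "c e \<longleftrightarrow> (\<exists>u v. u \<noteq> v \<and> e = {f u, f v} \<and> linked R u v) \<or> (\<exists>a\<in>A. \<exists>u\<in>X a. e = {a, f u})" for e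
  have c1: "c {f u, f v} = linked R u v" if "u \<noteq> v" for u v
    using that lab R unfolding c_def symm_def doubleton_eq_iff by metis
  have c2: "c {a, f u} = (u \<in> X a)" if "a \<in> A" for a u
    using that lab unfolding c_def doubleton_eq_iff by metis
  have in_B: "linked B u v" if "u \<noteq> v" "(f u, f v) \<in> parcs G" "\<not> linked R u v" for u v
    using that nonadj unfolding B_def linked_others by blast
  have inside: False if "u \<noteq> v" "u \<noteq> w" "v \<noteq> w" "(f u, f v) \<in> parcs G" "(f u, f w) \<in> parcs G" "(f v, f w) \<in> parcs G"
      "c {f u, f v} = c {f u, f w}" "c {f u, f v} = c {f v, f w}" for u v w
  proof (cases "linked R u v")
    case True
    with that c1 tfree[OF tR R, of u v w] show False by auto
  next
    case False
    with that c1 in_B tfree[OF tB B, of u v w] show False by auto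
  qed
  have apex: False if "a \<in> A" "u \<noteq> v" "(a, f u) \<in> parcs G" "(a, f v) \<in> parcs G" "(f u, f v) \<in> parcs G"
      "c {a, f u} = c {a, f v}" "c {a, f u} = c {f u, f v}" for a u v
    using that c1[OF that(2)] c2[OF that(1)] in_B[OF that(2,5)] X[OF that(1), of u v] X2[OF that(1), of u v] unfolding S_def by auto
  have apex': False if "a \<in> A" "y \<noteq> z" "(a, y) \<in> parcs G" "(a, z) \<in> parcs G" "(y, z) \<in> parcs G"
      "c {a, y} = c {a, z}" "c {a, y} = c {y, z}" for a y z
  proof -
    have "y \<notin> A" "z \<notin> A" using that indep unfolding is_independent_def by auto
    moreover have "y \<in> pverts G" "z \<in> pverts G" using arcs_verts that(3,4) by blast+
    ultimately have "\<exists>u. y = f u" "\<exists>v. z = f v" by (simp_all add: lab(4))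
    then obtain u v where "y = f u" "z = f v" by blast
    with apex[of a u v] that lab(1) show False by auto
  qed
  from minimal obtain T where "monochromatic_triangle G c T"
    unfolding minimal_ramsey_3_3_def ramsey_3_3_def by blast
  from mono_triangleE[OF this] obtain x y z where T: "T = {x, y, z}" "x \<noteq> y" "x \<noteq> z" "y \<noteq> z" "T \<subseteq> pverts G"
    and arcs: "\<And>u v. u \<in> T \<Longrightarrow> v \<in> T \<Longrightarrow> u \<noteq> v \<Longrightarrow> (u, v) \<in> parcs G"
    and mono: "c {x, y} = c {x, z}" "c {x, y} = c {y, z}"
    by metis
  \<comment> \<open>By independence a triangle has at most one vertex in \<open>A\<close>; if it has
    one, that vertex is the apex.\<close>
  consider "x \<in> A" | "y \<in> A" | "z \<in> A" | "x \<notin> A" "y \<notin> A" "z \<notin> A" by blast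
  then show False
  proof cases
    case 1
    with apex'[of x y z] T arcs mono show False by auto
  next
    case 2
    with apex'[of y x z] T arcs mono show False by (auto simp: insert_commute)
  next
    case 3
    with apex'[of z x y] T arcs mono show False by (auto simp: insert_commute)
  next
    case 4
    then have "\<exists>u. x = f u" "\<exists>v. y = f v" "\<exists>w. z = f w" using T(1,5) by (simp_all add: lab(4))
    then obtain u v w where "x = f u" "y = f v" "z = f w" by blast
    with inside[of u v w] T arcs mono lab(1) show False by auto
  qed
qed

section \<open>The bound from minimality of the graph\<close>

definition met :: "(vx \<Rightarrow> 'a) \<Rightarrow> vx list nine nine \<Rightarrow> point_id list \<Rightarrow> bool" where
  "met f t h \<longleftrightarrow> (\<exists>q\<in>set h. \<exists>a\<in>A. \<forall>v\<in>set (point t q). (a, f v) \<in> parcs G)"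

text \<open>The points contained in neighbourhoods form a transversal \<open>T\<close> of the
  families; a part \<open>T'\<close> with at most \<open>length b\<close> points is still one.
  Keeping a single apex \<alpha> q for each q in \<open>T'\<close> leaves a Ramsey graph: a good
  colouring of it would be blocked by every point of some family, yet \<open>T'\<close> meets this
  family and the apex there provides a splitting. By minimality nothing was removed, so
  \<open>A\<close> consists of the chosen apices.\<close>

lemma bounded_by_cover:
  assumes fits: "fits f P D" and D: "symm D" and met: "\<And>h. h \<in> set hs \<Longrightarrow> met f t h"
    and covered: "covered zs Q' hs [] (Some b) cs = Some r" and refuted: "refuted_root Q t H D tr" "table_within H (set hs)"
  shows "card A \<le> length b"
proof -
  have f: "labelling f" and adj: "\<And>u v. u \<noteq> v \<Longrightarrow> linked D u v \<Longrightarrow> (f u, f v) \<in> parcs G"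
    using fits unfolding fits_def by blast+
  note lab = labellingD[OF f]
  define T where "T = {q. \<exists>a\<in>A. \<forall>v\<in>set (point t q). (a, f v) \<in> parcs G}"
  have "hits T hs" using met unfolding hits_def T_def met_def by blast
  from cover[OF covered this] obtain T' where T': "T' \<subseteq> T" "hits T' hs" "card T' \<le> length b" by blast
  from T'(1) have "\<forall>q\<in>T'. \<exists>a. a \<in> A \<and> (\<forall>v\<in>set (point t q). (a, f v) \<in> parcs G)" unfolding T_def by blast
  then obtain \<alpha> where \<alpha>: "\<And>q. q \<in> T' \<Longrightarrow> \<alpha> q \<in> A" "\<And>q v. q \<in> T' \<Longrightarrow> v \<in> set (point t q) \<Longrightarrow> (\<alpha> q, f v) \<in> parcs G"
    by metis
  \<comment> \<open>The nine vertices outside \<open>A\<close> together with one apex for each point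
    of \<open>T'\<close>; \<open>K\<close> is the subgraph induced on them.\<close>
  define W where "W = (pverts G - A) \<union> \<alpha> ` T'"
  define K where "K = \<lparr> pverts = W, parcs = parcs G \<inter> W \<times> W \<rparr>"
  have A_verts: "A \<subseteq> pverts G" using indep unfolding is_independent_def by blast
  have W: "W \<subseteq> pverts G" using \<alpha>(1) A_verts unfolding W_def by blast
  have fW: "f u \<in> W" for u using lab unfolding W_def by blast
  have K_graph: "pair_graph K"
    using finite_subset[OF W finite_verts] finite_arcs no_loops arcs_sym
    by unfold_locales (auto simp: K_def symmetric_def intro!: symI)
  have sub: "subgraph (with_proj K) (with_proj G)"
  proof -
    interpret K: pair_graph K by (rule K_graph)
    have "wf_digraph (with_proj K)" by unfold_locales
    moreover have "wf_digraph (with_proj G)" by unfold_locales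
    ultimately show ?thesis using W unfolding subgraph_def compatible_def by (auto simp: K_def)
  qed
  have ramsey: "ramsey_3_3 K"
  proof (rule ccontr)
    assume "\<not> ramsey_3_3 K"
    then obtain c where c: "\<And>T. \<not> monochromatic_triangle K c T" unfolding ramsey_3_3_def by blast
    have free: False if "x \<noteq> y" "x \<noteq> z" "y \<noteq> z" "x \<in> W" "y \<in> W" "z \<in> W" "(x, y) \<in> parcs G" "(x, z) \<in> parcs G" "(y, z) \<in> parcs G"
      "c {x, y} = c {x, z}" "c {x, y} = c {y, z}" for x y z
    proof -
      have "monochromatic_triangle K c {x, y, z}"
        using that arcs_sym by (intro mono_triangleI) (auto simp: K_def)
      with c show False by blast
    qed
    define \<kappa> where "\<kappa> u v = c {f u, f v}" for u v
    interpret tree_colouring D \<kappa>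
    proof
      show "symm D" by (rule D)
      show "\<kappa> u v = \<kappa> v u" for u v by (simp add: \<kappa>_def insert_commute)
      show "\<not> (\<kappa> u v = \<kappa> u w \<and> \<kappa> u v = \<kappa> v w)"
        if "u \<noteq> v" "u \<noteq> w" "v \<noteq> w" "linked D u v" "linked D u w" "linked D v w" for u v w
        using free[of "f u" "f v" "f w"] that lab(1) fW adj unfolding \<kappa>_def by blast
    qed
    from refuted_root_sound[OF refuted(2,1)] obtain h where h: "h \<in> set hs" "\<And>q. q \<in> set h \<Longrightarrow> blocked (set (point t q))" by blast
    from T'(2) h(1) obtain q where q: "q \<in> set h" "q \<in> T'" unfolding hits_def by blast
    have "splits (\<lambda>u v. linked D u v \<and> \<kappa> u v) (\<lambda>u v. linked D u v \<and> \<not> \<kappa> u v) (set (point t q))"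
      unfolding splits_def
    \<comment> \<open>The splitting is read off the apex: the vertices joined to it in red and those
      joined to it in blue. A red edge inside the first part, or a blue one inside the second, would
      close a monochromatic triangle in \<open>K\<close>.\<close>
    proof (intro exI[of _ "{v. c {\<alpha> q, f v}}"] conjI ballI impI notI)
      have aW: "\<alpha> q \<in> W" "\<And>v. \<alpha> q \<noteq> f v" using \<alpha>(1) q(2) lab(3) unfolding W_def by (blast, metis)
      fix u v
      assume "u \<in> set (point t q) \<inter> {v. c {\<alpha> q, f v}}" "v \<in> set (point t q) \<inter> {v. c {\<alpha> q, f v}}" "u \<noteq> v" "linked D u v \<and> \<kappa> u v"
      then show False
        using free[of "\<alpha> q" "f u" "f v"] \<alpha>(2)[OF q(2)] aW fW lab(1) adj[of u v] unfolding \<kappa>_def by auto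
    next
      have aW: "\<alpha> q \<in> W" "\<And>v. \<alpha> q \<noteq> f v" using \<alpha>(1) q(2) lab(3) unfolding W_def by (blast, metis)
      fix u v
      assume "u \<in> set (point t q) - {v. c {\<alpha> q, f v}}" "v \<in> set (point t q) - {v. c {\<alpha> q, f v}}" "u \<noteq> v" "linked D u v \<and> \<not> \<kappa> u v"
      then show False
        using free[of "\<alpha> q" "f u" "f v"] \<alpha>(2)[OF q(2)] aW fW lab(1) adj[of u v] unfolding \<kappa>_def by auto
    qed
    with h(2)[OF q(1)] show False unfolding blocked_def by blast
  qed
  \<comment> \<open>\<open>K\<close> is a subgraph of \<open>G\<close> that is still Ramsey, so it
    cannot be a proper one.\<close>
  have "K = G" using minimal K_graph sub ramsey unfolding minimal_ramsey_3_3_def by blast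
  then have "W = pverts G" unfolding K_def by (metis pair_pre_digraph.select_convs(1))
  then have "A \<subseteq> \<alpha> ` T'" using A_verts unfolding W_def by blast
  then have "card A \<le> card (\<alpha> ` T')" by (intro card_mono finite_imageI finite_pt)
  also have "\<dots> \<le> card T'" by (intro card_image_le finite_pt)
  finally show ?thesis using T'(3) by simp
qed

end

lemma symm_node_mat [simp]: "symm (node_mat ds)"
  by (cases ds rule: node_mat.cases) (simp_all add: symm_links)

section \<open>Induction along the enumeration of graphs\<close>

context ramsey_split
begin

lemma arcs_irrefl: "(u, u) \<notin> parcs G"
proof -
  interpret pair_graph G by (rule graph)
  show ?thesis using no_loops' by blast
qed

lemma labelling_permuted: "labelling f \<Longrightarrow> isperm p \<Longrightarrow> labelling (\<lambda>v. f (get p v))"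
  unfolding labelling_def using bij_betw_trans[of "get p" UNIV UNIV f] isperm_bij[of p] by (simp add: comp_def)

definition trie_ok :: "trie \<Rightarrow> bool" where
  "trie_ok T \<longleftrightarrow> (\<forall>i j k ds. get (get (get T i) j) k = Some ds \<longrightarrow> good (links ds nomat))"

text \<open>If the settled graph embeds into \<open>P\<close> by a permutation \<open>p\<close>,
  then composing a labelling that avoids \<open>P\<close> with \<open>p\<close> gives one that
  avoids the settled graph.\<close>

lemma take_branch:
  assumes br: "take_branch T P ds = Some ds'" and T: "trie_ok T" and P: "symm P"
  shows "good P"
proof -
  obtain i j k es p where ds: "get (get (get T i) j) k = Some es" "isperm p" "embeds es p P"
    using br by (cases "(T, P, ds)" rule: take_branch.cases)
      (auto simp: Let_def simp del: isperm.simps embeds.simps embedding.simps split: option.splits if_splits)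
  then have good: "good (links es nomat)" using T unfolding trie_ok_def by blast
  show ?thesis
    unfolding good_def
  proof (intro allI impI)
    fix f assume f: "labelling f" and nonadj: "\<forall>u v. linked P u v \<longrightarrow> (f u, f v) \<notin> parcs G"
    have "\<forall>u v. linked (links es nomat) u v \<longrightarrow> (f (get p u), f (get p v)) \<notin> parcs G"
      using embeds_links[OF ds(3) P, of nomat] nonadj by auto
    with good labelling_permuted[OF f ds(2)] show "card A \<le> 20" unfolding good_def by blast
  qed
qed

lemma branches:
  "branches T D P es ds \<Longrightarrow> trie_ok T \<Longrightarrow> symm P \<Longrightarrow> (u, v) \<in> set es \<Longrightarrow> linked D u v \<Longrightarrow> good (link P u v)"
proof (induction T D P es ds rule: branches.induct)
  case (2 T D P u' v' es ds)
  show ?case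
  proof (cases "linked D u' v'")
    case True
    with 2(3) obtain ds' where ds': "take_branch T (link P u' v') ds = Some ds'" "branches T D P es ds'"
      by (auto split: option.splits)
    show ?thesis
    proof (cases "(u, v) = (u', v')")
      case eq: True
      then show ?thesis using take_branch[OF ds'(1) 2(4) symm_link[OF 2(5)]] by simp
    next
      case False
      with 2(6) show ?thesis using 2(1)[OF True ds'(1) ds'(2) 2(4,5) _ 2(7)] by auto
    qed
  next
    case False
    have "branches T D P es ds" using 2(3) False by simp
    moreover have "(u, v) \<in> set es" using 2(6,7) False by auto
    ultimately show ?thesis using 2(2)[OF False] 2(4,5,7) by blast
  qed
qed simp

lemma good_node:
  assumes br: "branches T D P (pairs vxs) ds" and T: "trie_ok T" and P: "symm P" and D: "symm D"
    and fits: "\<And>f. fits f P D \<Longrightarrow> card A \<le> 20"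
  shows "good P"
  unfolding good_def
proof (intro allI impI)
  fix f assume f: "labelling f" and nonadj: "\<forall>u v. linked P u v \<longrightarrow> (f u, f v) \<notin> parcs G"
  show "card A \<le> 20"
  proof (cases "fits f P D")
    case True
    then show ?thesis by (rule fits)
  next
    case False
    then obtain u v where uv: "u \<noteq> v" "linked D u v" "(f u, f v) \<notin> parcs G"
      using f nonadj unfolding fits_def by blast
    then have vu: "(f v, f u) \<notin> parcs G" using arcs_sym by blast
    have "(u, v) \<in> set (pairs vxs) \<or> (v, u) \<in> set (pairs vxs)" using uv(1) by (intro set_pairs) auto
    then have "good (link P u v) \<or> good (link P v u)"
      using branches[OF br T P] uv(2) D unfolding symm_def by blast
    moreover have "\<forall>x y. linked (link P u v) x y \<longrightarrow> (f x, f y) \<notin> parcs G" "\<forall>x y. linked (link P v u) x y \<longrightarrow> (f x, f y) \<notin> parcs G"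
      using nonadj uv(3) vu unfolding linked_link by auto
    ultimately show ?thesis using f unfolding good_def by blast
  qed
qed

lemma no_quint:
  assumes "fits f P D" "card (set q) = 5" "\<And>x y. x \<in> set q \<Longrightarrow> y \<in> set q \<Longrightarrow> x \<noteq> y \<Longrightarrow> linked D x y"
  shows False
proof -
  have f: "labelling f" using assms(1) unfolding fits_def by blast
  have "is_clique G (f ` set q)"
    unfolding is_clique_def using assms(1,3) labellingD(1,2)[OF f] unfolding fits_def by auto
  moreover have "card (f ` set q) = 5" using assms(2) labellingD(1)[OF f] by (simp add: card_image inj_on_def)
  ultimately show False using no_5_clique by blast
qed

text \<open>This is how one colouring yields a whole orbit of families: a family that every fitting
  labelling must meet is met after composition with an automorphism of \<open>P\<close> and
  \<open>D\<close>, and that says that its image is met.\<close>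

lemma fits_permuted:
  assumes "fits f P D" "isperm p" "embeds_pairs (pairs vxs) p P" "embeds_pairs (pairs vxs) p D" "symm P" "symm D"
  shows "fits (\<lambda>v. f (get p v)) P D"
proof -
  have f: "labelling f" using assms(1) unfolding fits_def by blast
  have inj: "get p u = get p v \<longleftrightarrow> u = v" for u v
    using isperm_bij[OF assms(2)] by (simp add: bij_def inj_eq)
  have "(f (get p u), f (get p v)) \<notin> parcs G" if "linked P u v" for u v
  proof (cases "u = v")
    case True
    then show ?thesis using arcs_irrefl by simp
  next
    case False
    with assms(1) embeds_pairs[OF assms(3,5) that] show ?thesis unfolding fits_def by blast
  qed
  moreover have "(f (get p u), f (get p v)) \<in> parcs G" if "u \<noteq> v" "linked D u v" for u v
    using assms(1) embeds_pairs[OF assms(4,6) that(2,1)] inj that(1) unfolding fits_def by blast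
  ultimately show ?thesis using labelling_permuted[OF f assms(2)] unfolding fits_def by blast
qed

lemma automorphic_images:
  assumes P: "symm P" and D: "symm D" and met: "\<And>f. fits f P D \<Longrightarrow> met f t h"
  shows "automorphic_images t ix P D h ks = Some hs \<Longrightarrow> h' \<in> set hs \<Longrightarrow> fits f P D \<Longrightarrow> met f t h'"
proof (induction ks arbitrary: hs)
  case Nil
  then show ?case by simp
next
  case (Cons k ks)
  then obtain g hs' where g: "automorphic_image t ix P D h (hex k) = Some g" "automorphic_images t ix P D h ks = Some hs'" "hs = g # hs'"
    by (auto split: option.splits)
  show ?case
  proof (cases "h' = g")
    case False
    with Cons g show ?thesis by simp
  next
    case True
    obtain p where p: "isperm p" "embeds_pairs (pairs vxs) p P" "embeds_pairs (pairs vxs) p D" "same_points t p h g"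
      using g(1) by (cases "(t, ix, P, D, h, hex k)" rule: automorphic_image.cases)
        (auto simp: Let_def simp del: isperm.simps split: if_splits)
    from met[OF fits_permuted[OF Cons.prems(3) p(1-3) P D]]
    obtain q a where q: "q \<in> set h" "a \<in> A" "\<forall>v\<in>set (point t q). (a, f (get p v)) \<in> parcs G"
      unfolding met_def by blast
    from same_points[OF p(4) q(1)] obtain r where "r \<in> set g" "set (point t r) \<subseteq> get p ` set (point t q)" by blast
    with q(2,3) True show ?thesis unfolding met_def by blast
  qed
qed

lemma families:
  assumes P: "symm P" and D: "symm D"
    and qs: "\<And>q. q \<in> set qs \<Longrightarrow> card (set q) = 4" "\<And>q x y. q \<in> set qs \<Longrightarrow> x \<in> set q \<Longrightarrow> y \<in> set q \<Longrightarrow> x \<noteq> y \<Longrightarrow> linked D x y"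
  shows "families t ix ks P D qs fs = Some hs \<Longrightarrow> h \<in> set hs \<Longrightarrow> fits f P D \<Longrightarrow> met f t h"
proof (induction fs arbitrary: hs)
  case Nil
  then show ?case by simp
next
  case (Cons F fs)
  obtain r k where F: "F = Fam r k" by (cases F)
  define h0 where "h0 = point_ids (hex k)"
  from Cons.prems(1) obtain hs1 hs2 where ok: "colouring_ok P (links (hex r) nomat) (map (point t) h0 @ qs)"
    "automorphic_images t ix P D h0 ks = Some hs1" "families t ix ks P D qs fs = Some hs2" "hs = h0 # hs1 @ hs2"
    unfolding F h0_def by (auto simp: Let_def split: if_splits option.splits)
  have h0: "met f t h0" if "fits f P D" for f
    using hit[OF that P symm_links[OF symm_nomat] ok(1) qs] unfolding met_def by auto
  from automorphic_images[OF P D h0 ok(2)] h0 Cons ok(3,4) show ?case by auto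
qed

lemma valid:
  assumes valid: "valid T k c" and T: "trie_ok T"
  shows "good (node_mat k)"
proof (cases c)
  case (Clique5 q bs)
  then have q: "quint (hex q)" and br: "branches T (clique (hex q) nomat) (node_mat k) (pairs vxs) (hexes bs)"
    using valid by simp_all
  show ?thesis
    using good_node[OF br T symm_node_mat symm_clique[OF symm_nomat]] no_quint[OF _ quint[OF q]] clique_linked Clique5 by fastforce
next
  case (Nice qs r bs)
  define P where "P = node_mat k"
  have q: "quad (hex q)" if "q \<in> set qs" for q using that valid Nice by (auto simp: list_all_iff Let_def)
  have ok: "colouring_ok P (links (hex r) nomat) ([] @ map hex qs)" and br: "branches T (cliques qs nomat) P (pairs vxs) (hexes bs)"
    using valid Nice by (simp_all add: P_def Let_def)
  \<comment> \<open>Here the list of points is empty, so \<open>hit\<close> promises a member of the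
    empty list: no labelling fits, and only the branches remain.\<close>
  have False if "fits f P (cliques qs nomat)" for f
    using hit[OF that _ symm_links[OF symm_nomat] ok] quad[OF q] cliques_linked by (fastforce simp: P_def)
  then have "good P" by (intro good_node[OF br T]) (auto simp: P_def symm_cliques)
  then show ?thesis by (simp add: P_def Nice)
next
  case (System qs e ps as fs tr Q cs Q' bs)
  define P where "P = node_mat k"
  define D where "D = links (hex e) (cliques qs nomat)"
  define t where "t = point_table ps (List.product vxs vxs) (nine_of (nine_of []))"
  have q: "quad (hex q)" if "q \<in> set qs" for q using that valid System by (auto simp: list_all_iff Let_def)
  have P: "symm P" and D: "symm D" by (simp_all add: P_def D_def symm_links symm_cliques)
  from valid System obtain hs r where hs: "families t (zip (List.product vxs vxs) (map hex ps)) as P D (map hex qs) fs = Some hs"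
    and refuted: "refuted_root Q t (edge_table hs (List.product vxs (List.product vxs vxs)) (nine_of (nine_of (nine_of None)))) D (hexes tr)"
    and covered: "covered (pairs vxs) Q' hs [] (Some budget) (hexes cs) = Some r"
    and br: "branches T D P (pairs vxs) (hexes bs)"
    by (auto simp: P_def D_def t_def Let_def split: option.splits)
  have register_all: "table_within (edge_table hs (List.product vxs (List.product vxs vxs)) (nine_of (nine_of (nine_of None)))) (set hs)"
    by (rule edge_table) (simp_all add: table_within_def)
  have "card A \<le> 20" if fits: "fits f P D" for f
  proof -
    have "met f t h" if "h \<in> set hs" for h
    proof (rule families[OF P D _ _ hs that fits])
      fix q assume "q \<in> set (map hex qs)"
      then obtain k' where k': "k' \<in> set qs" "q = hex k'" by auto
      then show "card (set q) = 4" using quad q by blast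
      show "linked D x y" if "x \<in> set q" "y \<in> set q" "x \<noteq> y" for x y
        unfolding D_def using k' that by (intro links_mono cliques_linked) auto
    qed
    from bounded_by_cover[OF fits D this covered refuted register_all] show ?thesis by (simp add: budget_def)
  qed
  then have "good P" by (rule good_node[OF br T P D])
  then show ?thesis by (simp add: P_def System)
qed

lemma trie_ok_register:
  assumes T: "trie_ok T" and k: "good (node_mat k)"
  shows "trie_ok (register k T)"
proof (cases "(k, T)" rule: register.cases)
  case (1 i j l ds)
  show ?thesis
    unfolding trie_ok_def
  proof (intro allI impI)
    fix i' j' l' ds'
    assume "get (get (get (register k T) i') j') l' = Some ds'"
    then have "ds' = ds \<or> get (get (get T i') j') l' = Some ds'"
      using 1 by (cases "i = i'"; cases "j = j'"; cases "l = l'") (simp_all add: get_put)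
    then show "good (links ds' nomat)" using T k 1 unfolding trie_ok_def by auto
  qed
qed (use T in simp_all)

lemma trie_ok_empty: "trie_ok empty_trie"
  by (simp add: trie_ok_def)

lemma trie_ok_register_all: "valid_all T ks cs \<Longrightarrow> trie_ok T \<Longrightarrow> trie_ok (register_all ks T)"
  by (induction T ks cs rule: valid_all.induct) (auto simp del: valid.simps intro: trie_ok_register valid)

lemma valid_all_good: "valid_all T ks cs \<Longrightarrow> trie_ok T \<Longrightarrow> k \<in> set ks \<Longrightarrow> good (node_mat (hex k))"
  by (induction T ks cs rule: valid_all.induct) (auto simp del: valid.simps node_mat.simps intro: trie_ok_register valid)

end

section \<open>Clique number and independence number\<close>

lemma clique_number_ge:
  assumes "pair_graph G" "is_clique G S"
  shows "card S \<le> clique_number G"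
proof -
  interpret pair_graph G by (rule assms(1))
  have "{card S | S. is_clique G S} \<subseteq> card ` Pow (pverts G)" unfolding is_clique_def by blast
  then have "finite {card S | S. is_clique G S}" using finite_verts finite_subset by blast
  then show ?thesis unfolding clique_number_def using assms(2) by (intro Max_ge) auto
qed

lemma independence_number_attained:
  assumes "pair_graph G"
  shows "\<exists>S. is_independent G S \<and> card S = independence_number G"
proof -
  interpret pair_graph G by (rule assms)
  let ?C = "{card S | S. is_independent G S}"
  have "?C \<subseteq> card ` Pow (pverts G)" unfolding is_independent_def by blast
  then have "finite ?C" using finite_verts finite_subset by blast
  moreover have "?C \<noteq> {}" by (auto simp: is_independent_def)
  ultimately have "independence_number G \<in> ?C" unfolding independence_number_def by (rule Max_in)
  then show ?thesis by auto
qed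

section \<open>Code equations\<close>

text \<open>
  Congruence rules make the simplifier traverse all arguments below a condition again. The
  auxiliary functions below take the value of the condition as an argument instead, which keeps evaluation with
  large arguments feasible.
\<close>

definition "tfree_row1 c m u v vs = ((if c then apart (get m u) (get m v) else True) \<and> tfree_row m u vs)"

definition "tfree_row2 c m u vs = (c \<and> tfree_row m u vs)"

lemma [code]:
  "tfree_row m u [] = True"
  "tfree_row m u (v # vs) = tfree_row1 (linked m u v) m u v vs"
  "tfree_row1 False m u v vs = tfree_row m u vs"
  "tfree_row1 True m u v vs = tfree_row2 (apart (get m u) (get m v)) m u vs"
  "tfree_row2 True m u vs = tfree_row m u vs"
  "tfree_row2 False m u vs = False"
  by (simp_all add: tfree_row1_def tfree_row2_def)

definition "tfree_rows1 c m us = (c \<and> tfree_rows m us)"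

lemma [code]:
  "tfree_rows m [] = True"
  "tfree_rows m (u # us) = tfree_rows1 (tfree_row m u us) m us"
  "tfree_rows1 True m us = tfree_rows m us"
  "tfree_rows1 False m us = False"
  by (simp_all add: tfree_rows1_def)

definition "splittable1 c R B v vs X Y = (c \<and> splittable R B vs (put X v True) Y \<or> apart (get B v) Y \<and> splittable R B vs X (put Y v True))"

definition "splittable2 c R B v vs X Y = (c \<or> apart (get B v) Y \<and> splittable R B vs X (put Y v True))"

definition "splittable3 c R B v vs X Y = (c \<and> splittable R B vs X (put Y v True))"

lemma [code]:
  "splittable R B [] X Y = True"
  "splittable R B (v # vs) X Y = splittable1 (apart (get R v) X) R B v vs X Y"
  "splittable1 True R B v vs X Y = splittable2 (splittable R B vs (put X v True) Y) R B v vs X Y"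
  "splittable1 False R B v vs X Y = splittable3 (apart (get B v) Y) R B v vs X Y"
  "splittable2 True R B v vs X Y = True"
  "splittable2 False R B v vs X Y = splittable3 (apart (get B v) Y) R B v vs X Y"
  "splittable3 True R B v vs X Y = splittable R B vs X (put Y v True)"
  "splittable3 False R B v vs X Y = False"
  by (simp_all add: splittable1_def splittable2_def splittable3_def)

definition "unblocked1 c R B b bs S K = (if c then unblocked_minus R B bs b S K else unblocked R B bs S K)"

definition "unblocked_minus1 c R B bs v vs S K = ((c \<or> unblocked R B bs (put S v False) K) \<and> unblocked_minus R B bs vs S (put K v True))"

definition "unblocked_minus2 c R B bs v vs S K = (c \<and> unblocked_minus R B bs vs S (put K v True))"

lemma [code]:
  "unblocked R B [] S K = splittable R B (filter (get S) vxs) none none"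
  "unblocked R B (b # bs) S K = unblocked1 (all_in b S) R B b bs S K"
  "unblocked1 True R B b bs S K = unblocked_minus R B bs b S K"
  "unblocked1 False R B b bs S K = unblocked R B bs S K"
  "unblocked_minus R B bs [] S K = True"
  "unblocked_minus R B bs (v # vs) S K = unblocked_minus1 (get K v) R B bs v vs S K"
  "unblocked_minus1 True R B bs v vs S K = unblocked_minus R B bs vs S (put K v True)"
  "unblocked_minus1 False R B bs v vs S K = unblocked_minus2 (unblocked R B bs (put S v False) K) R B bs v vs S K"
  "unblocked_minus2 True R B bs v vs S K = unblocked_minus R B bs vs S (put K v True)"
  "unblocked_minus2 False R B bs v vs S K = False"
  by (simp_all add: unblocked1_def unblocked_minus1_def unblocked_minus2_def)

definition "link1 m' u v = put m' v (put (get m' v) u True)"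

lemma [code]:
  "link m u v = link1 (put m u (put (get m u) v True)) u v"
  by (simp_all add: link_def link1_def Let_def)

definition "embeds1 c ds p m = (c \<and> embeds ds p m)"

lemma [code]:
  "embeds (u # v # ds) p m = embeds1 (linked m (get p u) (get p v)) ds p m"
  "embeds [] p m = True"
  "embeds [u] p m = True"
  "embeds1 True ds p m = embeds ds p m"
  "embeds1 False ds p m = False"
  by (simp_all add: embeds1_def)

definition "place1 c zs m u v ds p F = (case c of None \<Rightarrow> tries zs m (u # v # ds) p F u F vxs
  | Some a \<Rightarrow> (case get p v of None \<Rightarrow> tries zs m (u # v # ds) p F v (get m a) vxs
      | Some b \<Rightarrow> if linked m a b then place zs m ds p F else None))"

definition "place2 c a zs m u v ds p F = (case c of None \<Rightarrow> tries zs m (u # v # ds) p F v (get m a) vxs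
  | Some b \<Rightarrow> if linked m a b then place zs m ds p F else None)"

definition "place3 c zs m ds p F = (if c then place zs m ds p F else None)"

definition "tries1 c zs m ds p F x C w ws = (case (if c then place zs m ds (put p x (Some w)) (put F w False) else None) of
    None \<Rightarrow> tries zs m ds p F x C ws | Some r \<Rightarrow> Some r)"

definition "tries2 c zs m ds p F x C ws = (case c of None \<Rightarrow> tries zs m ds p F x C ws | Some r \<Rightarrow> Some r)"

lemma [code]:
  "place (z # zs) m (u # v # ds) p F = place1 (get p u) zs m u v ds p F"
  "place [] m ds p F = Some (p, F)"
  "place (z # zs) m [] p F = Some (p, F)"
  "place (z # zs) m [u] p F = Some (p, F)"
  "place1 None zs m u v ds p F = tries zs m (u # v # ds) p F u F vxs"
  "place1 (Some a) zs m u v ds p F = place2 (get p v) a zs m u v ds p F"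
  "place2 None a zs m u v ds p F = tries zs m (u # v # ds) p F v (get m a) vxs"
  "place2 (Some b) a zs m u v ds p F = place3 (linked m a b) zs m ds p F"
  "place3 True zs m ds p F = place zs m ds p F"
  "place3 False zs m ds p F = None"
  "tries zs m ds p F x C [] = None"
  "tries zs m ds p F x C (w # ws) = tries1 (get C w \<and> get F w) zs m ds p F x C w ws"
  "tries1 False zs m ds p F x C w ws = tries zs m ds p F x C ws"
  "tries1 True zs m ds p F x C w ws = tries2 (place zs m ds (put p x (Some w)) (put F w False)) zs m ds p F x C ws"
  "tries2 None zs m ds p F x C ws = tries zs m ds p F x C ws"
  "tries2 (Some r) zs m ds p F x C ws = Some r"
  by (simp_all add: place1_def place2_def place3_def tries1_def tries2_def)

definition "completion1 c v vs p fr q = (case c of Some a \<Rightarrow> completion vs p fr (put q v a)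
  | None \<Rightarrow> (case fr of [] \<Rightarrow> q | a # fr' \<Rightarrow> completion vs p fr' (put q v a)))"

lemma [code]:
  "completion [] p fr q = q"
  "completion (v # vs) p fr q = completion1 (get p v) v vs p fr q"
  "completion1 (Some a) v vs p fr q = completion vs p fr (put q v a)"
  "completion1 None v vs p [] q = q"
  "completion1 None v vs p (a # fr') q = completion vs p fr' (put q v a)"
  by (simp_all add: completion1_def)

definition "embedding1 c = (case c of None \<Rightarrow> nine_of V0 | Some (p, F) \<Rightarrow> completion vxs p (filter (get F) vxs) (nine_of V0))"

lemma [code]:
  "embedding x m [] = nine_of V0"
  "embedding x m (u # ds) =
     embedding1 (place (pairs vxs) m (u # ds) (put (nine_of None) u (Some x)) (put (nine_of True) x False))"
  "embedding1 None = nine_of V0"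
  "embedding1 (Some (p, F)) = completion vxs p (filter (get F) vxs) (nine_of V0)"
  by (simp_all add: embedding1_def)

definition "take_branch1 c x P ds = (case c of None \<Rightarrow> None
  | Some es \<Rightarrow> (let p = embedding x P es in if isperm p \<and> embeds es p P then Some ds else None))"

definition "take_branch2 p es P ds = (if isperm p \<and> embeds es p P then Some ds else None)"

definition "take_branch3 c p es P ds = (if c \<and> embeds es p P then Some ds else None)"

definition "take_branch4 c ds = (if c then Some ds else None)"

lemma [code]:
  "take_branch T P (x # i # j # k # ds) = take_branch1 (get (get (get T i) j) k) x P ds"
  "take_branch T P [] = None"
  "take_branch T P [x] = None"
  "take_branch T P [x, i] = None"
  "take_branch T P [x, i, j] = None"
  "take_branch1 None x P ds = None"
  "take_branch1 (Some es) x P ds = take_branch2 (embedding x P es) es P ds"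
  "take_branch2 p es P ds = take_branch3 (isperm p) p es P ds"
  "take_branch3 True p es P ds = take_branch4 (embeds es p P) ds"
  "take_branch3 False p es P ds = None"
  "take_branch4 True ds = Some ds"
  "take_branch4 False ds = None"
  by (simp_all add: take_branch1_def take_branch2_def take_branch3_def take_branch4_def Let_def)

definition "branches1 c T D P u v es ds = (if c then (case take_branch T (link P u v) ds of None \<Rightarrow> False | Some ds' \<Rightarrow> branches T D P es ds')
  else branches T D P es ds)"

definition "branches2 c T D P es = (case c of None \<Rightarrow> False | Some ds' \<Rightarrow> branches T D P es ds')"

lemma [code]:
  "branches T D P [] ds = True"
  "branches T D P ((u, v) # es) ds = branches1 (linked D u v) T D P u v es ds"
  "branches1 False T D P u v es ds = branches T D P es ds"
  "branches1 True T D P u v es ds = branches2 (take_branch T (link P u v) ds) T D P es"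
  "branches2 None T D P es = False"
  "branches2 (Some ds') T D P es = branches T D P es ds'"
  by (simp_all add: branches1_def branches2_def)

definition "all_blocked1 c t R B qs = (\<not> c \<and> all_blocked t R B qs)"

lemma [code]:
  "all_blocked t R B [] = True"
  "all_blocked t R B (q # qs) = all_blocked1 (splittable R B (point t q) none none) t R B qs"
  "all_blocked1 True t R B qs = False"
  "all_blocked1 False t R B qs = all_blocked t R B qs"
  by (simp_all add: all_blocked1_def)

definition "leaf1 c t R B ds = (case c of None \<Rightarrow> None | Some h \<Rightarrow> if all_blocked t R B h then Some ds else None)"

definition "leaf2 c ds = (if c then Some ds else None)"

lemma [code]:
  "leaf_ok t H R B (i # j # k # ds) = leaf1 (get (get (get H i) j) k) t R B ds"
  "leaf_ok t H R B [] = None"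
  "leaf_ok t H R B [i] = None"
  "leaf_ok t H R B [i, j] = None"
  "leaf1 None t R B ds = None"
  "leaf1 (Some h) t R B ds = leaf2 (all_blocked t R B h) ds"
  "leaf2 True ds = Some ds"
  "leaf2 False ds = None"
  by (simp_all add: leaf1_def leaf2_def)

definition "refuted6 c zs Q t H D R B u v ds = (if c then (case ds of i # j # ds' \<Rightarrow> call (refuted zs Q t H D R B (hexes (Q i j))) ds' | _ \<Rightarrow> None)
  else leaf_ok t H R B (v # ds))"

definition "refuted4 c zs Q t H D R B u v = (case c of
    None \<Rightarrow> None
  | Some ds' \<Rightarrow> if apart (get B u) (get B v) then refuted zs Q t H D R (link B u v) ds' else Some ds')"

definition "refuted3 c zs Q t H D R B u v ds = refuted4 (if c then refuted zs Q t H D (link R u v) B ds else Some ds) zs Q t H D R B u v"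

definition "refuted2 c zs Q t H D R B u v ds = (if c then refuted3 (apart (get R u) (get R v)) zs Q t H D R B u v ds else None)"

definition "refuted1 c zs Q t H D R B u v ds = (if c then refuted6 (u = V8) zs Q t H D R B u v ds else refuted2 (linked D u v) zs Q t H D R B u v ds)"

definition "refuted5 c zs Q t H D R B u v ds' = (if c then refuted zs Q t H D R (link B u v) ds' else Some ds')"

lemma [code]:
  "refuted (z # zs) Q t H D R B (u # v # ds) = refuted1 (u = v) zs Q t H D R B u v ds"
  "refuted [] Q t H D R B ds = None"
  "refuted (z # zs) Q t H D R B [] = None"
  "refuted (z # zs) Q t H D R B [u] = None"
  "refuted1 True zs Q t H D R B u v ds = refuted6 (u = V8) zs Q t H D R B u v ds"
  "refuted1 False zs Q t H D R B u v ds = refuted2 (linked D u v) zs Q t H D R B u v ds"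
  "refuted2 False zs Q t H D R B u v ds = None"
  "refuted2 True zs Q t H D R B u v ds = refuted3 (apart (get R u) (get R v)) zs Q t H D R B u v ds"
  "refuted3 True zs Q t H D R B u v ds = refuted4 (refuted zs Q t H D (link R u v) B ds) zs Q t H D R B u v"
  "refuted3 False zs Q t H D R B u v ds = refuted4 (Some ds) zs Q t H D R B u v"
  "refuted4 None zs Q t H D R B u v = None"
  "refuted4 (Some ds') zs Q t H D R B u v = refuted5 (apart (get B u) (get B v)) zs Q t H D R B u v ds'"
  "refuted5 True zs Q t H D R B u v ds' = refuted zs Q t H D R (link B u v) ds'"
  "refuted5 False zs Q t H D R B u v ds' = Some ds'"
  "refuted6 False zs Q t H D R B u v ds = leaf_ok t H R B (v # ds)"
  "refuted6 True zs Q t H D R B u v (i # j # ds') = call (refuted zs Q t H D R B (hexes (Q i j))) ds'"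
  "refuted6 True zs Q t H D R B u v [i] = None"
  "refuted6 True zs Q t H D R B u v [] = None"
  by (simp_all add: refuted1_def refuted2_def refuted3_def refuted4_def refuted5_def refuted6_def)

definition "mem1 c p qs = (c \<or> mem p qs)"

definition "subedge1 c ps e = (c \<and> subedge ps e)"

definition "has_sub1 c ms e = (c \<or> has_sub ms e)"

definition "without1 c p e es = (if c then without p es else e # without p es)"

definition "shrunk1 c p e es = (if c then drop1 p e # shrunk p es else shrunk p es)"

definition "drop2 c p q qs = (if c then drop1 p qs else q # drop1 p qs)"

definition "minimal_edges1 c e es acc = (if c then minimal_edges es acc else minimal_edges es (e # acc))"

lemma [code]:
  "mem p [] = False"
  "mem p (q # qs) = mem1 (p = q) p qs"
  "mem1 True p qs = True"
  "mem1 False p qs = mem p qs"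
  "subedge [] e = True"
  "subedge (p # ps) e = subedge1 (mem p e) ps e"
  "subedge1 True ps e = subedge ps e"
  "subedge1 False ps e = False"
  "has_sub [] e = False"
  "has_sub (m # ms) e = has_sub1 (subedge m e) ms e"
  "has_sub1 True ms e = True"
  "has_sub1 False ms e = has_sub ms e"
  "without p [] = []"
  "without p (e # es) = without1 (mem p e) p e es"
  "without1 True p e es = without p es"
  "without1 False p e es = e # without p es"
  "shrunk p [] = []"
  "shrunk p (e # es) = shrunk1 (mem p e) p e es"
  "shrunk1 True p e es = drop1 p e # shrunk p es"
  "shrunk1 False p e es = shrunk p es"
  "drop1 p [] = []"
  "drop1 p (q # qs) = drop2 (p = q) p q qs"
  "drop2 True p q qs = drop1 p qs"
  "drop2 False p q qs = q # drop1 p qs"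
  "minimal_edges [] acc = acc"
  "minimal_edges (e # es) acc = minimal_edges1 (has_sub acc e) e es acc"
  "minimal_edges1 True e es acc = minimal_edges es acc"
  "minimal_edges1 False e es acc = minimal_edges es (e # acc)"
  by (simp_all add: mem1_def subedge1_def has_sub1_def without1_def shrunk1_def drop2_def minimal_edges1_def)

definition "lonely1 c p l X = (if c then l = ([] :: point_id list list) else lonely p X)"

lemma [code]:
  "lonely p [] = False"
  "lonely p ((q, l) # X) = lonely1 (p = q) p l X"
  "lonely1 True p [] X = True"
  "lonely1 True p (e # l) X = False"
  "lonely1 False p l X = lonely p X"
  by (simp_all add: lonely1_def)

definition "covered5 c zs Q es X i j b = (case c of None \<Rightarrow> None
  | Some ds' \<Rightarrow> covered zs Q (merge (shrunk (i, j) es) (without (i, j) es)) X b ds')"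

definition "covered3 c ds = (if c then Some ds else None)"

definition "covered6 c x y zs Q es X b ds = (if c then call (covered zs Q es X b (hexes (Q x y))) ds else covered3 (lonely (x, y) X) ds)"

definition "covered2 c zs Q es X b j ds = (if c then covered3 (cover_leaf (minimal_edges (minimal_edges es []) []) b) ds
  else (case ds of x # y # ds' \<Rightarrow> covered6 (j = V8) x y zs Q es X b ds' | _ \<Rightarrow> None))"

definition "covered4 c zs Q es X i j b ds = (if c then None
  else covered5 (covered zs Q (without (i, j) es) (((i, j), shrunk (i, j) es) # private_to (i, j) X) (spend b) ds) zs Q es X i j b)"

definition "covered1 c zs Q es X b i j ds = (if c then covered2 (j = V0) zs Q es X b j ds
  else covered4 (mem (i, j) (map fst X)) zs Q es X i j b ds)"

lemma [code]:
  "covered (z # zs) Q es X b (i # j # ds) = covered1 (i = V8) zs Q es X b i j ds"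
  "covered [] Q es X b ds = None"
  "covered (z # zs) Q es X b [] = None"
  "covered (z # zs) Q es X b [i] = None"
  "covered1 True zs Q es X b i j ds = covered2 (j = V0) zs Q es X b j ds"
  "covered1 False zs Q es X b i j ds = covered4 (mem (i, j) (map fst X)) zs Q es X i j b ds"
  "covered2 True zs Q es X b j ds = covered3 (cover_leaf (minimal_edges (minimal_edges es []) []) b) ds"
  "covered2 False zs Q es X b j (x # y # ds) = covered6 (j = V8) x y zs Q es X b ds"
  "covered2 False zs Q es X b j [x] = None"
  "covered2 False zs Q es X b j [] = None"
  "covered6 True x y zs Q es X b ds = call (covered zs Q es X b (hexes (Q x y))) ds"
  "covered6 False x y zs Q es X b ds = covered3 (lonely (x, y) X) ds"
  "covered4 True zs Q es X i j b ds = None"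
  "covered4 False zs Q es X i j b ds =
     covered5 (covered zs Q (without (i, j) es) (((i, j), shrunk (i, j) es) # private_to (i, j) X) (spend b) ds) zs Q es X i j b"
  "covered3 True ds = Some ds"
  "covered3 False ds = None"
  "covered5 None zs Q es X i j b = None"
  "covered5 (Some ds') zs Q es X i j b = covered zs Q (merge (shrunk (i, j) es) (without (i, j) es)) X b ds'"
  by (auto simp: covered1_def covered2_def covered3_def covered4_def covered5_def covered6_def split: list.splits option.splits)


definition "embeds_pairs1 c u v es p m = ((if c then linked m (get p u) (get p v) else True) \<and> embeds_pairs es p m)"

definition "embeds_pairs2 c es p m = (c \<and> embeds_pairs es p m)"

lemma [code]:
  "embeds_pairs [] p m = True"
  "embeds_pairs ((u, v) # es) p m = embeds_pairs1 (linked m u v) u v es p m"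
  "embeds_pairs1 False u v es p m = embeds_pairs es p m"
  "embeds_pairs1 True u v es p m = embeds_pairs2 (linked m (get p u) (get p v)) es p m"
  "embeds_pairs2 True es p m = embeds_pairs es p m"
  "embeds_pairs2 False es p m = False"
  by (simp_all add: embeds_pairs1_def embeds_pairs2_def)

definition "valid_all1 c k T ks cs = (c \<and> valid_all (register k T) ks cs)"

definition "valid_clique c T k q bs = (c \<and> branches T (clique q nomat) (node_mat k) (pairs vxs) bs)"

definition "valid_colouring c T P D bs = (c \<and> branches T D P (pairs vxs) bs)"

definition "system_ok k qs e ps as fs tr Q cs Q' = (let P = node_mat k; D = links (hex e) (cliques qs nomat);
          t = point_table ps (List.product vxs vxs) (nine_of (nine_of [])) in
      list_all (\<lambda>q. quad (hex q)) qs \<and>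
      (case families t (zip (List.product vxs vxs) (map hex ps)) as P D (map hex qs) fs of None \<Rightarrow> False
       | Some hs \<Rightarrow>
          refuted_root Q t (edge_table hs (List.product vxs (List.product vxs vxs)) (nine_of (nine_of (nine_of None)))) D (hexes tr) \<and>
          (case covered (pairs vxs) Q' hs [] (Some budget) (hexes cs) of None \<Rightarrow> False | Some _ \<Rightarrow> True)))"

lemma [code]:
  "valid_all T [] [] = True"
  "valid_all T (n # ns) (x # xs) = valid_all1 (valid T (hex n) x) (hex n) T ns xs"
  "valid_all T [] (x # xs) = False"
  "valid_all T (n # ns) [] = False"
  "valid_all1 True n' T ns xs = valid_all (register n' T) ns xs"
  "valid_all1 False n' T ns xs = False"
  "valid T k (Clique5 d bs) = valid_clique (quint (hex d)) T k (hex d) (hexes bs)"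
  "valid_clique True T k ds ds' = branches T (clique ds nomat) (node_mat k) (pairs vxs) ds'"
  "valid_clique False T k ds ds' = False"
  "valid T k (Nice qs r bs) = valid_colouring (list_all (\<lambda>q. quad (hex q)) qs \<and> colouring_ok (node_mat k) (links (hex r) nomat) (map hex qs)) T (node_mat k) (cliques qs nomat) (hexes bs)"
  "valid_colouring True T P D ds = branches T D P (pairs vxs) ds"
  "valid_colouring False T P D ds = False"
  "valid T k (System qs e ps as fs tr Q cs Q' bs) =
     valid_colouring (system_ok k qs e ps as fs tr Q cs Q') T (node_mat k) (links (hex e) (cliques qs nomat)) (hexes bs)"
  by (auto simp: valid_all1_def valid_clique_def valid_colouring_def system_ok_def Let_def split: option.splits)

section \<open>The enumeration\<close>

text \<open>
  Each code consists of the three-digit (base 9) index of a node and its non-edges. The tree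
  below serves all nodes that contain a vertex joined to the complement of a 7-cycle.
\<close>

definition hub_tree :: "int list" where
 "hub_tree =
  [0x18581538002822505840441000324048616000026468404248225410003168646418303000536138200012425,
   0x12683031336864600053625242646418682000082860004000186000082048626000400018205038626000400,
   0x10113518682260004242500000503831384410006040002831351058616368246418416368002030005040002,
   0x18002038404240005840006040002842441261680020400062502800326000180035183168480040006058224,
   0x100030225414686368003000204000586361353822600002500045313]"

section \<open>Subtrees of the colouring tree for the complement of the 9-cycle\<close>

primrec tree_parts0 :: "vx \<Rightarrow> int list" where
 "tree_parts0 V0 =
  []"
| "tree_parts0 V1 =
  [0x15718274846426207087833227833110072780023080024627808070024073316111808002607111678080700,
   0x12300610811220700066200354211254208624600354633021125627808070024480722861118487808070024,
   0x10727466242220842330400414200226200356211580082072718780848464262221462228800464200226200,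
   0x13508484262460035463322112562002646112242624600354633021125484642620072621116000662003542,
   0x1002248780030]"
| "tree_parts0 V2 =
  [0x11217276257514642182848784828780807110707004800040807224822280711387807080048081107000400,
   0x13551281848427827625746080700240711580082003588015718284827077808624246002200684211114600,
   0x10100300811147800046278464208071114070048000400354208077800301114487808071107072728424662,
   0x11111002262006846000162004800045142624600352746482818571778080700232281082215070054070878,
   0x122157817116400540811650083]"
| "tree_parts0 V3 =
  [0x16248285767070527525117121878083311082212007278330418780822810811820054121111275112521718,
   0x10708782212782214007205670878338144117844137807080030056708338111231807781708116408118200,
   0x15405677817083341336108227617125218780807227105670044071144526778181751121251008608180778,
   0x100226757051778271121522800845112522728783381112127782833411121]"
| "tree_parts0 V4 =
  [0x14252121727575118413828783808077800482811387800047807080048081107000428080722482228071138,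
   0x17857510807380024184138280727331622861118072728220811580082184138280807111407270068004800,
   0x10408073811070727280068004800045107270828184138228800301841382827080026071116415118281757,
   0x107277808000600812778]"
| "tree_parts0 V5 =
  [0x14262281241525157056727172711275705672717785111510088271751780030570567511778625227281176,
   0x10023275228120041625212271778280057780023172811132752121700011712275251620021412851782752,
   0x100102762526711220026526267005352627827005027002667117051780030]"
| "tree_parts0 V6 =
  [0x10436422862522767124117785118385705337033305705333700305722571822525118413878175705337033,
   0x13022525705677851171241183833703337225741121827171218387851111052000051125278570567183844,
   0x10033571838227300301811421110570552126722376757527812224717186252675727121727570551781117,
   0x12800037827285118413857054407335057052270003057114711171841382827223241511828272240570517]"
| "tree_parts0 V7 =
  [0x10446380778284218411217570551676252122722482700681227525162002141512762526700061116526267,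
   0x11143526227111667226127184162425212670026425705526712116251002051125211620020171252112612,
   0x11700811217675705624252275251122842411878271722331722531841420020177818122742410046002128,
   0x14241335628421200214118333627121800532778281217514241334322465118414200202842121751184151,
   0x11817225312175118414233632226511841420020]"
| "tree_parts0 V8 =
  [0x10888070746184138781728421257056751275212426222016222060061426200206242002327521262420057,
   0x14200880001624200235112522742621171626711560046426200202842122762425212671104425705526712,
   0x10052510020121751520052510020521126121700068805880667570578625227461718271228525112280080,
   0x14228124111271200214111605112522728184138422260113611232728184142002004364228184117513800,
   0x1511241525117273347270047]"

primrec tree_parts1 :: "vx \<Rightarrow> int list" where
 "tree_parts1 V0 =
  [0x13808041841280636460778275705676252464200231108526267511200101712420021005017570551672752,
   0x11262521242461100000312422752516200215127366252674642113042222022404642000000404211034642,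
   0x16200006252671130004052626742460000361103460060526246421101271150672200364200206757057827,
   0x152625112170080171242002111604212]"
| "tree_parts1 V1 =
  [0x10441360646380848060567075752622757075112424648281808782215781711640054081165008317124218,
   0x17846482808441611440833542238482888024642880312525162002148172757516762070578080023281808,
   0x12248111328187827576762070508002327626707510878002678570518220611761811560030181104570057,
   0x15157670705087800817818006100411800061807087800817800460006056708782246222678113678070800,
   0x130056708224611235700015767620705780023081828]"
| "tree_parts1 V2 =
  [0x10718413878276212422846110300002842122762122842464178002678120442412846621137622227224762,
   0x14600031100460047466242000342411137004728424162460003041100460067284246621108121157412207,
   0x10462002378182762122812424128466222680462336733474662004311800462115328424162460043041153,
   0x1462210]"
| "tree_parts1 V3 =
  [0x15112422818413846620020110141182862002146175727780804380711162253070026080438077811437822,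
   0x13322530778001000537800802757785707270804463862421841122878170082781118172243284212187811,
   0x11817333841171878111833767818411700821118780024170804463862422707782841182223121822237818,
   0x11133284118224312182243077828421227183358411827111644062712184142110378181227424100422277,
   0x12842414408284212271833384118337627121800538812]"
| "tree_parts1 V4 =
  [0x13808041841280757782752511200101712424662000300476211134246620026002062460003111346006717,
   0x15251122762464200000040421126624642002100234246000011264600602762124642111022874200201242,
   0x14662111722806200234662421117421110331042002062002362277827575117111400245251121700801712,
   0x142466200431180622285426246002000266246004322854622104212]"
| "tree_parts1 V5 =
  [0x10665281251522757676278002317576778622221336062175767272767577822505227576762177800231778,
   0x16222416733407817515212275700506227675733310026572752621267335112620026526700412757526267,
   0x15117225012172230676200236762271778281251575265222152224112287800266557177827125111285233,
   0x14852281251112833805112520085112852511227577817280045226317577828441817782712334828123380,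
   0x15727120041]"
| "tree_parts1 V6 =
  [0x10665076757625751171252782827184842225642276748337133314833440026482256182827225042275267,
   0x17828184833713331225012281848427811241700057818174227526748441433514822720026481146112427,
   0x15267171822304252271728481822411822416727525112421722211718782812422241487811050005425267,
   0x14828005518511227577817280050002317577828336017782700232812334057271200415727]"
| "tree_parts1 V7 =
  [0x17806466542281241525157276211126733326717276211123372622767110611126200226712276217285152,
   0x16557008757655251525765621746421148424128005622625765424128624622645246335233324662005852,
   0x11168621173521765624241284611273372460021424128466244176244023372466200632218622203284241,
   0x127175157112052576562460058117346330046656233086200633320622203]"
| "tree_parts1 V8 =
  [0x16712422765066200216246060778080003111708002278006306077808111522830800250878071115002578,
   0x10711133313070023460608077800250022077800472280782218650662464211012778115078070800503308,
   0x10722000800224200202762784606421110228742002006460778081115228308002507780846624200030067,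
   0x16211134200200800254246621110002046621117331062002378081115424662002600206246006333134633,
   0x12008002565066207271278080025464211011150420020]"

primrec tree_parts2 :: "vx \<Rightarrow> int list" where
 "tree_parts2 V0 =
  [0x15751077827081102064611556765124246620058521168622205526246420058220546330042002008002552,
   0x15112650662464200002778004067077808001000600800227811204211036706460742112662002127627808,
   0x10025074642000000404211264642620000620021077808001000600800227811204211266200218818271251,
   0x1780800250765066762424600001103460040424662000062222011034662113000406222406267]"
| "tree_parts2 V1 =
  [0x10438184808075717064665675267276212284246417800267851120010126562424128461127224746002142,
   0x14128466211376222272247624600031100460047284241466265000365005000676211002842466265110851,
   0x11200531265002111574165117022076200236562271228424641780026271251284241786267654611222240,
   0x14600265178003088174128178820782712425152570765066762082234064633666746114844045707081102,
   0x10646115567654662005852116862220542120848]"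
| "tree_parts2 V2 =
  [0x16534881148063646040567075762880427284278411817120811040700261217181217424151521838570807,
   0x17833050024782201070052070878330578117100527857115107003057520088515218413857077808006108,
   0x11122000608002478002307087811227800460006785700410700305700011841423851002052112688088810,
   0x13606056734044648528813622757070804464238511700041278184117008211182818172243785117121841,
   0x13811071114002488140757]"
| "tree_parts2 V3 =
  [0x15217572727060567620757574642620778081124080065000578002308002400206211284200150708784246,
   0x16200656211280015460020620026781105000546426257670705780811240800450005077808110508004500,
   0x1050567780822452225081135002057676278464200201128]"
| "tree_parts2 V4 =
  [0x10812522842416246112846271778070605570024675705224506050767005557002407002267112167570600,
   0x11578071727284257526706050024050646626722452706050767575217424662005562008500154128466222,
   0x15511456222355262464200554128114542001542624600854600550015412846622255114562223557002446,
   0x10742620022412862526722551112676257054211214128000217575262672807064642002211060506464200,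
   0x1840002]"
| "tree_parts2 V5 =
  [0x11252284241625707170665780827672266002604005427670811400467652778005727676506008365003542,
   0x12704575207176765620665621111626765065211256500355267060778172808111333330800237817280807,
   0x12278380733533333080700441172073811540665085752620767111167625207781728111300231757527828,
   0x16506046200356762008606071167040708004438115408221741622827677865060452075708224238334557,
   0x10001175752650021]"
| "tree_parts2 V6 =
  [0x15752071767656206466562420088000106466567624252077817280811133373080023657817284207084662,
   0x11141625200432275676208462231335546225133350708286252674642222242113222424246000200424600,
   0x18442466200026252113200426252674246226528463365334542460051117446281161676208424611061152,
   0x14628002267625246427817280708114108223122510708000200510811062878080700840022071161427817,
   0x128070844050844033373070800622204082202]"
| "tree_parts2 V7 =
  [0x10304360646653808484841284212128823426246060552008546271757780806050767006507004505671135,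
   0x10700055752670506070607780811240800650005780023080024077808112408004500050605076708780065,
   0x17811050005070878004578110500050567087822451135782225675752177806050015882405364648413808,
   0x10406654228175767077827620023521227576762077811000023622767570712784401114011111257077833,
   0x164621252282767572236570717223688250665]"
| "tree_parts2 V8 =
  [0x10627780848076252674642222242113222424246000200424600846762424611061152460022074842625267,
   0x14611223382460026625267424644154644123382424600712216462211526267464248080778000211127800,
   0x12607007148080778112333017800300778081123081121332108002278003042487808070030002608070042,
   0x13307072216]"

primrec tree_parts3 :: "vx \<Rightarrow> int list" where
 "tree_parts3 V0 =
  [0x10465882867524842080706782711232762002633017800300646074278003008622711272700232282620021,
   0x12762780807464200020084420062464211060022422202074642007122114233140878070030076242460023,
   0x10021464200021121420062624246112700214246111233124600220778112362464200210023464200713321,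
   0x14233147800306227]"
| "tree_parts3 V1 =
  [0x10807782752008734044806364604650567484262522700812700264842466562522767112227002652671163,
   0x13605672762002611630436626727002365522733420465276252674642227436423362334242460056361166,
   0x14611815262674246005636116646221336056752276246420056118142228462464200210023424600562284,
   0x1462213622705780030]"
| "tree_parts3 V2 =
  [0x14252175727780308340448484665675727622807112005001007570562060436272844103368272822670023,
   0x12711311120060436055722243606056257225867273606046227670728004057050767653334650058042827,
   0x15705074606676536622258360662676533744606656762070023360665620058050757270800806506366757,
   0x12762463404280010366227670657284834044608002257463404062258040848225448340600226733342806,
   0x13346673374340648082254]"
| "tree_parts3 V3 =
  [0x13488274148380412425228030878172728424606625752656707051102071115052251360667626557071115,
   0x10533350552570711153373075705110211150700250536278826175752782867080706656242460002004246,
   0x11121464262000211214200626200216506624246111233074600220646426211272282620021464262111200,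
   0x122426211273312620021070665624246005111744633034642620051330342220462002165066206460308]"
| "tree_parts3 V4 =
  []"
| "tree_parts3 V5 =
  []"
| "tree_parts3 V6 =
  []"
| "tree_parts3 V7 =
  []"
| "tree_parts3 V8 =
  []"

primrec tree_parts :: parts where
 "tree_parts V0 = tree_parts0"
| "tree_parts V1 = tree_parts1"
| "tree_parts V2 = tree_parts2"
| "tree_parts V3 = tree_parts3"
| "tree_parts V4 = no_parts V0"
| "tree_parts V5 = no_parts V0"
| "tree_parts V6 = no_parts V0"
| "tree_parts V7 = no_parts V0"
| "tree_parts V8 = no_parts V0"

section \<open>Subtrees of the transversal tree for the complement of the 9-cycle\<close>

primrec cover_parts0 :: "vx \<Rightarrow> int list" where
 "cover_parts0 V0 =
  []"
| "cover_parts0 V1 =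
  [0x11405022401802227150780060380112382248080800407800623118224038224808080808080232722061021,
   0x18228011180038007082582068080802508821080800811802582288080072180808080808003150680071123,
   0x12480012227258213808080808080808080042227020780060308238080808080031506800711230825801021,
   0x18208808080808080808080808003152227060880800723112580248212800204302580248223808080800204,
   0x124300825801021800534821080808080808080808080808080]"
| "cover_parts0 V2 =
  [0x11804060380022311800724820680808080072327241182128022022580800103110825821610218208808010,
   0x12182168080808080808080800514022417158218808023270617158218013182188080800722081701821880,
   0x18010218228808080808080031517821880808003152206020108240780112380172782018080808010212417,
   0x1822080808080808007112324821217270825801021820880808080808080808080808017880180]"
| "cover_parts0 V3 =
  [0x10122232717211580140280030418108008258221808080808080082515801402808080061028380582070418,
   0x18208808080808080061028381405820704183282171582078080808080808080141810218028380406800825,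
   0x182108080800825821080808080808080808080]"
| "cover_parts0 V4 =
  [0x12428180402800323808080051517148218032223088080808080808080172714050215808080042223108080,
   0x18080800315222310808080808080808022232717022514808080031580040514188217808080808005141802,
   0x180030410808080808080808080808803]"
| "cover_parts0 V5 =
  [0x12888022227170223082504800514808080102182088080102104800514808080808006241510808014078080,
   0x18080800315068007112310808080808004051418821780808080800514180406080380808007230280031125,
   0x12482128080808080800102232580808080808080808080]"
| "cover_parts0 V6 =
  [0x10615051804800102172480802328801427118007248213808080808080808080140218050480012311802407,
   0x18223173182248080173133800825821880808080808080081725822680808080800723112482122714011805,
   0x18212041728801580020825820180808080808002082582038080808080020825822680808002242528088226,
   0x11136181482128015178226808080808080808080]"
| "cover_parts0 V7 =
  [0x12705141123288226808080152311182817822624078006128224808080808007122422068223042817820080,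
   0x18080808080800724041222171882050328820080808080808080808004151711232280182882268080072422,
   0x11206821128038200808080808080071224280382008080808080182835071182268080808080808003222806,
   0x1120523148080800415188225808080071123248206808080800711232405808080808080808080]"
| "cover_parts0 V8 =
  [0x12203128806112327151780180704288005148215808080808014180407288005800208172582038080808080,
   0x18002081725820380808080800724281804800515178080808080808080242528020714050882263618048001,
   0x13380151782018080808080808001062714058213041582268080041582268080808080010627041582268080,
   0x1808080808080800208258226808080082582268080]"

primrec cover_parts1 :: "vx \<Rightarrow> int list" where
 "cover_parts1 V0 =
  [0x10603171580141880020823808080808080020818278080141727800528241582048080808080808080070208,
   0x12714801517808080800311282418801517272380363080051482048080808080800123271780808080802327,
   0x1172482128080808080800311232715248080808080808080]"
| "cover_parts1 V1 =
  [0x10412881011230727031417158018058080808080020814808080802428188005141715808080808080800106,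
   0x12715808080808024280307021880051417088080808080010627151782070514820780808080808001062718,
   0x10580808080808080808080051715030628111280242780071480808080808007231127808080808002081407,
   0x12780282480808080808080010208140724802327808080808080808001020818280714800315241280808080,
   0x18080808080808080]"
| "cover_parts1 V2 =
  [0x10102082707140524808004151817821428352480112332228006128207808080808080800317222380808080,
   0x18080801522170411188080808018283511048003052382000612820080808080808080808080062311052815,
   0x11480172280808080800415172280808080800312202437171582210582218004188223808080808080800320,
   0x124371517822104180514821512283582058080808080800405148221808080808080808080808080]"
| "cover_parts1 V3 =
  [0x10205142407800603112317808017288012221580041882168080808080123717158023318004188217808080,
   0x18080808080801517222403061280112380041882058080800711820080800418820580808004188205808080,
   0x18004151711222380240306808080801828248080808012240728808080808080808003102815171123050680,
   0x180808006122405808080808004051418821580808080040514181182138080808080808080]"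
| "cover_parts1 V4 =
  [0x12521102288112808041218028003068007112324821280808080800514171582040102078080808080808011,
   0x12407028003011827142380808080051415178204808080808080808080051417120224158080800315068080,
   0x18080112407018080808080808080010320272411171805048213148221808080808080808080808088120120,
   0x12708881303102815171106188080072414808080808004051418821580808080040514181182138080808080,
   0x180808080808080]"
| "cover_parts1 V5 =
  [0x11720150612808080041418058217262812808080808080800102211580040514188217808080808080801804,
   0x12026140624808080800102140523808015212835061282140711822080800711822080808080808015212835,
   0x10624078220123780112382208080808080808080808080010221111523280724801206820714328212808080,
   0x10612808080800607122482118080808080060712240580808080808080808001020515281106071282002324,
   0x182008080808080808080808080]"
| "cover_parts1 V6 =
  [0x10825278815262820041806128080800514151782048080808005151417120623808080800102182407128080,
   0x18080808080808080010221121506182480800514172480808080800711232482128080808004051418060780,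
   0x18080808080800711232405820080808080808080808080010221262812061518800517238080808080071123,
   0x1248212808080800711232418808080808080808080808080]"
| "cover_parts1 V7 =
  [0x12620128805110788040106272223171510218028041880051482040308348204808080800514808080808005,
   0x11410028003041882178080808080800514182580808080800324281404171005808008251580808080808080,
   0x18080800324281517148080808080808080808080211088080102082588070322280724180506808004150680,
   0x18080800515170627820080808080800611122382078080808006111223158216808080808080808080808080,
   0x18814]"
| "cover_parts1 V8 =
  [0x11628182504110817068080808007122420050280808008211780808080808080051411081517821802380680,
   0x18080808010202126822580808080071224080280068223801020151780022126822380808080808080808080,
   0x18010202126042411800712148080808080051411382402078006128015178202808080808080071224028080,
   0x18080808080808080800514172511152080800238088010202126822580808080808007122420158080808080,
   0x180102021261106808080808080808080808080]"

primrec cover_parts2 :: "vx \<Rightarrow> int list" where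
 "cover_parts2 V0 =
  [0x12505280802800617808080102002171580262180808018048080808021220604800233128228113682068080,
   0x18080021136180480332680151782188080808080808080808006122202088010211826808080808037082017,
   0x11580041882178080801021048080808080808080800415171882141222062180800228302182148080808080,
   0x18080808010212605061222028080202802820680808011202802820680808080800415171206228080808080,
   0x18080808080]"
| "cover_parts2 V1 =
  [0x12407161488201517042528182080210680808012222102088010068030113680202682008080808080808080,
   0x18006122221808080808010212612068080808080800506122221808080808080808006122204250815218080,
   0x18080808080808006111628180425108080800514151782188080808005141517208080808080808080808080]"
| "cover_parts2 V2 =
  [0x12322111517252010218028160408148080800514808080808080808005141825048215808080808005141825,
   0x10421802008808080808080808007122406822302162825081480801020261704188222218225051482238080,
   0x180808080801020212614058080808080808080808080808088188821]"
| "cover_parts2 V3 =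
  [0x11688170322102104061227802818800514151782048080808080112307248206012717808080808080800711,
   0x12327158080808080800515172706808028060112148080808080800102182824071180808080808080808080,
   0x10820252682100102271517118080051418062404821528078200111223820080808080808080808004051418,
   0x11180808080808080808080808088168080]"
| "cover_parts2 V4 =
  [0x12705081123808080102026112807218080808080808080041517188214032207120880102021268225808080,
   0x18080808080808080132807240526208008211082268080808004151718821480808080061112238207808080,
   0x180061112230510808004151718821480808080808080808080]"
| "cover_parts2 V5 =
  [0x11628051113072480230612808080808080800415171882140310212227238080808080808080808010212227,
   0x12311800607122482238080808080808080800321221023112805131506128024078027330482138080808080,
   0x10418060780808080808004151727821413188214808080808080060712248223808080800607122415271780,
   0x1051833808080808080808080800813282412181507808080808080808080808080]"
| "cover_parts2 V6 =
  [0x12508070311238024120680808080808080102026218225041316182824808080808080808080802620211023,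
   0x10311800712240680808080808007241203068080808080800813282407031812048080800534068016822180,
   0x18080800611122382248080808006111223038080808080808080801316280418240780808003050834231182,
   0x10407122406820430822380808080808080808003050834112306128007248010388207808080808080808080,
   0x180808080030813212807241180808080808080808080]"
| "cover_parts2 V7 =
  [0x11517222788261318280612260321802008238080808004163520800810212582268080808080808008102125,
   0x10380041635238080808080808080800711242382060416352620808080808080808080072411232616080380,
   0x18080808080808080808080041618280724082780808006111223820780808080061112232013808080808080,
   0x18080808080030513182228061226088080800711232482068080808007112324218080808080808080808080,
   0x18080]"
| "cover_parts2 V8 =
  [0x10102142516882403221108272315178005180482158080808006071224821180808080132805060724158080,
   0x11223820780808080041517188214808080808080102021268225808080800607122408131528058080808080,
   0x11020212682258080808080808080808026208825030813212228061215058004171180808080800711232482,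
   0x1068080808007112324058080808080808080808080808088278080]"

primrec cover_parts :: parts where
 "cover_parts V0 = cover_parts0"
| "cover_parts V1 = cover_parts1"
| "cover_parts V2 = cover_parts2"
| "cover_parts V3 = no_parts V0"
| "cover_parts V4 = no_parts V0"
| "cover_parts V5 = no_parts V0"
| "cover_parts V6 = no_parts V0"
| "cover_parts V7 = no_parts V0"
| "cover_parts V8 = no_parts V0"

section \<open>Nodes and certificates, in the order in which they are settled\<close>

definition codes1 :: "int list" where
 "codes1 =
  [0x10000102120313230515253546, 0x1001010212051525343646, 0x10020102120515253746,
   0x10033031013202120515255446, 0x100401051523273746, 0x1005270105153846,
   0x10064550510102120313232746, 0x100750510102120313235446, 0x10087172121020132303066445,
   0x10102123131030170706644528, 0x1011010212031323155406462738, 0x10125446600102120313231728,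
   0x101310120213032306644517, 0x1014101202130323066445, 0x10150102120313230717274546,
   0x10162021012303130717284546, 0x101701021203132307174546, 0x101801021203132307184546,
   0x1020010212031323074546, 0x10214546010212031323, 0x102201021203132345,
   0x10236560505404614313423227, 0x10245450404243232131061627, 0x102550540406466112132327,
   0x1026010616120424132305452747, 0x10276160041242054513234827, 0x10285054040142120616132327,
   0x103012132324344045050656, 0x1031050656045442232131, 0x10326002612104240545231357,
   0x10330102120424132305450616, 0x1034101202132316062704740545, 0x10356160100405451213232748,
   0x10361012021323160604054527, 0x10371012021323160604054547, 0x103840450502012106162313,
   0x10403132122036060405454817, 0x10414045050102121323063617, 0x104254504046061312323817,
   0x10438332312120101704054506, 0x104440450546060221231317, 0x10452021012313170474054506,
   0x10462021012313040545481706, 0x104710120213230405450617, 0x10485054040102121323063647,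
   0x105031321210203606040545, 0x10514045050102121323473706, 0x10527331321210150504540648,
   0x10535054040102121323063748, 0x105401021213230405450637, 0x1055404505010212132306,
   0x1056010212041424, 0x1057323121201026063707146545, 0x1058606202212313041407374575,
   0x1060202101231304142606073745, 0x10615456406062412123133807, 0x106221231338268514546007,
   0x10638331321220140426064507, 0x1064010212041413230626450748, 0x10656062020121041423134507,
   0x106685825451412343130706, 0x1067515414134332280607, 0x10680104141343123206072845,
   0x10706063013132120414072845, 0x1071533231215428480607, 0x10723132121428481040060745,
   0x10732021010414231345060728, 0x107421231310140445060748, 0x107560010212041413234507,
   0x1076010212132304340616072745, 0x10773132121020160627070445, 0x1078606112132328844507,
   0x108031321210160604450728, 0x10816113123260074548, 0x108210120213231606044507,
   0x1083313212182804060745, 0x108431321210200445060718, 0x108512132306074548,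
   0x1086313212102004450607, 0x108741401012132345352636, 0x10886260202101671373143545,
   0x1100626020210123130414354537, 0x1101313212102014042606354567, 0x11021012021323140435450626,
   0x110343453532312120102706, 0x1104010212132304143545274736, 0x1105323121201014043545360627,
   0x1106533154141040321202062767, 0x11071012021323140435450627, 0x11083231212010350454065647,
   0x11103132121020140435450647, 0x11115354314140103212020667, 0x111231321210201404354506,
   0x11132321313616106004354527, 0x11146160101213233504542747, 0x11151012021323160604354527,
   0x11161012021323160635045457, 0x111710120213231606043545, 0x1118400102121323453506361727,
   0x11205331321210205404062767, 0x11210102121323172704354506, 0x11221312323517575440360628,
   0x1123400102121323453506361728, 0x11241012021323043545064728, 0x11250102121323043545061728,
   0x11260102121323043545174706, 0x11274001021213234535061768, 0x112840010212132345350617,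
   0x113001021213230435450646, 0x11312120102313153504544706, 0x113201021213230435450647,
   0x11330102121323043545063767, 0x113431321210203504540667, 0x1135010212132304354506,
   0x113601021213230406464537, 0x113701021213230445063748, 0x11383132121020140445065637,
   0x114040010212132317370665, 0x11410102121323044506563718, 0x114273313212102004450656,
   0x11430206262123130414453757, 0x11443231213710140475450628, 0x11450102121323041445375706,
   0x11461012021323160604453757, 0x11470102121323044537570618, 0x114840010212132345375706,
   0x115060010414131232453758, 0x11510102121323044518580637, 0x115273313212102004450658,
   0x1153733132121020044506, 0x115421231314344045065767, 0x1155212313143445400657,
   0x11562021012313043406164557, 0x11571012021323043445065718, 0x115810120213230434450657,
   0x11601012021323140406364557, 0x116131321236162060044557, 0x11621012021323063604455718,
   0x116331321210203606044557, 0x1164313212102004450657, 0x11655440010212132306,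
   0x116602212313241445060738, 0x116731321210201424450607, 0x11682021012313063614450728,
   0x117010120213231445060728, 0x1171600102121323144507, 0x117201021213230616072745,
   0x1173606101121323280745, 0x1174101202132316060745, 0x117501021213231828060745,
   0x1176010212132306071845, 0x11770102121323060745, 0x11780102121323343545,
   0x1180373272347471211076064565]"

text \<open>In the last entry, as in the later ones with \<open>hub_tree\<close>, vertex 8 is the
  hub and 0-1-2-3-4-5-6 the 7-cycle. The 4-cliques are 8 with the seven independent triples of the
  cycle; the points are 8 with two cycle edges that are separated by a single vertex on one side,
  which span a wheel with four spokes in \<open>D\<close>. Each family is a single point, so seven
  apices suffice and the transversal tree is the one leaf \<open>80\<close>.\<close>

definition certs1 :: "cert list" where
 "certs1 =
 [Nice [] 0x10818283847586778
  [],
  Nice [] 0x10818283747586778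
  [],
  Nice [] 0x1030713172327353848576878
  [],
  Nice [0x13578, 0x15678] 0x1081828353847566778
  [0x1000050025002000100020002000200020002],
  Nice [] 0x10818242634364748586768
  [],
  Nice [] 0x10308131823242628353747586778
  [],
  Nice [0x13578, 0x15678] 0x108182528353847566778
  [0x1500250047005000100020002000200020002],
  Nice [0x12578, 0x13578, 0x15678] 0x108182528353847566778
  [0x1300340064006200340064006000100020002000200020002],
  Nice [0x13678, 0x15678] 0x10816182628363847565778
  [0x1600470026005000100020002000200020002],
  Clique5 0x135678
  [0x15005400570027004400480057005200470056005],
  Nice [0x15678] 0x108182636474857586768
  [0x1000100020002000200020002],
  Clique5 0x135678
  [0x13011700560056005000100020002000200020002],
  Nice [0x12678, 0x13678, 0x15678] 0x10816182628363847565778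
  [0x1400670085012400670085012000100020002000200020002],
  Nice [0x11678, 0x12678, 0x13678, 0x15678] 0x10816182628363847565778
  [0x1600710131013600720132013600730133013000100020002000200020002],
  Nice [0x13568, 0x13578] 0x1050815182528343638565778
  [0x1700270020000700200010002000200020002],
  Clique5 0x135678
  [0x15005600570027004000100020002000200020002],
  Clique5 0x125678
  [0x17008700800152016000100020002000200020002],
  Clique5 0x125678
  [0x16012501210160016000100020002000200020002],
  Clique5 0x115678
  [0x10013001300170018000100020002000200020002],
  Clique5 0x105678
  [0x11014101400200020000100020002000200020002],
  Nice [0x14678, 0x15678] 0x106071617262736374648565878
  [0x1402140214021502150215021000200020002],
  Nice [0x11478] 0x108121718373847485868
  [0x1100420042004700480052004],
  Clique5 0x135678
  [0x10023600470047005602310231023000400040004],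
  Nice [0x13678, 0x15678] 0x1020718242628363847565778
  [0x1000470047005000160046004000400040004],
  Clique5 0x135678
  [0x17004500460047004700460047004200420042004],
  Nice [0x13678, 0x15678] 0x1010308151725343537586768
  [0x1600470047005600460058004000400040004],
  Clique5 0x134678
  [0x15024500460047005502520266027200420042004],
  Nice [0x11478, 0x14678] 0x1081417273746586878
  [0x1100160046004000160046004000400040004],
  Nice [0x11478, 0x13478, 0x14678] 0x108141727343746586878
  [0x1303060256025103060256025000160046004000400040004],
  Clique5 0x134678
  [0x11023000450238005600470046005100410041004],
  Clique5 0x125678
  [0x14014602250285028503160326032300430043004],
  Nice [0x10378, 0x13678, 0x15678] 0x1070814171828373846565768
  [0x1600850257027400460047005300460046005300430043004],
  Clique5 0x135678
  [0x17005400460047005200480058004200420042004],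
  Nice [0x13678, 0x14678, 0x15678] 0x10718262836384647565778
  [0x1400460047005502510346035402510346035300430043004],
  Clique5 0x125678
  [0x16032300810346035300460046005300430043004],
  Clique5 0x124678
  [0x10033602210361036403110371037300430043004],
  Clique5 0x125678
  [0x17005400470048005600460058004100410041004],
  Nice [0x12678, 0x14678, 0x15678] 0x10716182628384647565778
  [0x1400470047005502470323040402470323040300430043004],
  Clique5 0x125678
  [0x17005700570048004000160046004000400040004],
  Nice [0x14678, 0x15678] 0x116262736374648565878
  [0x1504270325024404270324024300430043004],
  Clique5 0x135678
  [0x16025502570255042400160046004100410041004],
  Clique5 0x125678
  [0x13024203430257027600430046005300430043004],
  Nice [0x12678, 0x13678, 0x15678] 0x1031524252734353746566878
  [0x1603530428027304070255024600460053004300430043004],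
  Nice [0x13678, 0x14678, 0x15678] 0x103141524252734353746566878
  [0x1404130318043404420452046504420452046300430043004],
  Clique5 0x115678
  [0x16032202570323040600470047005300430043004],
  Nice [0x11678, 0x12678, 0x14678, 0x15678] 0x10716182628384647565778
  [0x1303140414041303140414041403150485048503140484048300430043004],
  Clique5 0x115678
  [0x12024502420255024600430046005300430043004],
  Clique5 0x125678
  [0x16005700550044023600460058004200420042004],
  Clique5 0x115678
  [0x17052301070258032600460058004300430043004],
  Nice [0x14678, 0x15678] 0x11618262836384647565778
  [0x1404440515053504450514053300430043004],
  Nice [0x11678, 0x12678, 0x13678] 0x107081617262736374748575868
  [0x1403810471047403820472047305000540054300430043004],
  Clique5 0x135678
  [0x10022002200220022002200220022002200220022],
  Nice [0x11678] 0x10308171827283648586768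
  [0x1000260048005300450053005],
  Nice [0x14678] 0x10518242538464856586778
  [0x1100450048005700440055005],
  Clique5 0x115678
  [0x15004600260048005305760588005700450056005],
  Nice [0x14678] 0x105182836474857586768
  [0x1500470047005700470050005],
  Nice [0x14678] 0x10215161827283435364867
  [0x1700500051004000470050005],
  Clique5 0x115678
  [0x15004700550056004506180052062700470055005],
  Clique5 0x135678
  [0x15063405520608063700560055004700470056005],
  Clique5 0x134678
  [0x14047405520608063405530280064700470056005],
  Nice [0x12567] 0x1020508172627374756576878
  [0x1100470050005700500050004],
  Clique5 0x135678
  [0x11002700500052004700500052066000420052005],
  Clique5 0x115678
  [0x15067806380638067700560058066600470056005],
  Clique5 0x115678
  [0x17005700550057005506180053062700470056005],
  Clique5 0x115678
  [0x14066106210625066700500051004000470050005],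
  Clique5 0x135678
  [0x15071607070701067700560052004600470056005],
  Clique5 0x134678
  [0x10068607070708067104610463072600470056005],
  Clique5 0x125678
  [0x13072307230723072700560052004600470056005],
  Clique5 0x124678
  [0x10056606570652073605570553074600470056005],
  Clique5 0x135678
  [0x15004700460048005705860588005300470056005],
  Clique5 0x134678
  [0x10076700460048005703260323071300470056005],
  Clique5 0x135678
  [0x11062800520621005700500051004000470050005],
  Clique5 0x134678
  [0x18063700580056004805260356078700470055005],
  Clique5 0x125678
  [0x16078306760716078700500051004000470050005],
  Clique5 0x124678
  [0x16065602230773080405510376081700470056005],
  Clique5 0x134678
  [0x18067700560051002304230423067600470056005],
  Clique5 0x124678
  [0x11073308030803083204620468081600470056005],
  Clique5 0x115678
  [0x15081608170818081700500051004000470050005],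
  Clique5 0x114678
  [0x16075108210823084605570553085600470056005],
  Clique5 0x115678
  [0x14031201420452045603100040004503250320004],
  Nice [0x11578] 0x108151828343847576878
  [0x1400470048005600440053005],
  Nice [0x13468, 0x11578, 0x11678] 0x10307151627363848586778
  [0x160046002600480056025507560673087606770048005408870056005],
  Nice [0x12478] 0x1030515242534363756576878
  [0x1000270048005308850056005],
  Clique5 0x134678
  [0x15030408761006100308761006100310131016005],
  Nice [0x13678, 0x14678, 0x15678] 0x1081618262837384748575867
  [0x1404140386043502470328052402470328052000400040004],
  Nice [0x12568, 0x10578, 0x15678] 0x10306081618284648565778
  [0x1703230874068504860483068000450048005408850056005],
  Nice [0x10378, 0x14678, 0x15678] 0x1030515162425263448586778
  [0x100222060507070243068602401043068500430577005408870056005],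
  Nice [0x13468] 0x10818283637384648565758
  [0x1000440888005302350057005],
  Clique5 0x134678
  [0x15103310570245070602441055070510670056005],
  Nice [0x10578] 0x107081828384657586768
  [0x1600470048005300460054005],
  Clique5 0x125678
  [0x15103610041055070310830046005308850056005],
  Nice [0x12468, 0x12478] 0x103051524253438586878
  [0x1000231015106800530233088500550666005],
  Clique5 0x124678
  [0x10022110211071107308731103110511151116005],
  Nice [0x10578] 0x10708182425384748575868
  [0x1400471118005008840056005],
  Nice [0x13468] 0x10305152836384648565878
  [0x1500421138005402350051062],
  Clique5 0x134678
  [0x15004211360047005402361147005605761136005],
  Clique5 0x124678
  [0x12102500611153078300470046005611340056005],
  Clique5 0x125678
  [0x15087300711151115311211161116611361136005],
  Nice [0x10378] 0x107081626373848586768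
  [0x1600470028005700260056005],
  Nice [0x13478] 0x10818283738464748565758
  [0x1000461118005308850056005],
  Nice [0x13468, 0x10378, 0x13678] 0x107081626343748586768
  [0x1002250067067700441187002600570046005512040056005],
  Nice [0x11568] 0x1010305071418273446475678
  [0x1800580050005700530620005],
  Nice [0x12567, 0x15678] 0x1030507141518273446475678
  [0x1010511134118700531223122412041206005],
  Nice [0x11568, 0x10578, 0x15678] 0x1030508151625263648576878
  [0x1104670248078800580056005606130046005308850056005],
  Clique5 0x134678
  [0x17005412380057005700511242124512051206005],
  Clique5 0x125678
  [0x15108611401211124310830046005308850056005],
  Nice [0x12467, 0x12478] 0x1070826272836384647485658
  [0x1700561134005512030235005308810626005],
  Clique5 0x124678
  [0x12107211501210125602401262124512041276005],
  Clique5 0x115678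
  [0x13031111760246024303030043004302330233004],
  Clique5 0x125678
  [0x13002600451088005310830046005308820056005],
  Clique5 0x115678
  [0x12131111701262124310830046005308850056005],
  Nice [] 0x108182838464748565758
  [],
  Nice [0x13478] 0x10818283738464748565758
  [0x1000401338005308850056005],
  Clique5 0x114678
  [0x13112111741284128013001320132313431346005],
  Nice [0x13568, 0x11578, 0x12578] 0x1030507151825283847566778
  [0x150327025505250327025505201303135608150043004300450053004],
  Nice [0x11467, 0x12467, 0x10578, 0x15678] 0x10508171827283846565768
  [0x150537081805340686067706740686067706701360132800560055004606650056005],
  Clique5 0x124678
  [0x10002410140048005500430888005308850054005],
  Clique5 0x124678
  [0x14004710330028005702531342005213170674005],
  Clique5 0x124678
  [0x18005800580054005500430887005308850054005],
  Clique5 0x114678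
  [0x13138313841400141500430888005308850054005],
  Nice [0x13568] 0x1050718252736384856586778
  [0x1700441118005011470054005],
  Nice [0x13568] 0x105162736384656586778
  [0x1700480050004700510624005],
  Clique5 0x124678
  [0x17006214370234144300430046005411340056005],
  Clique5 0x124678
  [0x10143600260048005300450046005711140056005],
  Clique5 0x124678
  [0x13144800580056005300430046005612740056005],
  Clique5 0x114678
  [0x10145114661400147300430046005313440056005],
  Clique5 0x124678
  [0x16005700500044144200460052004400510626005],
  Clique5 0x124678
  [0x13113800580056005300460055004400550056005],
  Clique5 0x114678
  [0x16150301070670151300460055004400550056005],
  Nice [0x10578, 0x14678, 0x15678] 0x103070816172627364748575868
  [0x1005430863086013601320137714241487152313450056005],
  Nice [0x12468] 0x1010203081624263648586878
  [0x1100221348005000480050005],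
  Clique5 0x124678
  [0x11002213421348005000450048005215400056005],
  Clique5 0x124678
  [0x16004600201438005300450046005314340056005],
  Nice [0x10358, 0x12468, 0x10378, 0x14678] 0x103141624263647586878
  [0x150062046308480788005800560057052314100103004300460054078212240056005],
  Nice [0x11468, 0x12468, 0x10378, 0x14678] 0x1050708141824283847566768
  [0x140073086408121552156115711551156215761426152300430046005315440056005],
  Clique5 0x124678
  [0x10002400430578005300450047005314340055005],
  Clique5 0x124678
  [0x10004100261548005100450040005215440050005],
  Clique5 0x124678
  [0x18005400531224005300450047005212240055005],
  Nice [0x11468, 0x12468, 0x13478] 0x103141624263435374856586778
  [0x111603161116221603161216211587148408130045004700540055005],
  Clique5 0x134678
  [0x11158316341488152300430046005315440056005],
  Clique5 0x103578
  [0x10022405530863086013571538153316431646005],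
  Clique5 0x125678
  [0x15067515051508067800580055066100470056005],
  Clique5 0x134678
  [0x14020515351530166316431643085300470056005],
  Clique5 0x115678
  [0x18005700580057005215731223062300470055005],
  Clique5 0x134678
  [0x10068216821688067316431648081300470056005],
  Clique5 0x124678
  [0x13167516551651170316431643085300470056005],
  Clique5 0x134678
  [0x16164700460048005316431643071300470056005],
  Clique5 0x134678
  [0x18150700580050004715030786078200470054005],
  Clique5 0x124678
  [0x15165002201726173316431646081300470056005],
  Clique5 0x134678
  [0x18067700560053002316431643067300470056005],
  Clique5 0x124678
  [0x12170317331730175316431648081300470056005],
  Clique5 0x114678
  [0x16171117411740176316431643085300470056005],
  Nice [0x13678, 0x14678, 0x15678] 0x106081618262836374647565778
  [0x1405540554055616571658165616571658165000400040004],
  System [0x10248, 0x10258, 0x10358, 0x11358, 0x11368, 0x11468, 0x12468] 0x1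
  [0x112568, 0x102368, 0x101348, 0x112458, 0x123568, 0x103468, 0x101458]
  []
  [Fam 0x10203071316283846485758 0x100, Fam 0x10203071316263848586878 0x101, Fam 0x104050715161828384678 0x102,
   Fam 0x104051516283846485778 0x103, Fam 0x102030713162638485758 0x104, Fam 0x102030713162648586878 0x105,
   Fam 0x10405151618283846485778 0x106]
  hub_tree no_parts
  [0x180] no_parts
  [0x1000411432088600480052002315430880004800530024143408880057004108860053004000560050005]]"

definition codes2 :: "int list" where
 "codes2 =
  [0x1181122710702373760634654578, 0x1182575476416160104313120232, 0x1183070171721206762334654578,
   0x11845457433132127616102060]"

definition certs2 :: "cert list" where
 "certs2 =
 [System [0x10248, 0x10258, 0x10358, 0x11358, 0x11368, 0x11468, 0x12468] 0x1
  [0x112568, 0x102368, 0x101348, 0x112458, 0x123568, 0x103468, 0x101458]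
  []
  [Fam 0x10203131617262838485758 0x100, Fam 0x102031316172638485868 0x101, Fam 0x10203081316172647485868 0x102,
   Fam 0x10405151625262838474857 0x103, Fam 0x102031316172638485758 0x104, Fam 0x102031316172647485868 0x105,
   Fam 0x1081314242535575868 0x106]
  hub_tree no_parts
  [0x180] no_parts
  [0x1400520576122200540052004211401140004800500053122005700054004110620053004000520050005],
  System [0x10358, 0x12468, 0x12568, 0x13568, 0x10378, 0x10478, 0x12478] 0x1151718
  [0x102458, 0x123678, 0x103468, 0x134678, 0x104568, 0x101578, 0x102578, 0x113578, 0x123578,
   0x112578]
  []
  [Fam 0x105071518283846474856 0x100, Fam 0x108171828353746475668 0x101, Fam 0x108151728353738464756 0x102,
   Fam 0x108182835373846475668 0x103, Fam 0x108182835373846474856 0x104, Fam 0x108151724253537476878 0x10506,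
   Fam 0x108182835374647566878 0x10708, Fam 0x1081824253537476878 0x1061007, Fam 0x108152835374647566878 0x1051008
   ]
  [0x18782842486264652855626468004000450000004800774728385538151000571000750000003370783565385,
   0x13680000450000080035085000485815100057100075000008553362680500381510005710007370380360002,
   0x18074830337855053560004373600027480374626248685500004565283030002533685505256860004038353,
   0x15007860001563653365652868300018683000300018300025083863600030002862624728303360003000183,
   0x10307048636000346000207047284260783855381518050030008710006525686360001370380048646000336,
   0x10002800474248550835303378151000771000552000086462474833600013700037424] no_parts
  [0x180] no_parts
  [0x10002305730883004800501803180218130026088000240888005000400570088500520883004600570048005,
   0x120056005],
  System [0x10248, 0x10258, 0x10358, 0x11358, 0x11368, 0x11468, 0x12468] 0x1
  [0x112568, 0x102368, 0x101348, 0x112458, 0x123568, 0x103468, 0x101458]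
  []
  [Fam 0x10818242535364668 0x100, Fam 0x10818242528353646 0x101, Fam 0x102030813162648575868 0x102,
   Fam 0x1040514151625262835363848 0x103, Fam 0x1081824252835364668 0x104, Fam 0x1020313162648575868 0x105,
   Fam 0x1020308131424575868 0x106]
  hub_tree no_parts
  [0x180] no_parts
  [0x1100211222088600480052004608801220002800570040088012240052004108820055004800520058005],
  System [0x10358, 0x12468, 0x12568, 0x13568, 0x10378, 0x10478, 0x11478, 0x12478] 0x115
  [0x123678, 0x103468, 0x134678, 0x104568, 0x114568, 0x101578, 0x102578, 0x102458, 0x112458,
   0x113578, 0x123578, 0x101458, 0x112578]
  []
  [Fam 0x108171828353746475668 0x100, Fam 0x108141828353738464756 0x101, Fam 0x108182835373846475668 0x102,
   Fam 0x1030414242636586878 0x10304, Fam 0x10304081415172425356878 0x10506, Fam 0x10304081418242636586878 0x10708,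
   Fam 0x10304081418242835566878 0x11011, Fam 0x103041418242636586878 0x1120803, Fam 0x103040814182425356878 0x1061310,
   Fam 0x103040814242636586878 0x1120704, Fam 0x10304081415242835566878 0x1051311]
  [0x18581822686562583428446877247847346000284418040000370050010474680030001407053368442468656,
   0x14180400003050010478087707271837303530006038373705305860000465636734653868336000200005636,
   0x18300010583863600020001427286833600020000704083863600024600014070877205710004877242714180,
   0x17040837303530006400500042586844641804000050500074287718070837303530008400583730011035347,
   0x17226565182844286462656804000070500054187728070837303530011400583730008035347712586844680,
   0x140001005000342418780700004400583730006035347722656] no_parts
  [0x180] no_parts
  [0x10002314330883004800571820180518201834004608800026143800500040154008850052088300460057004,
   0x1800540056005]]"

definition codes3 :: "int list" where
 "codes3 =
  [0x118543313212102016064557, 0x1186313212172734754506, 0x11870201212313177534542806,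
   0x1188010212132315175734540676, 0x12003234272171701045065678, 0x1201010212132325175734540676,
   0x12020102121323170676347545]"

definition certs3 :: "cert list" where
 "certs3 =
 [Nice [0x10478, 0x12478, 0x12678, 0x13678] 0x1081718242528353738476768
  [0x1215611466078400400026154800501614140606730046005518440056005],
  Nice [0x10378, 0x13678] 0x10814152425353747485868
  [0x1713431344066713410028005313440660005],
  Nice [0x14678] 0x10507182738464856586778
  [0x1018630046005012240056005],
  System [0x10358, 0x11468, 0x12468, 0x12568, 0x13568, 0x10378, 0x10478, 0x12478] 0x1
  [0x103468, 0x102578, 0x104568, 0x102458, 0x123678, 0x123578, 0x134678]
  []
  [Fam 0x108161828353738464756 0x100, Fam 0x1081424253537476878 0x101, Fam 0x1030414242535586878 0x102,
   Fam 0x10814182425353747586878 0x103, Fam 0x1081424252835374768 0x104, Fam 0x108142425283537476878 0x105,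
   Fam 0x10814182425283537384768 0x106]
  [0x18285658662255383638480405003836300008747833700046300062707830005630337464283536386628737,
   0x10004270005508003536387478442402707860002466240428684460000000262468400068427864600000006,
   0x18407378646000000062707378707800337478442406284864600006300064246864000028625844600004240,
   0x10002408084420003034286844600000002624684634700068447278646000062630006478442800003273780,
   0x10001030725865380844640000342870700014727500383638737000527000483636562873700052700046265] no_parts
  [0x180] no_parts
  [0x10002311470573004800531800180418140043057700400578005000401145057800571143004600560048005,
   0x140056005],
  System [0x10248, 0x10258, 0x10358, 0x11358, 0x11368, 0x11468, 0x12468] 0x1
  [0x112568, 0x102368, 0x101348, 0x112458, 0x123568, 0x103468, 0x101458]
  []
  [Fam 0x10818242535364668 0x100, Fam 0x10818242528353646 0x101, Fam 0x10203081316264857586768 0x102,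
   Fam 0x10203081314182457586768 0x103, Fam 0x1081824252835364668 0x104, Fam 0x102031316264857586768 0x105,
   Fam 0x102030813142457586768 0x106]
  hub_tree no_parts
  [0x180] no_parts
  [0x1100211222088600480056005212201223005600570040088112240052004018660055004800560058005],
  Nice [0x11468, 0x11568, 0x10378, 0x10478] 0x105071628384647485658
  [0x100023154300480054143305760883122008880050186300460056004800540056005],
  System [0x10358, 0x11468, 0x12468, 0x11568, 0x12568, 0x13568, 0x10378, 0x10478, 0x12478] 0x1
  [0x103468, 0x102578, 0x104568, 0x123678, 0x123578, 0x134678, 0x101458, 0x102458]
  []
  [Fam 0x1081828353738464756 0x100, Fam 0x10814151824253537476878 0x101, Fam 0x103041415242535586878 0x102,
   Fam 0x108141524252835374768 0x103, Fam 0x1081415182425283537476878 0x104, Fam 0x1081415182425283537384768 0x105,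
   Fam 0x10814152425353747586878 0x10607]
  [0x18783038007378453855086466365855000024282624627478500046525418161466285822500012700046525,
   0x18251278582250001000465508182000662256151824740852500016550810006615140478553508007822500,
   0x10127000463866553508182464740078084000084424180000200068000008442412780400002000684426225,
   0x14161518040000200066225615182658184424186466280400002500006478086000546000040500751618662,
   0x18446424147000586622553844642470005252786000362653780538682620003278446000542476365855084,
   0x140000046000285500307822500042700010307] no_parts
  [0x180] no_parts
  [0x10002315430883004800531800188518242004088020161434120012200040154008850050186300460055004,
   0x1800540056005]]"

definition codes4 :: "int list" where
 "codes4 =
  [0x120360010212132317347545, 0x120410120213233445065718, 0x120501021213233445065767,
   0x1206600102121323344557, 0x12075443313212102006, 0x12080102121323155428480637,
   0x121001021213231554063748, 0x1211010212132306374548, 0x12120102121323063745,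
   0x12133132121020064547, 0x121431321210200645, 0x121501021213234746764565,
   0x1216020121231354564667, 0x121701021213234546675878, 0x1218020121231364455867,
   0x12200201212313644567, 0x12210102121323454867, 0x122254313212102076,
   0x1223010212132345, 0x1224533154144032021626380817, 0x1225535431413240201626086817,
   0x1226611062021323140435451708, 0x1227800104148616130232453517, 0x12284140101345350232170816,
   0x12302001271704144513531636, 0x12315331361610540432022817, 0x123223313616200435451768,
   0x12332331201014043545361617, 0x12348331861614354540320217, 0x1235611062021323140435453817,
   0x12362331201014043545161738, 0x123710140402234535161767, 0x12386110140413023245351768,
   0x124020012313041435451617, 0x12412001231304141636451708, 0x12426163131014043202451738,
   0x12432001231304141636451758, 0x124461631310140432024517, 0x124531101404161732720865,
   0x12462001041423134516561708, 0x1247100712720676742343654578, 0x12482001231304144516561738,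
   0x125020010414231345165617, 0x125120010414231316176745, 0x1252200104142313451617,
   0x12537370310104143216263525, 0x1254626123132535145420400738, 0x1255404101024525132353162607,
   0x12566110140402132325350728]"

definition certs4 :: "cert list" where
 "certs4 =
 [Clique5 0x124678
  [0x10113615431860187018630046005020240056005],
  Clique5 0x124678
  [0x18005800501876005018630046005420040056005],
  System [0x10358, 0x11468, 0x12468, 0x11568, 0x12568, 0x13568, 0x10378, 0x10478, 0x11478, 0x12478
   ] 0x1
  [0x103468, 0x104568, 0x134678, 0x101578, 0x102578, 0x101458, 0x102458, 0x113678, 0x123678,
   0x113578, 0x123578, 0x112578]
  []
  [Fam 0x1081828353738464756 0x100, Fam 0x103041415242535586878 0x101, Fam 0x1081415182425283537384768 0x102,
   Fam 0x103040814152425356878 0x10304, Fam 0x10304081415242535586878 0x10506, Fam 0x10814151824252835374768 0x10708,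
   Fam 0x1030408141518242528356878 0x11011, Fam 0x10304081415242528356878 0x1031211, Fam 0x10304081415182425356878 0x1041210
   ]
  [0x18185658661155282628453836380405003836300008747824227628373000563000217708382000862270006,
   0x16373034641825262866184428747271763804050835303000070835300087303835346418353638661628773,
   0x10005172700065080035363874784414217274070860001466184864600000002414240860001466117277073,
   0x18646844161154262528000044000018747844142172780000440000180704084414200040384000041424000,
   0x10117277384000241424761626384874700021727738000037003464115864153528087708262278363730300,
   0x10700031747844640708242620004500383638446000140000082626561638727807083730300075003837300,
   0x10817478446428363656162825287738070035082270008520006174784464282522700058446616582426252,
   0x1804000045000016165] no_parts
  [0x180] no_parts
  [0x10002315430883004800571843202518402024200718432025184020242000004015400885005018630046005,
   0x17004800540056005],
  Nice [0x10478, 0x11678, 0x12678, 0x13678] 0x108141518242528353738476768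
  [0x111587148408141856203120441856203220401636142615230046005020540056005],
  Clique5 0x103578
  [0x10022013501770177017861536153620662066005],
  Nice [0x10578, 0x15678] 0x1040508172735464756576878
  [0x1311330623113700560054004106240056005],
  Clique5 0x125678
  [0x16005500550050208800560054004106240056005],
  Clique5 0x115678
  [0x10210606770670210800560054004606640056005],
  Nice [0x13468, 0x13568, 0x14678, 0x15678] 0x10307161726273435364748575868
  [0x16153615331773177720662060211720662060211018640056005],
  Clique5 0x103578
  [0x10020316431643085620662060211300460056005],
  Clique5 0x103478
  [0x10022516501770177520702120212321332136005],
  Nice [0x10358, 0x10578] 0x10304060715253548586878
  [0x1000130043004300470044004400170044004],
  Clique5 0x103478
  [0x10001302530043004002540044004021500424004],
  Nice [0x10348] 0x1030607161726274748565768
  [0x1000240058005400540055004],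
  Clique5 0x103478
  [0x10002400570058005400560054005600450040217],
  Clique5 0x103568
  [0x10002321332148005021302144005021602180083],
  Clique5 0x103568
  [0x10002500530678005500500674005021840040218],
  Clique5 0x103468
  [0x10002321432148005021402144005022002210221],
  Clique5 0x103678
  [0x10022321432143214021402140214422242227222],
  Nice [0x13467] 0x10305061227283448586768
  [0x1700570058005612280058005],
  Nice [0x13467] 0x10305061824252834386778
  [0x1700570050005612200058005],
  Clique5 0x134678
  [0x17005700580055224115780057005800552255005],
  Nice [0x12467, 0x12478] 0x10305151824253437576778
  [0x1700552255005506161222005806280051062],
  Clique5 0x124678
  [0x12084622672264071616471645071800582278227],
  Clique5 0x105678
  [0x15004511120048005400431434005318850052005],
  Nice [0x10567, 0x10378, 0x10678] 0x1030607242527344648565878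
  [0x1815040044127700580046218507170054005500561222005],
  Nice [0x12567, 0x11258, 0x12578] 0x1010305071418242534476778
  [0x1618761878154700511871122612211871122612271540005],
  Clique5 0x124678
  [0x10045604522305231311272130228711452322005],
  Nice [0x13467] 0x1030506081824252628346778
  [0x1700570050005023200058005],
  Clique5 0x105678
  [0x17005700580055224606180058004200582345005],
  Clique5 0x124678
  [0x15081623572355071621372130228200582348234],
  Nice [0x12468, 0x12478] 0x1060708122627283846474858
  [0x1600461437143800571546154200510621062],
  Nice [0x13467, 0x13478] 0x10305071218242527346778
  [0x1700552322005823461872005822710621062],
  Clique5 0x103678
  [0x16075621472144228523352335236123762387238],
  Clique5 0x124678
  [0x10047700580056004311060722027800522322005],
  Clique5 0x124678
  [0x10046604650636078311270800228200570052005],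
  Clique5 0x124678
  [0x16004400440053143211120055004800521812005],
  Clique5 0x103578
  [0x16065404572132241523362206242523022432005],
  Clique5 0x134678
  [0x18005515000045005621080053005515030782005],
  Clique5 0x124678
  [0x12084322632453078700580057005800522273005],
  System [0x10248, 0x10258, 0x10358, 0x11358, 0x11368, 0x11468, 0x12468] 0x1
  [0x112568, 0x102368, 0x101348, 0x112458, 0x123568, 0x103468, 0x101458]
  []
  [Fam 0x10405151628373846485758 0x100, Fam 0x10205151626373848575868 0x101, Fam 0x10203081314172648575868 0x102,
   Fam 0x10405141516172628373848 0x103, Fam 0x102051516263738485758 0x104, Fam 0x102031314172648575868 0x105,
   Fam 0x102030813142437575868 0x106]
  hub_tree no_parts
  [0x180] no_parts
  [0x1400552256122200540052004323432253005800500053234012200054004122520050005000520050005],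
  Clique5 0x124678
  [0x17005323880054004700520055227200522473005],
  Clique5 0x103678
  [0x16075421472142246624452302248223052488005],
  Clique5 0x103568
  [0x16004500471558005123772132005223080055150],
  Clique5 0x103567
  [0x16075508662147214224062447244225022502251],
  Nice [0x11278, 0x11578, 0x14678, 0x15678] 0x10617182728384647575868
  [0x1203470324025607850256078600470046005600470048005000400040004],
  Nice [0x14678] 0x10106171828364748586768
  [0x1500450047005023170054005],
  Clique5 0x134678
  [0x12023202362536254600470047005400440044004],
  Nice [0x10368, 0x10568, 0x14678, 0x15678] 0x1030515242734374546576878
  [0x1304650460044502860275042600470047005602772318025400440044004]]"

definition codes5 :: "int list" where
 "codes5 =
  [0x12572001231304142535451607, 0x1258313616101404320267074525, 0x12605220540401412313163607,
   0x1261200123130414254526160738, 0x1262833186161032021404254507, 0x12633110320214042545160738,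
   0x1264611014046545025213230737, 0x1265404101024525165613230767, 0x12664041010245251323165607,
   0x12673110140432452516260758, 0x1268232531541458168670, 0x127025544123134007587816,
   0x12713110320214042545160758, 0x12725254204041012313071668, 0x127320010414231325451607,
   0x12746163131032021404352545, 0x12751310320214043525451637, 0x127631103202140435254516,
   0x12776163131032021404254537, 0x12783110320214042545163738, 0x12804140104516565213236737,
   0x12813110320214042545165637, 0x12823110320214042545163758, 0x128361101404021323452537,
   0x128452200123130414163657, 0x12853110320214042545165657, 0x12863110320214042545165758,
   0x128731103202140425451657, 0x128820010414231325451678, 0x1300525420404101231316,
   0x13013110320214040727451656, 0x130240410102132307274516, 0x130301041413023216363527,
   0x13048772732331351454204016, 0x13055331541410403202372716, 0x130661101404022723453578,
   0x130753544140103202273816, 0x13085354314140103202162767, 0x131053315414104032021627,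
   0x131120012313041416364527, 0x131272732320010414451638, 0x131320012313041427374516,
   0x13142001041423134516562708, 0x13152001041423134516562757, 0x131601041402132345165627,
   0x131772200475452341311608, 0x131872755420404123131658, 0x132020010414231345275716,
   0x132120010414231316276745, 0x1322200104142313451627, 0x132331321626201404455708,
   0x132420010414231345165708, 0x13252001231304141636456757, 0x132661631310140432024557,
   0x13270706767201212334654578, 0x132831101404320245165738, 0x133020010414231345165758,
   0x1331311014043202451657, 0x1332544140100778168623, 0x1333544041010207781623,
   0x133473313210201404781645, 0x133531103202140445166778, 0x1336200104142313451678,
   0x13373110320214044516, 0x13383137170604054502, 0x134060610102132304054517,
   0x134104054543313216261708, 0x134213321626177440450508, 0x1343800504541316326217,
   0x134401021323040545161708]"

definition certs5 :: "cert list" where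
 "certs5 =
 [Clique5 0x124678
  [0x15103425550286256600470047005400440044004],
  Nice [0x11278, 0x12478, 0x13578] 0x1030608171827283746474858
  [0x140576088412250046004700540047004800570047005405880054005],
  Clique5 0x124678
  [0x15004202360047005310870047005325850614005],
  Nice [0x13567, 0x11578] 0x1030608121524273746566778
  [0x170058005700562542023006250048005806150054062],
  Nice [0x13567] 0x10517262728363747565758
  [0x1400480045005623120055005],
  Clique5 0x124678
  [0x17005226160057005700560055232500582624122],
  Nice [0x10368, 0x12468, 0x11278] 0x1031724283435364757586768
  [0x10107016172264155715622465088500440048005526060716088012250058005],
  Nice [0x12478, 0x13478, 0x11578] 0x10506171828384647575868
  [0x171116108722410574258106231546264500571541122600480058005],
  Clique5 0x134678
  [0x14158526062646231510871543232426532548005],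
  Clique5 0x134678
  [0x17005000480058061700560053005200580611062],
  Nice [] 0x106081215182434354648566778
  [],
  Nice [0x13467] 0x1050812262728353638474857
  [0x1312200050268700520056268],
  Clique5 0x124678
  [0x11068326760633078700560057005800582682270],
  Nice [0x10358, 0x13578] 0x1030517262728363738475758
  [0x1511131276227400450058262800582680062],
  Clique5 0x103568
  [0x12112312862144228225752603263426632715272],
  Clique5 0x124678
  [0x12031203140284028403120282028400440044004],
  Clique5 0x124678
  [0x15131525570258256602502558256400440044004],
  Clique5 0x103678
  [0x12112003122572257627432753275400440044004],
  Clique5 0x124678
  [0x15025002440285063311202668063700470054005],
  Clique5 0x124678
  [0x15067607150275027606702660266800550057004],
  Nice [0x10368] 0x10306071728384647586878
  [0x1512041547268700480055005],
  Clique5 0x124678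
  [0x16111500470048005510802656254028050058005],
  Clique5 0x124678
  [0x16005700570048004200572542005800550050270],
  Clique5 0x103568
  [0x10107413162133263327562773278328132825005],
  Clique5 0x124678
  [0x16004400450048005218531432005014370054005],
  Clique5 0x103678
  [0x12112421442664266528432816078700470058005],
  Clique5 0x103678
  [0x14081408332713271207132823282800570057004],
  Clique5 0x103568
  [0x12112111262143271327652843282328532867005],
  Clique5 0x103567
  [0x16005600570052273400440056283700532873071],
  Clique5 0x103578
  [0x12112113522732273327662836283328732872288],
  Clique5 0x134678
  [0x17004600440046005500420883005725830058005],
  Clique5 0x103568
  [0x16140516462133241526060046005330130783005],
  Nice [0x12568, 0x10678, 0x14678, 0x15678] 0x103050615262834384546586778
  [0x1514070286080402801036081613162778063500472844005726070056078],
  Nice [0x11258, 0x12468] 0x10106070815262836464856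
  [0x111374023706250054005023250050005526840052062],
  Clique5 0x105678
  [0x15004600430238005400450254004525340048304],
  Nice [0x12568] 0x10615262836373846565758
  [0x1100450057004300542687005],
  Clique5 0x105678
  [0x16005800560056304800570618004406270056306],
  Nice [0x10368, 0x12468, 0x12568] 0x1060708121718263846474858
  [0x140576201412261204004700480050258406261863270028080057005],
  Clique5 0x103678
  [0x17153621352602263030353055307530870056306],
  Clique5 0x103578
  [0x17153500460048005030342845063314340052005],
  Clique5 0x105678
  [0x15004600460058005100463061004530610042005],
  Clique5 0x103568
  [0x17103500460048005530542847312400440044004],
  Clique5 0x134678
  [0x18005800540047005300572723005412210622005],
  Clique5 0x103678
  [0x12138016162872314014340047005500480058005],
  Clique5 0x103578
  [0x12138516333012314531040047005231530818005],
  Clique5 0x134678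
  [0x16306800580058270800580056005526812682270],
  Clique5 0x103678
  [0x17078331730787317400540054268426812684005],
  Clique5 0x103568
  [0x11145314862137317531031436306231573188005],
  Clique5 0x103568
  [0x14113515452033232530873005306031680057318],
  Clique5 0x103567
  [0x17153516462134302531023112313031623202321],
  Clique5 0x134678
  [0x18005100562706268800510051005327032682270],
  Clique5 0x124678
  [0x10168632373173078800560056005327070052270],
  System [0x11258, 0x10358, 0x12468, 0x10568, 0x12568, 0x11278, 0x10378, 0x12478, 0x13478] 0x1
  [0x104678, 0x102678, 0x134568, 0x103468, 0x123458, 0x101578, 0x123578, 0x102578, 0x113578
   ]
  []
  [Fam 0x1030612242634485878 0x100, Fam 0x103060812242634485878 0x101, Fam 0x1030612242634586878 0x102,
   Fam 0x103061224263448586878 0x103, Fam 0x103061224263438586878 0x104, Fam 0x103051218242534386878 0x10506,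
   Fam 0x103060812182627374858 0x10708]
  [0x18385805086566007877303538482252481215171000526278151000621716474342582265660870001277381,
   0x15100062151718151218226870001277300068284248727747371000564340004262187000127737103873460,
   0x17473848225000424278656000226648225272484000421266424278486000086568400030002840000865625,
   0x15184640003000281512571275686262464268684000286840003000226840000848664000300008656505384,
   0x16400030002847473078656640003600000077353805682842400043487270781217151000573742526866084,
   0x16400022434000386605003846400023400035003] no_parts
  [0x180] no_parts
  [0x13143502330576258306271825188718821816004011440043114400500574258702300622106500420057004,
   0x1800570052005],
  Clique5 0x124678
  [0x16004400431434005211150042005232570052005],
  System [0x10248, 0x10258, 0x10358, 0x11358, 0x11368, 0x11468, 0x12468] 0x1
  [0x112568, 0x102368, 0x101348, 0x112458, 0x123568, 0x103468, 0x101458]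
  []
  [Fam 0x1020515162628373847485758 0x100, Fam 0x1020515162637384748575868 0x101, Fam 0x1020308131424374748575868 0x102,
   Fam 0x1040515162526283738474857 0x103, Fam 0x10205151626373847485758 0x104, Fam 0x10203131424374748575868 0x105,
   Fam 0x1030408131424253747575868 0x106]
  hub_tree no_parts
  [0x180] no_parts
  [0x1400512706122200540052004830602703005800500058306012200054004426220050005006220050005],
  Clique5 0x124678
  [0x16005800563064004200560052272006270050327],
  Clique5 0x103678
  [0x14081621443164316207123172317800570057004],
  Clique5 0x103568
  [0x12164715362142324231063263328431623307005],
  Nice [0x12567, 0x13567] 0x1051526272836373847565758
  [0x1406253065306406253065306200520058004],
  Clique5 0x103568
  [0x16005600550055005633253322232300563325332],
  Clique5 0x103568
  [0x16005600550052232633220056005800503270122],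
  Clique5 0x103568
  [0x16005600550055332106220050122800570057004],
  Clique5 0x103567
  [0x16005600550055333633220057334700533313335],
  Clique5 0x112578
  [0x10223522322522252530023222322333133312336],
  Nice [0x12468, 0x12568] 0x11618242526363848586778
  [0x1222322232004400452231085422310854004],
  Nice [0x12468, 0x13468, 0x12568, 0x13568, 0x13678] 0x1031824252834353846566778
  [0x15213421331716081430353034041733820817140508071404080400470058005],
  Clique5 0x135678
  [0x18005200470047005206183064005700470051005],
  Clique5 0x135678
  [0x18306200470047005830680051005600470051005],
  Clique5 0x134678
  [0x10341200470047005034113425083700470051005],
  Nice [0x11248, 0x11258, 0x12678, 0x13678] 0x10612262736374648565878
  [0x110475084408483405213421383438343808163387338208150834083400470056005]]"

definition codes6 :: "int list" where
 "codes6 =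
  [0x134520233136160405451748, 0x134661631310320204054517, 0x1347010213230405451617,
   0x134871101606721323043445, 0x135060610102132317270445, 0x135131103202160604451728,
   0x135223311016060425451747, 0x1353400106164717134532, 0x1354101606021323044548,
   0x1355311016063202041745, 0x13562001231326160435451708, 0x13572001231304354516461708,
   0x135801130232043545161708, 0x136086616717133220043545, 0x136161671710130232043545,
   0x136231322004354516176878, 0x136361101302320435451768, 0x1364101302320435451617,
   0x1365616313322004451708, 0x136661631310320204451757, 0x136701130232163604451758,
   0x1368616313103202044517, 0x137020270871831316650454, 0x13712001231327170445165608,
   0x137240010213234516561708, 0x137356546140101332172738, 0x13741007127274234345065678,
   0x137501130232044516561738, 0x137620012313044517571668, 0x137701021323044516561757,
   0x1378611002132365041758, 0x1380544001561602132317, 0x1381717616100204234568,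
   0x1382010213230416176745, 0x13836110021323044517, 0x138431103202042415451637,
   0x138502042413151678, 0x1386010204241323154516, 0x13875354324240203101571676,
   0x138801021323042435451657, 0x140040420201231316653757, 0x1401424020012313166557,
   0x1402100204241323451657, 0x1403611002042413234578, 0x14046110130232042445,
   0x140540450501021323162748, 0x1406404505010213231627, 0x1407606101021323044527,
   0x140801021323043545162708, 0x14103135541646576710403272, 0x14110102132304164635452767,
   0x141201021323043545162767, 0x141368876113723235205404, 0x1414611310043545322768,
   0x1415010213230435451627, 0x1416722023013136160445, 0x141701021323162767657554,
   0x141831321665275754204068, 0x142001021323044516562757, 0x142101021323044516562758,
   0x142287722023013104164565, 0x1423100213230445165627, 0x142401021323044516276758,
   0x142501021323162767044568, 0x1426010213230416276745, 0x14273220310104164527,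
   0x142831103202044516564757, 0x1430311032020445475716, 0x143140011345350232164758,
   0x143231103202044516564758, 0x1433544001021323164758, 0x14342001231304451647,
   0x143553311032025404071678, 0x1436010213230407451678, 0x1437011302320435451678,
   0x14384001021323162645375878, 0x144010120727233445065678]"

definition certs6 :: "cert list" where
 "certs6 =
 [Clique5 0x125678
  [0x15004200440044004830600058004700470054004],
  Clique5 0x124678
  [0x15025200440044004230522532345700470054004],
  Clique5 0x103678
  [0x16171634073400344634673462081400470056005],
  Clique5 0x135678
  [0x15004015560048005728302808005520743225005],
  Clique5 0x134678
  [0x17348315560048005514233483081715533235005],
  Nice [0x12467, 0x13567, 0x10378, 0x13678] 0x1030524252736374648565878
  [0x171716221817343023171635042313155600560045152308123224071706722735005],
  Clique5 0x135678
  [0x16004520701435005728740048005616143222005],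
  Clique5 0x125678
  [0x12352031633483081530050048005721443225005],
  Clique5 0x135678
  [0x13353516520813353233780055004233723375005],
  Clique5 0x124678
  [0x11337317163503351515343531354715573335005],
  Nice [0x10367, 0x11248, 0x13478, 0x13678] 0x1060714151828343647576878
  [0x101680157735001216226423112634071700570058005223462347005800582348234],
  Clique5 0x125678
  [0x18005235672347005800562242224800582348234],
  Clique5 0x124678
  [0x11278235623564071235773572071800582348234],
  Nice [0x13478] 0x10103050712182425273478
  [0x1500400058005026800051005],
  Nice [0x10568, 0x10578] 0x106070814152838464748565758
  [0x1400471546154800562807280400583608360],
  Nice [0x10367] 0x10305141518242534465667
  [0x1600542684268000500051005],
  Nice [0x10367, 0x10378] 0x1030514151824253447576778
  [0x1700522328005823452322005823483600362],
  Clique5 0x103678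
  [0x16171335533550358035503553358636163637363],
  Clique5 0x124678
  [0x16312700580058004230720782345800573320005],
  Clique5 0x124678
  [0x14004215463614005230850042005320231222005],
  Clique5 0x124678
  [0x14004700540053270730620055004400533272005],
  Clique5 0x105678
  [0x16346516533536365033163660367721343342005],
  Nice [0x11248] 0x1031215263435364857586768
  [0x1400522684005700500621005],
  Clique5 0x134678
  [0x17234800560057370800532343005800522342370],
  Clique5 0x124678
  [0x11328235623713078800532347005800522347370],
  Nice [0x11258] 0x1020506071415242837464778
  [0x1800540054005426870054268],
  System [0x10248, 0x10258, 0x10358, 0x11358, 0x11368, 0x11468, 0x12468] 0x1
  [0x112568, 0x102368, 0x101348, 0x112458, 0x123568, 0x103468, 0x101458]
  []
  [Fam 0x1040515162628373848575867 0x100, Fam 0x1020515162637384857586768 0x101, Fam 0x1020308131424374857586768 0x102,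
   Fam 0x1040515162526283738485767 0x103, Fam 0x10205151626373848575867 0x104, Fam 0x10203131424374857586768 0x105,
   Fam 0x10203081314243757586768 0x106]
  hub_tree no_parts
  [0x180] no_parts
  [0x1400512343272200520056005323432253005237000053234123400052005122583703005300583708370],
  Clique5 0x124678
  [0x17005336343737005200553735270200523744373],
  Nice [0x10367, 0x10358] 0x105060712141526272836373847
  [0x170057005833250053370726831222005437342688306],
  Clique5 0x103678
  [0x12164430043004372631673160375508823762376],
  Clique5 0x103678
  [0x12164332423558372032820783375400570055373],
  Clique5 0x103578
  [0x12164034723554372136473660375037763782376],
  Clique5 0x103578
  [0x12004400430058005836083062005830640050005],
  Clique5 0x103568
  [0x12004400471558005636172132005538040057381],
  Clique5 0x103567
  [0x16171034733553355136463687368538053800382],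
  Clique5 0x103568
  [0x14110513123035307025723555081600460055005],
  Nice [0x13567, 0x13568] 0x106070826272835364647485758
  [0x1000430040085008550040085008500850085],
  Clique5 0x103578
  [0x11135113513371337027633843384538453844385],
  Nice [0x12568] 0x1060718252627384647586878
  [0x1111142804268700430053005],
  Clique5 0x103678
  [0x14155528412811282400470046005538730056005],
  Nice [0x12678, 0x14678] 0x1050618252738454647586878
  [0x1436101430270338773878360500430053005],
  Clique5 0x103678
  [0x16185432643661367400444006005500430053005],
  Clique5 0x103568
  [0x16206720663261328038840046005440130813005],
  Clique5 0x103567
  [0x16005200550055333600540040381300530784401],
  Clique5 0x112578
  [0x10223038663836383522313221322140214026403],
  Clique5 0x103678
  [0x16150507830785218400470046005836030056005],
  Nice [0x11478, 0x11578, 0x13678, 0x14678, 0x15678] 0x103081718242534353748586768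
  [0x15164416403474085400470046005435443544405535453545405436130056005],
  Clique5 0x134678
  [0x16406315560047005520613543081233733335005],
  Nice [0x13467, 0x11248, 0x12468, 0x11478, 0x14678] 0x106121718242526343748576768
  [0x10125226323564231126313564231800580058005236313636005527063767376],
  Nice [0x11258, 0x10568, 0x10378, 0x13478] 0x10508182425263637474868
  [0x12283428011867364726802837273231771864268226422130317020723177201222502250317],
  Nice [0x10378, 0x11478, 0x11578] 0x10607081217262837384858
  [0x111862280726861863280628052680308427013083270541032682268],
  Nice [0x11248, 0x11258, 0x13468, 0x13478] 0x1030508141518242528346878
  [0x101865308430872705308430862705361730863084270041124113270027022701270],
  Nice [] 0x101061217182637384648575867
  [],
  Nice [0x11258, 0x11478] 0x102060708171824253746474857
  [0x173325005400523764005730662700268526842687413],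
  Clique5 0x103678
  [0x11212640774070408640774073408041224141414],
  Clique5 0x103578
  [0x16155400470048005640742846381640040052005],
  Nice [0x11248, 0x10368, 0x12468, 0x10378, 0x11478] 0x103040512151726363748586878
  [0x11025330033003061104463774142434373774142434303000300006142134213000503230323],
  Nice [0x11248] 0x1050715171824253536373847
  [0x1400512684005800512687370],
  Clique5 0x103678
  [0x16203631673161375640074006268041734183418],
  Clique5 0x103678
  [0x17203307830781375400540054268027040058370],
  Nice [0x11248] 0x1050614152526283536373846
  [0x1400580058270300530055270],
  Clique5 0x103578
  [0x17203535473661375041574002414042004218422],
  Nice [0x12468] 0x10305081214172634363748
  [0x1300530057270326800055413],
  Clique5 0x103578
  [0x17005300530053268227000050268327054130005],
  Clique5 0x103568
  [0x11186436123374363041214013414142304240425],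
  Clique5 0x103567
  [0x11212440664077407041574166416142324230426],
  Clique5 0x103678
  [0x12004700450888005700414172005418600058306],
  Nice [0x11258, 0x10368, 0x10568, 0x11278, 0x10678] 0x103050714151718283846566768
  [0x12004715550045155800520317380538000817401540100815004200534285341342800057341],
  Clique5 0x103678
  [0x16005700560054414200514142005227022707414],
  Clique5 0x103678
  [0x16005700560053376200512702418541400057414],
  Clique5 0x103567
  [0x16005733370056005443120055414343253415414],
  Clique5 0x112578
  [0x10223538363836383342734273427343054337433],
  Nice [0x11258, 0x12568] 0x103050817182425344748576768
  [0x1412763327234400563768376626882684270],
  Clique5 0x103568
  [0x16005600550056005543520058435337653733376],
  Nice [0x10567, 0x10568] 0x1030512171824252634366768
  [0x1600570055435543562687414841414241424],
  Nice [0x10356, 0x11257] 0x10508122728363847485767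
  [0x1600530053005400563704005637040058376000573704005],
  System [0x10248, 0x10258, 0x10358, 0x11358, 0x11368, 0x11468, 0x12468] 0x1
  [0x112568, 0x102368, 0x101348, 0x112458, 0x123568, 0x103468, 0x101458]
  []
  [Fam 0x103040813141718242535364668 0x100, Fam 0x103040813141718242528353646 0x101, Fam 0x104051516171825262835363846 0x102,
   Fam 0x102030813141718243536465868 0x103, Fam 0x1020515162637384748575867 0x104, Fam 0x1020313142437474857586768 0x105,
   Fam 0x102051516171826283536384648 0x106]
  hub_tree no_parts
  [0x180] no_parts
  [0x1400543735376200520056005741404143005343800054376437300052005441483703005537083708370]]"

definition codes7 :: "int list" where
 "codes7 =
  [0x1441011302320437451678, 0x1442313210201604654578, 0x144375788654614010130232,
   0x1444400102132345571678, 0x14458776611002132304, 0x14464001021323451678,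
   0x144740014502132316, 0x14481013073732160845, 0x14500102132316070845,
   0x1451010213231626074548, 0x14520102132316260745, 0x1453200123130616074548,
   0x14540102132316074548, 0x145570010213231645, 0x1456010213231664454757,
   0x14570102132316454757, 0x1458454656611310324758, 0x1460010213231665544758,
   0x1461100213231667744558, 0x14621002132316474558, 0x146320230131164745,
   0x1464200123131664674578, 0x14651002132316644578, 0x146610021323164578,
   0x1467202301311654, 0x14680102132345465767, 0x1470010213234546675878,
   0x14714546675801021323, 0x147246456701021323, 0x147345480102132367,
   0x1474450102132367, 0x14754501021323, 0x1476100223344516560728, 0x1477322021013445160728,
   0x14784345353220210156164707]"

definition certs7 :: "cert list" where
 "certs7 =
 [Clique5 0x103568
  [0x16005600550057435443520052005842224405422],
  Nice [0x10367, 0x10368] 0x105061415242527283435373846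
  [0x1600550053376337620058422742274148414],
  System [0x10356, 0x11247, 0x10367, 0x12467, 0x13467, 0x11248, 0x11258, 0x10358] 0x1
  [0x1012378, 0x1012357, 0x113478, 0x123478, 0x102567, 0x123567, 0x102568, 0x113458, 0x103468,
   0x103478, 0x101256, 0x112567, 0x101348, 0x112456, 0x124568, 0x134568, 0x123456, 0x123568,
   0x123458, 0x123468]
  [0x1103268475]
  [Fam 0x103050712171824252634363847 0x102, Fam 0x1050607121718242526363847 0x103, Fam 0x10507121718263638474858 0x106,
   Fam 0x1031226364748565867 0x108, Fam 0x103122636384748565867 0x110, Fam 0x103060814152425272834353746 0x111,
   Fam 0x103060814182425272834353746 0x100, Fam 0x103071217242634364748565867 0x11516, Fam 0x1050714171825272836373846 0x11715,
   Fam 0x1030507122425263436474858 0x11816, Fam 0x1030714151727283446565867 0x12021, Fam 0x105071217182425263638474858 0x12118,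
   Fam 0x10507081215262835364748 0x12016, Fam 0x1031226344748565867 0x11721]
  [0x16365306743474673272426417121242625483800282800024838242826250017585181212500072521001071,
   0x18150356080001200142100072535508000042625002881000026272446252141712848815800177151000738,
   0x14880355850242141712781282551001000076070505851810005252800268158512528002650250020280004,
   0x12841255800200015462728001850355860802428254800218151484100120005214148710000462748000228,
   0x10022582428254800218151484171000000052141487100004627480002282500223580250004282448002746,
   0x12748000200244647737038800006480008737060502625000327000160503580734667477026242758384300,
   0x10848418100007124280002272125000428244800272721710010415181484300243800203843480006002043,
   0x10008480000262425000327000143476770384800060008677038583560734626246727000347432148417181,
   0x13858000530700008805850252800040023512528002530705038588000088058385025280004002328815125,
   0x13800050025250017385850255181280015288151000528385881417100004171272500075100102741285825,
   0x13800235125210007217181503000148070300014383048430000001248002543002800108148212500074881,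
   0x12171250017580023217125674770000127582838503080000421715181282447410007307050803851001181,
   0x10013472443417148812851380005002128380000804181483843000624001828001543000828515048244338,
   0x10002000038001243000800112471814828433800000002384300060018430008284838504348000681484124,
   0x1280002240018280015285124480018001543476770262700032425000167703050262700032500013050] no_parts
  [0x180] no_parts
  [0x16005600550053376537340057005737323764005300533708438337054135438841320052370237043620005,
   0x15414841440050005],
  Clique5 0x103568
  [0x16005600550055373741420052440244240057443],
  Clique5 0x103568
  [0x12214438323317380242704023423743364442430],
  Clique5 0x103567
  [0x16005600550050436043720050441244244448445],
  Clique5 0x112478
  [0x10223333763836383640434273427243424344446],
  Clique5 0x124678
  [0x15445644660050437742714275445344634466005],
  Clique5 0x134678
  [0x14447638514481448738373788378644664466005],
  Clique5 0x103568
  [0x11213537812138378344410673444644430056444],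
  Clique5 0x103468
  [0x11214444712140450544512140446544504516446],
  Clique5 0x112578
  [0x16081235562212355236730712367800540044005],
  Clique5 0x103568
  [0x12213537824538378844520815445644460056444],
  Nice [0x11248, 0x10348, 0x11258, 0x10358, 0x12468, 0x12568, 0x13478, 0x13578] 0x10304051218262736374748575868
  [0x12214444754470450321444475447145044475447045204484447544714521448544554450454444544450454,
   0x164467446],
  Clique5 0x103568
  [0x12004342850046005042860046005721313420005],
  Clique5 0x103468
  [0x12004343040046005043060046005045683430005],
  Clique5 0x103678
  [0x10312700583067306033373078307800570050005],
  Clique5 0x103468
  [0x16005343270052442043220050442445813420005],
  Clique5 0x103468
  [0x16005541470054443541420054443000500056362],
  Clique5 0x103567
  [0x16005443370057444443320057444046083431461],
  Clique5 0x103578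
  [0x12213744554450454744554453454045714621462],
  Clique5 0x103568
  [0x16005741440054414741420054414000563620005],
  Clique5 0x103567
  [0x16005244240055445044220055445000514612464],
  Clique5 0x103467
  [0x16005444640057446444620057446146514621465],
  Clique5 0x103478
  [0x12214444764556455444774558455246324631466],
  Clique5 0x112568
  [0x10220246324631462146314632462422054626462],
  Nice [0x11248, 0x10348] 0x10306071216174748565768
  [0x112174362836202174362836243628362436283620005],
  Clique5 0x112478
  [0x10218246414611461146424612461000500050470],
  Clique5 0x112578
  [0x10220246324631462146314632462046844716471],
  Clique5 0x112568
  [0x10221146524631465246514632465547100058471],
  Clique5 0x112468
  [0x14222246724671466146714672466647244736473],
  Clique5 0x112678
  [0x10223246724672467146714671467447444747474],
  Clique5 0x113578
  [0x10414700580058440700574407005441864185443],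
  Clique5 0x135678
  [0x18005433443346005147604763232646383358335],
  System [0x10368, 0x10468, 0x12468, 0x11378, 0x11578, 0x12578, 0x12678, 0x13678] 0x10514
  [0x103578, 0x105678, 0x102568, 0x112478, 0x114678, 0x113468, 0x101348, 0x101458, 0x102458,
   0x101358, 0x112458, 0x102358, 0x112348]
  []
  [Fam 0x10506131525263638485778 0x100, Fam 0x106131525263638485878 0x101, Fam 0x10813152526363846485878 0x102,
   Fam 0x10813141517252628364678 0x103, Fam 0x108131518252628364678 0x104, Fam 0x108131826283646485778 0x105,
   Fam 0x1081315252636464878 0x1060708, Fam 0x10813152526283638464878 0x1100711, Fam 0x108131525263638464878 0x110120708,
   Fam 0x108131525262836464878 0x106130711]
  [0x18184800486606485058224257587670001728767000162000215833082240007622500086331822400106225,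
   0x10006608373877131866364000467636272822400038224000386636787647100046287857500010500006772,
   0x18224710003822464048525000205157571870000870000306386643100058664048363308767737100043031,
   0x10005418687670004717331836300058363000564808287720003677175158525050001852572620500016224,
   0x16004] no_parts
  [0x180] no_parts
  [0x11023711472536025406200236253611420255062502340236004700480056004000480053025006230251062,
   0x1000400040004]]"

definition codes8 :: "int list" where
 "codes8 =
  [0x148061101202236535345407, 0x148110120223340747451656, 0x1482010212233445165607,
   0x14832021010523543416586807, 0x148401021223344516586807]"

definition certs8 :: "cert list" where
 "certs8 =
 [Clique5 0x124678
  [0x15023600470048005302544788306000400040004],
  Clique5 0x113578
  [0x10186611421868332447800048005247810624005],
  Nice [0x11478, 0x12578, 0x13578, 0x13678, 0x14678] 0x1030413172427384857586768
  [0x1433772132476533772131476648044041401045834801481136524812365240124584005],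
  System [0x11357, 0x12467, 0x12567, 0x13567, 0x11378, 0x11478, 0x12478] 0x103040608
  [0x112578, 0x123578, 0x123678, 0x114567, 0x113467, 0x112457, 0x103467, 0x134678, 0x103678,
   0x103468, 0x103478, 0x104678]
  []
  [Fam 0x10304081314172425356778 0x100, Fam 0x1030408131417242527356778 0x101, Fam 0x1061727353846485667 0x102,
   Fam 0x10306081314242535576778 0x103, Fam 0x1030608131824253547576778 0x104, Fam 0x10304131417242535576778 0x105,
   Fam 0x106081318262836475778 0x10607, Fam 0x10304081318262836475778 0x10807, Fam 0x104081318242636475778 0x11007,
   Fam 0x104131424263638475778 0x11107, Fam 0x108131826283646475778 0x11207]
  [0x17478711873313851753531387282000152000082724248147500053552000076354265367572000152000052,
   0x17572000572000100006264727500054872626452750001653675000175653631627242000552724200053664,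
   0x16242487200027200021442767336000431513575650003756500036462728275520005655100007282481875,
   0x15200055100004871723864317318755152000135513665766200027662000275513573520001627665524235,
   0x13673000473000440608065363573760004307673000600027300047652733600060002357673363080600008,
   0x10006600007000265367300047351763665308060000800066000070004766242827336314080001160308000,
   0x10800070002733118147636628040001030753565428235526040640011000864000640001165646040000800,
   0x1064000116000086551406460000600116000086400066460400008000664000442821418] no_parts
  [0x180] no_parts
  [0x14200318132006181700521223120300570057005612070056005112200047360500542708270206230058004,
   0x1400540051062],
  System [0x10356, 0x11357, 0x12467, 0x12567, 0x13567, 0x11378, 0x11478, 0x12478] 0x10408
  [0x123678, 0x112578, 0x123578, 0x114567, 0x112457, 0x113467, 0x103468, 0x134678, 0x103467,
   0x103678, 0x104678, 0x103478]
  []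
  [Fam 0x1061727353846485667 0x100, Fam 0x10617242535384648566778 0x101, Fam 0x106172735384648566778 0x102,
   Fam 0x10506081314242636576778 0x103, Fam 0x1050608131417242636576778 0x104, Fam 0x1050608131826283647576778 0x105,
   Fam 0x10405081318242636475778 0x10607, Fam 0x10506081318262836475778 0x10807, Fam 0x10304051318242636475778 0x11007,
   Fam 0x1050813182628364647565778 0x11107, Fam 0x1040513142426353638475778 0x11207]
  [0x17274784871418164766242827338000036317504605635528138300008500800064150303808001100080800,
   0x10638001130380800110008508138300008080006413530510800063800115230380800110008080006380011,
   0x13038080011000808000638001108001035563873318141760005366275083060000704000604001135566275,
   0x13135735176000536566030000750300408000636767300057300003060000850086000070400065676730000,
   0x17335518176365600005152567600037642755652733536310005510003828173763600006275350002565238,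
   0x13171417551000135520004714148427551000152000442787652418148717336000531387556000335517336,
   0x13831710005567535366271000131513151357536710003757100040003357100013871755100040001718148,
   0x18275565100040001755662647151000441000364624882] no_parts
  [0x180] no_parts
  [0x14200232724833200132770052122730630057005600573067005600511220004736050057306730610623005,
   0x18004400540052062]]"

definition codes9 :: "int list" where
 "codes9 =
  [0x1485202101233445160758, 0x1486544332202101166807, 0x14873220210134451607,
   0x14888332202101160745, 0x15003220210116074548, 0x150101021223160745,
   0x1502322021010405451637, 0x150320210104234737451656, 0x1504202101230445165637,
   0x15051012022304451637, 0x150602012123341637674565, 0x1507433220210116456537,
   0x1508010212233445163758, 0x15105443322120101667, 0x15116112102023344537,
   0x15120102122316373845, 0x15136112102023374548, 0x151432212010163745,
   0x15157478450201212316, 0x151601021223164578, 0x1517010212231645, 0x1518606101140245,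
   0x152001021424, 0x152132200134144528581607, 0x1522322001341445160728
   ]"

definition certs9 :: "cert list" where
 "certs9 =
 [Clique5 0x124678
  [0x16005700560053232733263323005400504841484],
  Clique5 0x113578
  [0x17005733230057005000450057306400504842062],
  Clique5 0x125678
  [0x14467621372133477048214822485646354865486],
  Clique5 0x124678
  [0x16333700560056005548654862485400573326332],
  Clique5 0x103568
  [0x13213547762138477248534632485148530051485],
  Clique5 0x134678
  [0x13487346734678488648774873500646784888488],
  Clique5 0x124678
  [0x15155400430048005532614826150023770053005],
  System [0x11348, 0x10358, 0x11358, 0x10368, 0x12468, 0x13468, 0x10578, 0x11578, 0x12578, 0x10678,
   0x12678] 0x1
  [0x123568, 0x114678, 0x112458, 0x123458, 0x113678, 0x112478]
  []
  [Fam 0x108182428343536576768 0x100, Fam 0x103071317242734485868 0x101, Fam 0x103071317182427345868 0x102,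
   Fam 0x10307131718242728345868 0x103, Fam 0x10307131724273448586878 0x104, Fam 0x1030708131718242734485868 0x105
   ]
  [0x18184833486366430800636648724826235855057855007517182000252000382725285505100026285000050,
   0x15152000307678535508006825224875772075767620000518224000252000331853680508757077182522400,
   0x10572626786060764000186066400013006866487576700040771000186643414875767000471000135511483,
   0x15187827200052464628636670001863667000171578535825200027224000385353134825200022400033134] no_parts
  [0x180] no_parts
  [0x13202632562023325148301863120514333085270612063080186714372700004541704008005500480051478,
   0x11062541750052062],
  Clique5 0x124678
  [0x11186018622378332500415038005050350052062],
  Clique5 0x105678
  [0x13502621473377488250414828486050450058486],
  Nice [0x10468] 0x1040506141524253848586878
  [0x1140021345268500480055005],
  Clique5 0x104678
  [0x13402420714010458500400048005050650054005],
  Clique5 0x104678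
  [0x12381606714010458700500045004400550056360],
  Clique5 0x103568
  [0x15207150472065486000474165005550740053081],
  Clique5 0x105678
  [0x11505621444040458450754630508551050050381],
  Clique5 0x104678
  [0x11505621484037403608105080508800540050004],
  Clique5 0x103568
  [0x11211848660675486050860810508800540044005],
  Clique5 0x103468
  [0x11212150562147488651174550512551065134005],
  Clique5 0x103568
  [0x16005048530050485651340056513351304713513],
  Clique5 0x103467
  [0x16005548830058488351440053514651475156514],
  Clique5 0x103678
  [0x13214621405010501346735143514651465140516],
  Clique5 0x135678
  [0x16517151745144514247565176517151715174514],
  Clique5 0x135678
  [0x13475347534753475547554755475647564757475],
  Nice [0x11357, 0x13567] 0x1050608172425273538486778
  [0x1630663326360700562707270641872680268],
  Clique5 0x103568
  [0x14322543465088365700504317005543235218317]]"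

definition codes10 :: "int list" where
 "codes10 =
  [0x152358548220410123163607]"

definition certs10 :: "cert list" where
 "certs10 =
 [System [0x11257, 0x11357, 0x12467, 0x12567, 0x10348, 0x10468, 0x11378, 0x13478, 0x14678] 0x105
  [0x123457, 0x115678, 0x112678, 0x112478, 0x112347, 0x104567, 0x134567, 0x105678, 0x135678,
   0x103456, 0x103568, 0x103457, 0x103578, 0x103567]
  []
  [Fam 0x105081315273446565778 0x100, Fam 0x104051725263538475768 0x101, Fam 0x10405172526353847576878 0x102,
   Fam 0x103061517252735373846485667 0x103, Fam 0x10508131527344647565778 0x104, Fam 0x104172425353847566768 0x10506,
   Fam 0x10405172526353847576768 0x10708, Fam 0x104061725263538476768 0x11006, Fam 0x1040506172526353847576768 0x11108,
   Fam 0x10304061725263538476768 0x11206, Fam 0x1030406121317263847576768 0x11308, Fam 0x104051725263538476768 0x1140607,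
   Fam 0x10405061725263538476768 0x1140611, Fam 0x10406172526353847576768 0x1101408, Fam 0x1030406121726353847576768 0x1121408
   ]
  [0x17873487681313871753565000151351252726200027262000275356551710001627252657434000042461251,
   0x13571000471000474344642725200004252125135717200047172000300045172000265727112000300024686,
   0x17271120003000271313834803040753565514674866040307262120003420004726242741200035274000042,
   0x10004864674347535307131518172420003621200044080380500116560800500054080526272427242627131,
   0x11200028100037434388631718140753551718176466500017242000362120004764642725200006272520000,
   0x16572427112000281000362523080764638747135865175317242000052126562764642608005403034001000,
   0x10748343000104000057646053060800013001260804030340010000748343000107242125275000046487662,
   0x14265527500017500014030348005606275766500150001526576001076427565001500106562527576000176,
   0x17500055265627675426080050007000575766080050008001405000600017605608000130012600007751276,
   0x16562608005000800140500060001608048343005626552757600017576001500017600107642756500150010,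
   0x17646483475655105304080600008603000154000143080600500104080600565001300077551318176466530,
   0x180001105866080000800064834408060000886000131813448] no_parts
  [0x180] no_parts
  [0x13327148343746327848373327005700580055376537670057005400562708418541370057005837070054418,
   0x14268541332704370]]"

definition codes11 :: "int list" where
 "codes11 =
  [0x1524322001361614450728, 0x15256110140245232807, 0x1526010214451658682307,
   0x15277001021416234568, 0x152870010214452316, 0x15300114024547572316,
   0x15313220011416454768, 0x153241100223451647, 0x153301020323166714,
   0x153401022318381445165767, 0x1535010223183814164567, 0x153641100245252316673878,
   0x1537525441201023163867, 0x1538322001144516576738, 0x1540611002231445385867,
   0x15418332200114164567, 0x154201021416234567, 0x154323344110451678,
   0x15443220013616144578, 0x154561100214458773, 0x154641100223451678,
   0x1547411002234516, 0x1548010402451617, 0x155010022316174548, 0x155171761610025443,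
   0x155201021617672345, 0x1553200123161745, 0x1554545747480102231636,
   0x15554547574801022316, 0x155601022316454757, 0x15570102231636454758
   ]"

definition certs11 :: "cert list" where
 "certs11 =
 [Clique5 0x113578
  [0x17005700580053435652124147005627055234414],
  Clique5 0x103468
  [0x18511750075133511352235247005551185228524],
  Nice [0x12567, 0x13567] 0x1030405151718273746474856
  [0x1452104143360341832701362400572683422],
  Clique5 0x112578
  [0x17333700530057005552473818524241405262414],
  Clique5 0x124678
  [0x10520444735116525551124477525244775276527],
  Nice [0x10358, 0x10468, 0x10568, 0x10378, 0x10678] 0x1030615172838464856586778
  [0x15004250264165004641680050507050720053510852874017508540100055508],
  Clique5 0x103567
  [0x11081542765057427752785255527542700057427],
  Clique5 0x105678
  [0x12447651824478525344505307528344535315528],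
  Nice [0x10568, 0x12568, 0x13568, 0x10578, 0x12578, 0x13578] 0x105081718252835384647485657
  [0x145280517244745285511351835188511551125182518851165326530400565326530],
  Nice [] 0x103040508121324252836376878
  [],
  Nice [0x10356, 0x10357] 0x103081213152834464748565758
  [0x1800553767332737622682435226823738534],
  Nice [] 0x103040508121315242846475657
  [],
  Nice [0x11357, 0x11578] 0x104050607121524262736376878
  [0x1543520052005326883326418226834424536],
  Nice [0x12568] 0x103040508121315172428464756
  [0x1226884220005400575363413],
  System [0x10346, 0x10356, 0x10347, 0x11257, 0x10357, 0x11357, 0x10468, 0x12468, 0x11278, 0x10478,
   0x12478] 0x1
  [0x113478, 0x101578, 0x101378, 0x112347, 0x102568, 0x102578, 0x105678, 0x125678, 0x123457,
   0x123567, 0x123456, 0x102456, 0x102457, 0x123467, 0x102567, 0x124567]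
  [0x1415802673]
  [Fam 0x1030812131824464756576878 0x100, Fam 0x103081725283546475657 0x101, Fam 0x1040512151826273637486878 0x10405,
   Fam 0x1040506151826273637486878 0x10506, Fam 0x1040515182425273536376878 0x10507, Fam 0x104051518262736374856576878 0x11213,
   Fam 0x1040515182627363748566878 0x1121505, Fam 0x104051215182627363748576878 0x1131504,
   Fam 0x104051518242736374656576878 0x1131416, Fam 0x10405151824273637566878 0x111151605,
   Fam 0x1040515182427363746566878 0x114151605]
  [0x17274784870040881712128427334000303310000347303040871000131000003750636460408680535562821,
   0x13573710001310000566242523173710003710001000051717300037151317300017300033100007151523173,
   0x10001357300014262357305563646710001310000715131730001217300033100000535735271000251217304,
   0x17131357505000205517500022100032871520851752173343103700001047000013531700446363403050656,
   0x10668560562001562420016001103055600180668484262560305363400173400170305733431357570030400,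
   0x10104700334480535750002750002466256426836340306053575700002350503703475001606757000200002,
   0x17000160305357570000270750636685600040013560006355636066800150018060011750002703436066875,
   0x10535560004001335560500150011066848426256347075050022001703363505750002033670044842750551,
   0x15662466806000406626836033473354600223573460020340022460013730334356846066206360334465662,
   0x10017465605620015620016001134620017755121817004056268000856080668000400064842466806000408,
   0x10002218142780421757335700305713100035152624605560600143668280603080023002148080600230334,
   0x13606560014563403050636460005460007360005310334460662000736066828624881560005055200105662,
   0x15200140005055200106200210848054606363462000736680656085200106200232862488156000552001008,
   0x14834566252001400055200106200216252560010560014002156000552001052566200050010625600140021,
   0x15600054808065628625200100023340656340370053508715181000031000152517181733100033400007181,
   0x12848733100033400007008482875057303343534715181000031000152624606560008684606560500130004,
   0x14828] no_parts
  [0x180] no_parts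
  [0x14005300574226484844364145005237620052005537674223442044065360005541420055523637064843443,
   0x100054440753625234370],
  Clique5 0x112578
  [0x15005200520058535453765370005353865404540],
  Clique5 0x103468
  [0x10533450565058527052875288541048735313531],
  Clique5 0x103567
  [0x14448344620055528551244482525344685310528],
  Nice [0x10357, 0x10358] 0x103061213152634464748565758
  [0x1600544424414441422680537053775388538],
  Clique5 0x103468
  [0x12528250025132528552885416005551355283541],
  Clique5 0x103467
  [0x16005348830056527254335446545051455280542],
  Clique5 0x104678
  [0x10517651865286528651745324532054205424546],
  Clique5 0x135678
  [0x11532252825285543054705471532153325282528],
  Clique5 0x105678
  [0x18531751365135531654675464085008165467546],
  Clique5 0x103568
  [0x13530553072136085600455102005351020058513],
  Clique5 0x103468
  [0x12004153372148005655105142005351000810514],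
  Clique5 0x104678
  [0x10548251425143543054775471550055265467546],
  Nice [0x10358, 0x10378] 0x10306121315172656586778
  [0x1200483608360800583608360200572175217],
  Clique5 0x103568
  [0x12004738140048005851355542005851372180005],
  Nice [0x10348, 0x10358, 0x10468, 0x10568, 0x10378, 0x10678] 0x103061824252734353748586878
  [0x120044533553340047533800555514551455120055551455545515555455100057555],
  Nice [0x10357, 0x10348, 0x10378] 0x1030612131417264648576778
  [0x1600545265526553845384526552655384538555445544470]]"

definition codes12 :: "int list" where
 "codes12 =
  [0x1558010223163774456858]"

text \<open>The non-edges of this node form the 9-cycle 0-1-6-8-5-4-7-3-2. Its automorphism group is
  dihedral of order 18, and the 17 permutations listed are all its elements except the identity;
  they spread 19 colourings over their orbits. The 36 points all have five vertices.\<close>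

definition certs12 :: "cert list" where
 "certs12 =
 [System [0x10346, 0x10356, 0x11257, 0x10567, 0x12567, 0x11248, 0x10348, 0x11348, 0x11278] 0x1
  [0x112358, 0x123468, 0x102578, 0x102456, 0x112345, 0x112346, 0x102467, 0x102678, 0x101578,
   0x113578, 0x102468, 0x104678, 0x103678, 0x113456, 0x123456, 0x101345, 0x112356, 0x112456,
   0x101358, 0x101378, 0x101478, 0x102478, 0x124678, 0x101357, 0x103578, 0x113567, 0x112467,
   0x101246, 0x124568, 0x123467, 0x101235, 0x113457, 0x113568, 0x104578, 0x102378, 0x101678
   ]
  [0x1021654387, 0x1106847253, 0x1160274835, 0x1203758146, 0x1230185764, 0x1327486051, 0x1372068415,
   0x1457301826, 0x1475810362, 0x1548602713, 0x1584720631, 0x1618573042, 0x1681037524, 0x1734561280,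
   0x1743216508, 0x1856123407, 0x1865432170]
  [Fam 0x106081218263435485778 0x10001, Fam 0x106081215182634354648565778 0x10405, Fam 0x10608121824263435485778 0x1001124,
   Fam 0x1060812182426273435485778 0x1001107, Fam 0x10607081218242627343557 0x1000826, Fam 0x1060812151826343548565778 0x1041501,
   Fam 0x1060812182425343548576778 0x106280011, Fam 0x1060812151824263435485778 0x104171124,
   Fam 0x1060812151824262734355778 0x104172307, Fam 0x106081215182426273435485778 0x104171107,
   Fam 0x1060812182534354648576778 0x105031800, Fam 0x106081218242534354648576778 0x130032800,
   Fam 0x1060708141725262834353857 0x10518210226, Fam 0x106081518242627343548565778 0x11815113107,
   Fam 0x103040507131417252836384667 0x10415113107, Fam 0x1060814172528343538465767 0x10301312108,
   Fam 0x106081417242528343538465767 0x10311210824, Fam 0x1050608141725283435384667 0x10325013121,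
   Fam 0x105060814172526283435384667 0x11815250121]
  [0x13531038822053634464138481808044818420757780665671228271751526267650015650085512765625200,
   0x11511286762521134521728656211281134522244881562122888168821066551188833384112883228175703,
   0x18831053634464842046506625211250035676227520086522778080706004406002311720733060607116707,
   0x10878004433067800300822170665670708622752008652277800231167625265002127676506040778082242,
   0x133828830066527783448] tree_parts
  [0x10013882301270388220216051425080728808080102021268225808080801020212607288022301180808080,
   0x18080808080041517188205808080800415171825081122802838078080808080102021268225808080801020,
   0x12126071122808080808080808080808080808080808828] cover_parts
  [0x16005641374138005844374434005544334133443841320056443641344430005441320051443441304132443,
   0x120050005000524130443]]"

definition codes13 :: "int list" where
 "codes13 =
  [0x15601002233774451658, 0x156132200116474558, 0x1562010223164547, 0x1563780204012345,
   0x15640102233445165678, 0x156520012334451678, 0x1566010223164578, 0x15670102231645,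
   0x1568022301454667, 0x1570454820012367, 0x15710201234567, 0x157202012345,
   0x1573232701061645, 0x15740106162345, 0x15750106232745, 0x157601062345,
   0x157701234567, 0x1578012345, 0x15800123, 0x158101, 0x1582]"

text \<open>The \<open>System\<close> entry belongs to the non-edges 0-1-6-5-4-3-2 (a 7-cycle) and
  78, disjoint from it. The automorphism group of this graph has order 14 * 2 = 28, and the 27
  permutations listed are its elements except the identity. The final entries are the sparse cases,
  down to the node without any non-edge.\<close>

definition certs13 :: "cert list" where
 "certs13 =
 [Clique5 0x103468
  [0x16005541480051540200555381538554020050558],
  Clique5 0x103567
  [0x16005852770058541854505571560854555552560],
  Clique5 0x112578
  [0x10517054775471550554775472550055635613561],
  Nice [0x12467, 0x13467, 0x12567, 0x13567, 0x12468, 0x13468, 0x12568, 0x13568] 0x1050614151626272836373847485758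
  [0x1450114555543152815285455355345464547454735435528552825462547254715451545],
  System [0x11247, 0x11257, 0x10357, 0x11357, 0x10367, 0x10467, 0x12467, 0x11248, 0x11258, 0x10358,
   0x11358, 0x10368, 0x10468, 0x12468] 0x1
  [0x113467, 0x113468, 0x101457, 0x101458, 0x101347, 0x101348, 0x102457, 0x102458, 0x123567,
   0x123568, 0x112367, 0x112368, 0x102567, 0x102568, 0x113478, 0x101478, 0x113678, 0x104578,
   0x102578, 0x123678, 0x125678]
  [0x1012345687, 0x1021654378, 0x1021654387, 0x1106543278, 0x1106543287, 0x1160234578, 0x1160234587,
   0x1203456178, 0x1203456187, 0x1230165478, 0x1230165487, 0x1324561078, 0x1324561087, 0x1342016578,
   0x1342016587, 0x1435610278, 0x1435610287, 0x1453201678, 0x1453201687, 0x1546102378, 0x1546102387,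
   0x1564320178, 0x1564320187, 0x1615432078, 0x1615432087, 0x1651023478, 0x1651023487]
  [Fam 0x10306121326474857586768 0x10001, Fam 0x1030612131826474857586768 0x1000515, Fam 0x10304121318244757586768 0x100031615,
   Fam 0x1030612132628384748575867 0x10014172122, Fam 0x103040612131724263848575867 0x1021016151721
   ]
  [0x10884468606043824822676707405738131141282263503755852517172001751585251825835527275700013,
   0x17003713112147411447400711411177400527570711274260033747175311412725270037500367275355200,
   0x15100041252753526006470037572713112141114140067125258352672717570003470037411111411387400,
   0x16575000258353171757074527282122600021226728200130034820033000272820013360370753558813171,
   0x11412725251827400355131711272528214747211575835033673707574713151813151527282125131260002,
   0x11226728200130034820033000272820013517282001303368224268606811214743858355271141272755131,
   0x17336037005767003115272767370030575510400717500130500527531360370057512700503733104760013,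
   0x13603730576003376730076033111037300330551717514127252707504003652127275000475727600511273,
   0x13576361108006403353136761137720004033136727614811224267471583538030531517573063676707286,
   0x10000047076728600000675700503733104763636037305387686725200340002733872527686007500348676,
   0x10017003776003800020331867672004372521104006803317672388600420070860000735152727605387003,
   0x10486361148111186361107006503703136861136700304707672863673037538000003753138730017004273,
   0x10043000073380017730551520551527271761258727174242676527551063538030536737075738151753138,
   0x10370368611537003057538510486361148111175388636007500340331368611040551360338860065863811,
   0x10703311136380065753136037005700451815275717435733803053170050373310406763606360373053876,
   0x18626000238732676860017003886003700022476860017033176860042260070033186737600432600687600,
   0x10004768636730338310000033173380017004338004200007338001735380305737075867675700604747124,
   0x18100663111157431718100220032810031000071810022710424810046310063707152060474248111163111,
   0x14374360670040636317503867470730504067636763673380604817100220031710032000038817371001771,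
   0x10081004281717300227300800031717300327300430000063673712638810037811105006871732476047005,
   0x10681380066383611561115813800463836111200637005060636388126767073710038717411060411347400,
   0x17073000205707338718174367606862600020626768600170038860037000224768600177371055251813138,
   0x10335350338757073717206707674040035737400080400470436868124527172757476268604367335380305,
   0x17058114070060373350558381140053503733858003473315158004770063831583551057570513573030670,
   0x17674040035740008047673004703350486360335737051760002035851737031357505768604747000220535,
   0x17570004670067500661116750046067074002206703674360670040535727551580574585104862481035851,
   0x13835318252120636467073747675725212717414141271527400087476733531711211137100473100627335,
   0x13171122611357100080535737131767470724614717512753171730047127335361113006235730571004705,
   0x13573710008717370313575057212527535057026111005357570000870750035355200727500087514127252,
   0x17073743646267271125275350511477505315212140535383151367370125282767175747252140046002272,
   0x17414003106467472717552140046757071383136064670747673583505510512825251357571721476000274,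
   0x10046767174721475355100460022727414003174727114268252003814128226517470717238367635580503,
   0x13106707375467100320000700603737505587131720043717573053100327273000003753100437372460670,
   0x10303313558527173757276737036004200174606707375050036585282264606747076720314527558053573,
   0x17038760013811251580535383136757000527370760013583835367675707305715131120036000473700500,
   0x15170733171731251753573707636004276001770367500373505510535385136757000527370760013718112,
   0x138360646] no_parts
  [0x100020406081180808080808080] no_parts
  [0x16005244214423005754085404005044254422005754085400005344214427540854020054442754085403005,
   0x1754085407540854075408540],
  Clique5 0x103567
  [0x16005454430055541200505446541056415604560],
  Nice [0x10347, 0x10357, 0x10467, 0x10567, 0x10348, 0x10358, 0x10468, 0x10568] 0x10306141527283738464748565758
  [0x1600575637563300545634563256525652565256515653561356115653561356115651565],
  Clique5 0x112478
  [0x10517454725532553454715531553056205620566],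
  Clique5 0x113578
  [0x16472056205623561456225621561247275615561],
  Clique5 0x113568
  [0x14473156505621565356525623565756100055561],
  Clique5 0x113468
  [0x14474056705670566256725672566256845706570],
  Clique5 0x113678
  [0x14475056705670567256725672567257125712571],
  Clique5 0x103478
  [0x13552155175522570355600047005755600852005],
  Clique5 0x102478
  [0x10567056715711571457225732573457345732005],
  Clique5 0x113467
  [0x11567156225737567356265670573656275626567],
  Clique5 0x112467
  [0x11567156705740571457265670575656745756571],
  Clique5 0x102468
  [0x12571457165710576457165712576657145766576],
  Clique5 0x102467
  [0x12572457205760576457225762576457645760577],
  Clique5 0x145678
  [0x10578057805780578557855785578657865787578],
  Clique5 0x123456
  [0x10580058005800580358035803580458045805580],
  Clique5 0x101234
  [0x10581058105810581158115811581258125813581]]"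

section \<open>Evaluation of the certificates, each block using the nodes of the earlier
  ones\<close>

definition table1 :: trie where
  "table1 = empty_trie"

lemma checked1: "valid_all table1 codes1 certs1"
  by code_simp

definition table2 :: trie where
  "table2 = register_all codes1 table1"

lemma checked2: "valid_all table2 codes2 certs2"
  by code_simp

definition table3 :: trie where
  "table3 = register_all codes2 table2"

lemma checked3: "valid_all table3 codes3 certs3"
  by code_simp

definition table4 :: trie where
  "table4 = register_all codes3 table3"

lemma checked4: "valid_all table4 codes4 certs4"
  by code_simp

definition table5 :: trie where
  "table5 = register_all codes4 table4"

lemma checked5: "valid_all table5 codes5 certs5"
  by code_simp

definition table6 :: trie where
  "table6 = register_all codes5 table5"

lemma checked6: "valid_all table6 codes6 certs6"
  by code_simp

definition table7 :: trie where
  "table7 = register_all codes6 table6"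

lemma checked7: "valid_all table7 codes7 certs7"
  by code_simp

definition table8 :: trie where
  "table8 = register_all codes7 table7"

lemma checked8: "valid_all table8 codes8 certs8"
  by code_simp

definition table9 :: trie where
  "table9 = register_all codes8 table8"

lemma checked9: "valid_all table9 codes9 certs9"
  by code_simp

definition table10 :: trie where
  "table10 = register_all codes9 table9"

lemma checked10: "valid_all table10 codes10 certs10"
  by code_simp

definition table11 :: trie where
  "table11 = register_all codes10 table10"

lemma checked11: "valid_all table11 codes11 certs11"
  by code_simp

definition table12 :: trie where
  "table12 = register_all codes11 table11"

lemma checked12: "valid_all table12 codes12 certs12"
  by code_simp

definition table13 :: trie where
  "table13 = register_all codes12 table12"

lemma checked13: "valid_all table13 codes13 certs13"
  by code_simp

text \<open>Only the three digits of the index are left: the last node has no non-edges, so its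
  goodness concerns every graph on nine vertices.\<close>

lemma root_code: "hex 0x1582 = [V5, V8, V2]"
  by code_simp

lemma (in ramsey_split) good_nomat: "good nomat"
proof -
  have ok1: "trie_ok table1"
    unfolding table1_def by (rule trie_ok_empty)
  have ok2: "trie_ok table2"
    unfolding table2_def by (rule trie_ok_register_all[OF checked1 ok1])
  have ok3: "trie_ok table3"
    unfolding table3_def by (rule trie_ok_register_all[OF checked2 ok2])
  have ok4: "trie_ok table4"
    unfolding table4_def by (rule trie_ok_register_all[OF checked3 ok3])
  have ok5: "trie_ok table5"
    unfolding table5_def by (rule trie_ok_register_all[OF checked4 ok4])
  have ok6: "trie_ok table6"
    unfolding table6_def by (rule trie_ok_register_all[OF checked5 ok5])
  have ok7: "trie_ok table7"
    unfolding table7_def by (rule trie_ok_register_all[OF checked6 ok6])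
  have ok8: "trie_ok table8"
    unfolding table8_def by (rule trie_ok_register_all[OF checked7 ok7])
  have ok9: "trie_ok table9"
    unfolding table9_def by (rule trie_ok_register_all[OF checked8 ok8])
  have ok10: "trie_ok table10"
    unfolding table10_def by (rule trie_ok_register_all[OF checked9 ok9])
  have ok11: "trie_ok table11"
    unfolding table11_def by (rule trie_ok_register_all[OF checked10 ok10])
  have ok12: "trie_ok table12"
    unfolding table12_def by (rule trie_ok_register_all[OF checked11 ok11])
  have ok13: "trie_ok table13"
    unfolding table13_def by (rule trie_ok_register_all[OF checked12 ok12])
  have "0x1582 \<in> set codes13"
    by (simp add: codes13_def)
  from valid_all_good[OF checked13 ok13 this] show ?thesis
    by (simp add: root_code)
qed

section \<open>From the bound 20 to the independence number\<close>

theorem corollary7p6: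
  fixes G :: "'a pair_pre_digraph"
  assumes "pair_graph G"
    and "minimal_ramsey_3_3 G"
    and "clique_number G < 5"
    and "card (pverts G) \<ge> 30"
  shows "independence_number G \<le> card (pverts G) - 10"
proof (rule ccontr)
  interpret pair_graph G by (rule assms(1))
  assume *: "\<not> ?thesis"
  obtain S where S: "is_independent G S" "card S = independence_number G"
    using independence_number_attained[OF assms(1)] by blast
  have "card (pverts G) - 9 \<le> card S" using * S(2) by linarith
  \<comment> \<open>The enumeration needs exactly nine vertices outside, so the independent set is
    cut down to |V(G)| - 9 elements.\<close>
  then obtain A where A: "A \<subseteq> S" "card A = card (pverts G) - 9" "finite A"
    by (rule obtain_subset_with_card_n)
  have "is_independent G A" using S(1) A(1) unfolding is_independent_def by blast
  moreover have "card C \<noteq> 5" if "is_clique G C" for C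
    using clique_number_ge[OF assms(1) that] assms(3) by linarith
  ultimately interpret ramsey_split G A
    using assms(1,2) by unfold_locales auto
  have "A \<subseteq> pverts G" using A(1) S(1) unfolding is_independent_def by blast
  then have "card (pverts G - A) = 9" using A(2,3) assms(4) by (simp add: card_Diff_subset)
  moreover have "card (UNIV :: vx set) = 9"
  proof -
    have "card (set vxs) = length vxs" by (intro distinct_card) (simp add: vxs_def)
    then show ?thesis by (simp add: vxs_def[THEN arg_cong[where f=length]])
  qed
  ultimately obtain f where "bij_betw f (UNIV :: vx set) (pverts G - A)"
    using finite_same_card_bij[of "UNIV :: vx set" "pverts G - A"] finite_vx finite_verts by auto
  then have "card A \<le> 20"
    using good_nomat unfolding good_def labelling_def by auto
  \<comment> \<open>With at least 30 vertices, \<open>A\<close> has at least 21 elements.\<close>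
  with A(2) assms(4) show False by simp
qed

end
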